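(* Let $M$ be an almost-CR manifold and $\Omega$ an open subset of $M$. Assume that there are a CR function $f\in\mathcal{O}_M(\Omega)\cap C^2(\bar\Omega)$ and a point $p_0\in\partial\Omega$ such that: (a) $|f(p_0)|>|f(p)|$ for all $p\in\Omega$; (b) $\partial\Omega$ is (smooth and) $\Theta$-non-characteristic at $p_0$. Then there is $0\neq\xi\in H^0_{M,p_0}(\Omega)$ with $\mathcal{L}^{\partial\Omega}_\xi\geq0$.
   Context: An almost-CR manifold is a smooth real manifold $M$ with a smooth complex subbundle $T^{0,1}M\subset\mathbb{C}TM$ of constant rank such that $T^{0,1}M\cap\overline{T^{0,1}M}=0$; no formal integrability is required. $\mathcal{Z}$ is the sheaf of smooth sections of $T^{0,1}M$, $H_pM=\{\mathrm{Re}\,Z\mid Z\in T^{0,1}_pM\}$, $\pi_M:TM\to TM/HM$ the projection, ${T^*_p}^{1,0}M=\{\zeta\in\mathbb{C}T_p^*M\mid\zeta(Z)=0\ \forall Z\in T^{0,1}_pM\}$. $\mathcal{O}_M(\Omega)$ is the space of smooth functions $f$ on $\Omega$ with $Zf=0$ for all $Z\in\mathcal{Z}$. $H^{1,1}_pM$ is the convex hull of $\{Z_p\otimes\bar Z_p\mid Z_p\in T^{0,1}_pM\}$. The vector valued Levi form is the linear extension $\mathcal{L}:H^{1,1}M\to TM/HM$ of $Z_p\otimes\bar Z_p\mapsto-\pi_M(i[Z,\bar Z]_p)$, $Z\in\mathcal{Z}$. Put $[\ker\mathcal{L}]_p=\{\tau\in H^{1,1}_pM\mid\tau\ne0,\mathcal{L}(\tau)=0\}$;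 for $U$ open, $[\ker\mathcal{L}](U)$ is the set of sections $\tau$ over $U$ with $\tau_p\in[\ker\mathcal{L}]_p$ for all $p\in U$, locally of the form $\tau=\sum_{j=1}^rZ_j\otimes\bar Z_j$ with $Z_j\in\mathcal{Z}$. For such $\tau$, $\Theta(\tau)$ is the span of $Z_1,\dots,Z_r$ over smooth complex functions, and $\Theta=\bigcup_\tau\Theta(\tau)$ (over all local sections $\tau$ of $[\ker\mathcal{L}]$). A smooth hypersurface $N$ is $\Theta$-non-characteristic at $p_0\in N$ if $T_{p_0}N+\{\mathrm{Re}\,Z_{p_0}\mid Z\in\Theta\}=T_{p_0}M$. Let $N=\partial\Omega$ near $p_0$. Then $T^{0,1}_pN=T^{0,1}_pM\cap\mathbb{C}T_pN$ has constant rank for $p$ near $p_0$ in $N$; $H_pN$ is the set of real parts of $T^{0,1}_pN$, and $H^0_pN$ its annihilator in $T^*_pN$. For $\xi\in H^0_{p_0}N$, the scalar Levi form of $N$ is the Hermitian form $\mathcal{L}^{\partial\Omega}_\xi(Z_{p_0},\bar Z_{p_0})=-\langle\xi|i[Z,\bar Z]_{p_0}\rangle$ for smooth sections $Z$ of $T^{0,1}N$. If $\rho$ is a smooth defining function of $\Omega$ near $p_0$ ($\Omega=\{\rho<0\}$ near $p_0$, $d\rho(p_0)\ne0$), then $H^0_{M,p_0}(\Omega)=\bigcup_{\lambda>0}\{\xi|_{T_{p_0}N}\mid\xi\in T^*_{p_0}M,\ \lambda\,d\rho(p_0)+i\xi\in{T^*_{p_0}}^{1,0}M\}$, an open half-space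 of $H^0_{p_0}N$ independent of the choice of $\rho$. *)

theory Defs
  imports "HOL-Analysis.Analysis" "HOL-Library.Function_Algebras"
begin

section \<open>Pointwise vector space structure on functions\<close>

instantiation "fun" :: (type, real_vector) real_vector
begin

definition scaleR_fun_def: "t *\<^sub>R X = (\<lambda>f. t *\<^sub>R X f)"

instance
  by standard (simp_all add: scaleR_fun_def fun_eq_iff scaleR_add_right scaleR_add_left)

end

definition cscale :: "complex \<Rightarrow> ('b \<Rightarrow> complex) \<Rightarrow> ('b \<Rightarrow> complex)" where
  "cscale a X = (\<lambda>f. a * X f)"

interpretation cvec: vector_space cscale
  by standard (simp_all add: cscale_def fun_eq_iff algebra_simps)


section \<open>Smooth manifolds\<close>

text \<open>\<open>Ck_on k f S\<close>: \<open>f\<close> is of class \<open>C\<^sup>k\<close> on the open set \<open>S\<close>. In finite dimension it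
  is enough to iterate over directional derivatives.\<close>

primrec Ck_on :: "nat \<Rightarrow> ('e::real_normed_vector \<Rightarrow> 'b::real_normed_vector) \<Rightarrow> 'e set \<Rightarrow> bool" where
  "Ck_on 0 f S \<longleftrightarrow> continuous_on S f"
| "Ck_on (Suc k) f S \<longleftrightarrow> (\<forall>x\<in>S. f differentiable (at x)) \<and>
     (\<forall>v. Ck_on k (\<lambda>x. frechet_derivative f (at x) v) S)"

text \<open>A chart is given by its domain and its coordinate map. The manifold is the whole
  type \<open>'a\<close>; its dimension is \<open>CARD('n)\<close>.\<close>

type_synonym ('a, 'n) chart = "'a set \<times> ('a \<Rightarrow> real ^ 'n)"

definition chart_inv :: "('a, 'n) chart \<Rightarrow> real ^ 'n \<Rightarrow> 'a" where
  "chart_inv c = inv_into (fst c) (snd c)"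

definition smooth_manifold ::
  "('a::{t2_space,second_countable_topology}, 'n::finite) chart set \<Rightarrow> bool" where
  "smooth_manifold A \<longleftrightarrow>
     (\<Union>c\<in>A. fst c) = UNIV \<and>
     (\<forall>c\<in>A. open (fst c) \<and> open (snd c ` fst c) \<and>
        homeomorphism (fst c) (snd c ` fst c) (snd c) (chart_inv c)) \<and>
     (\<forall>c\<in>A. \<forall>d\<in>A. \<forall>k. Ck_on k (snd d \<circ> chart_inv c) (snd c ` (fst c \<inter> fst d)))"

definition Ck_fun ::
  "('a::topological_space, 'n::finite) chart set \<Rightarrow> nat \<Rightarrow> 'a set \<Rightarrow> ('a \<Rightarrow> complex) \<Rightarrow> bool" where
  "Ck_fun A k U f \<longleftrightarrow> open U \<and>
     (\<forall>c\<in>A. Ck_on k (f \<circ> chart_inv c) (snd c ` (U \<inter> fst c)))"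

definition smooth_fun ::
  "('a::topological_space, 'n::finite) chart set \<Rightarrow> 'a set \<Rightarrow> ('a \<Rightarrow> complex) \<Rightarrow> bool" where
  "smooth_fun A U f \<longleftrightarrow> (\<forall>k. Ck_fun A k U f)"

definition smooth_near ::
  "('a::topological_space, 'n::finite) chart set \<Rightarrow> 'a \<Rightarrow> ('a \<Rightarrow> complex) \<Rightarrow> bool" where
  "smooth_near A p f \<longleftrightarrow> (\<exists>U. p \<in> U \<and> smooth_fun A U f)"

text \<open>\<open>C\<^sup>2\<close> on an arbitrary (e.g. closed) set: locally the restriction of a \<open>C\<^sup>2\<close> function
  on an open set of the manifold.\<close>

definition C2_on_set ::
  "('a::topological_space, 'n::finite) chart set \<Rightarrow> 'a set \<Rightarrow> ('a \<Rightarrow> complex) \<Rightarrow> bool" where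
  "C2_on_set A S f \<longleftrightarrow>
     (\<forall>p\<in>S. \<exists>V g. p \<in> V \<and> Ck_fun A 2 V g \<and> (\<forall>q\<in>V \<inter> S. f q = g q))"


section \<open>Complex tangent vectors and vector fields\<close>

text \<open>A complex tangent vector at \<open>p\<close> is identified with the operator
  \<open>\<Sum>i. v\<^sub>i (\<partial>/\<partial>x\<^sub>i)\<close> at \<open>p\<close> on complex functions smooth near \<open>p\<close>; it is set to \<open>0\<close> on all
  other functions, so that equality of vectors is equality of functions.\<close>

type_synonym 'a cvec = "('a \<Rightarrow> complex) \<Rightarrow> complex"

definition coord_vec ::
  "('a::topological_space, 'n::finite) chart set \<Rightarrow> ('a, 'n) chart \<Rightarrow> 'a \<Rightarrow> complex ^ 'n \<Rightarrow> 'a cvec" where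
  "coord_vec A c p v = (\<lambda>f. if smooth_near A p f
     then (\<Sum>i\<in>UNIV. v $ i * frechet_derivative (f \<circ> chart_inv c) (at (snd c p)) (axis i 1))
     else 0)"

definition ctangent :: "('a::topological_space, 'n::finite) chart set \<Rightarrow> 'a \<Rightarrow> 'a cvec set" where
  "ctangent A p = {coord_vec A c p v | c v. c \<in> A \<and> p \<in> fst c}"

definition vconj :: "'a cvec \<Rightarrow> 'a cvec" where
  "vconj X = (\<lambda>f. cnj (X (\<lambda>q. cnj (f q))))"

definition vRe :: "'a cvec \<Rightarrow> 'a cvec" where
  "vRe X = (1/2) *\<^sub>R (X + vconj X)"

text \<open>The real tangent space is the set of real elements of its complexification.\<close>

definition tangent :: "('a::topological_space, 'n::finite) chart set \<Rightarrow> 'a \<Rightarrow> 'a cvec set" where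
  "tangent A p = {X \<in> ctangent A p. vconj X = X}"

definition smooth_field ::
  "('a::topological_space, 'n::finite) chart set \<Rightarrow> 'a set \<Rightarrow> ('a \<Rightarrow> 'a cvec) \<Rightarrow> bool" where
  "smooth_field A U Z \<longleftrightarrow> open U \<and> (\<forall>p\<in>U. Z p \<in> ctangent A p) \<and>
     (\<forall>V f. V \<subseteq> U \<longrightarrow> smooth_fun A V f \<longrightarrow> smooth_fun A V (\<lambda>p. Z p f))"

definition field_conj :: "('a \<Rightarrow> 'a cvec) \<Rightarrow> 'a \<Rightarrow> 'a cvec" where
  "field_conj Z = (\<lambda>p. vconj (Z p))"

definition bracket ::
  "('a::topological_space, 'n::finite) chart set \<Rightarrow> ('a \<Rightarrow> 'a cvec) \<Rightarrow> ('a \<Rightarrow> 'a cvec) \<Rightarrow> 'a \<Rightarrow> 'a cvec" where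
  "bracket A Z W p = (\<lambda>f. if smooth_near A p f
     then Z p (\<lambda>q. W q f) - W p (\<lambda>q. Z q f) else 0)"

text \<open>Complex covectors at \<open>p\<close> are the complex-linear functionals on \<open>ctangent A p\<close>; real covectors
  are those with real values on \<open>tangent A p\<close>. Only the values on \<open>ctangent A p\<close> matter.\<close>

definition real_covector ::
  "('a::topological_space, 'n::finite) chart set \<Rightarrow> 'a \<Rightarrow> ('a cvec \<Rightarrow> complex) \<Rightarrow> bool" where
  "real_covector A p \<xi> \<longleftrightarrow>
     (\<forall>X\<in>ctangent A p. \<forall>Y\<in>ctangent A p. \<xi> (X + Y) = \<xi> X + \<xi> Y) \<and>
     (\<forall>a. \<forall>X\<in>ctangent A p. \<xi> (cscale a X) = a * \<xi> X) \<and>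
     (\<forall>X\<in>tangent A p. \<xi> X \<in> \<real>)"

definition differential :: "('a \<Rightarrow> real) \<Rightarrow> 'a cvec \<Rightarrow> complex" where
  "differential \<rho> X = X (\<lambda>q. complex_of_real (\<rho> q))"


section \<open>Almost-CR manifolds\<close>

text \<open>\<open>T p\<close> is the fibre of \<open>T\<^sup>0\<^sup>,\<^sup>1M\<close> at \<open>p\<close>.\<close>

definition smooth_subbundle ::
  "('a::topological_space, 'n::finite) chart set \<Rightarrow> ('a \<Rightarrow> 'a cvec set) \<Rightarrow> bool" where
  "smooth_subbundle A T \<longleftrightarrow> (\<exists>m::nat. \<forall>p. \<exists>U E. p \<in> U \<and>
     (\<forall>j<m. smooth_field A U (E j)) \<and>
     (\<forall>q\<in>U. inj_on (\<lambda>j. E j q) {..<m} \<and> cvec.independent ((\<lambda>j. E j q) ` {..<m}) \<and>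
        T q = cvec.span ((\<lambda>j. E j q) ` {..<m})))"

definition almost_CR_manifold ::
  "('a::{t2_space,second_countable_topology}, 'n::finite) chart set \<Rightarrow> ('a \<Rightarrow> 'a cvec set) \<Rightarrow> bool" where
  "almost_CR_manifold A T \<longleftrightarrow> smooth_manifold A \<and> (\<forall>p. T p \<subseteq> ctangent A p) \<and>
     smooth_subbundle A T \<and> (\<forall>p. T p \<inter> vconj ` T p = {0})"

text \<open>The sheaf of smooth sections of \<open>T\<^sup>0\<^sup>,\<^sup>1M\<close>; values of a section off \<open>U\<close> are irrelevant.\<close>

definition CR_sections ::
  "('a::topological_space, 'n::finite) chart set \<Rightarrow> ('a \<Rightarrow> 'a cvec set) \<Rightarrow> 'a set \<Rightarrow> ('a \<Rightarrow> 'a cvec) set" where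
  "CR_sections A T U = {Z. smooth_field A U Z \<and> (\<forall>p\<in>U. Z p \<in> T p)}"

definition CR_functions ::
  "('a::topological_space, 'n::finite) chart set \<Rightarrow> ('a \<Rightarrow> 'a cvec set) \<Rightarrow> 'a set \<Rightarrow> ('a \<Rightarrow> complex) set" where
  "CR_functions A T \<Omega> = {f. smooth_fun A \<Omega> f \<and>
     (\<forall>U Z. U \<subseteq> \<Omega> \<longrightarrow> Z \<in> CR_sections A T U \<longrightarrow> (\<forall>p\<in>U. Z p f = 0))}"

definition HM :: "('a \<Rightarrow> 'a cvec set) \<Rightarrow> 'a \<Rightarrow> 'a cvec set" where
  "HM T p = vRe ` T p"

text \<open>The quotient \<open>T\<^sub>pM/H\<^sub>pM\<close> consists of cosets; \<open>proj_HM A T p 0\<close> is its zero.\<close>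

definition proj_HM ::
  "('a::topological_space, 'n::finite) chart set \<Rightarrow> ('a \<Rightarrow> 'a cvec set) \<Rightarrow> 'a \<Rightarrow> 'a cvec \<Rightarrow> 'a cvec set" where
  "proj_HM A T p X = {Y \<in> tangent A p. Y - X \<in> HM T p}"

text \<open>Annihilator of the \<open>(0,1)\<close>-vectors: the complex covectors of type \<open>(1,0)\<close>.\<close>

definition covector_10 :: "('a \<Rightarrow> 'a cvec set) \<Rightarrow> 'a \<Rightarrow> ('a cvec \<Rightarrow> complex) \<Rightarrow> bool" where
  "covector_10 T p \<zeta> \<longleftrightarrow> (\<forall>Z\<in>T p. \<zeta> Z = 0)"


section \<open>The vector valued Levi form\<close>

text \<open>Tensors are represented as bilinear operators: \<open>(X \<otimes> Y)(f, g) = X f \<cdot> Y g\<close>.\<close>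

type_synonym 'a ctensor = "('a \<Rightarrow> complex) \<Rightarrow> ('a \<Rightarrow> complex) \<Rightarrow> complex"

definition tensor :: "'a cvec \<Rightarrow> 'a cvec \<Rightarrow> 'a ctensor" where
  "tensor X Y = (\<lambda>f g. X f * Y g)"

definition H11 :: "('a \<Rightarrow> 'a cvec set) \<Rightarrow> 'a \<Rightarrow> 'a ctensor set" where
  "H11 T p = convex hull {tensor Z (vconj Z) | Z. Z \<in> T p}"

text \<open>The linear extension of \<open>Z\<^sub>p \<otimes> conj Z\<^sub>p \<mapsto> - \<pi>(i[Z, conj Z]\<^sub>p)\<close>. The coset does not depend on
  the chosen representation of \<open>\<tau>\<close>, whence the definite description.\<close>

definition vector_levi ::
  "('a::topological_space, 'n::finite) chart set \<Rightarrow> ('a \<Rightarrow> 'a cvec set) \<Rightarrow> 'a \<Rightarrow> 'a ctensor \<Rightarrow> 'a cvec set" where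
  "vector_levi A T p \<tau> = (THE c. \<exists>(r::nat) t Z U. p \<in> U \<and> (\<forall>j<r. Z j \<in> CR_sections A T U) \<and>
     \<tau> = (\<Sum>j<r. t j *\<^sub>R tensor (Z j p) (vconj (Z j p))) \<and>
     c = proj_HM A T p (\<Sum>j<r. t j *\<^sub>R (- cscale \<i> (bracket A (Z j) (field_conj (Z j)) p))))"

definition ker_levi_at ::
  "('a::topological_space, 'n::finite) chart set \<Rightarrow> ('a \<Rightarrow> 'a cvec set) \<Rightarrow> 'a \<Rightarrow> 'a ctensor set" where
  "ker_levi_at A T p = {\<tau> \<in> H11 T p. \<tau> \<noteq> 0 \<and> vector_levi A T p \<tau> = proj_HM A T p 0}"

definition represents ::
  "('a::topological_space, 'n::finite) chart set \<Rightarrow> ('a \<Rightarrow> 'a cvec set) \<Rightarrow> 'a set \<Rightarrow>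
     ('a \<Rightarrow> 'a ctensor) \<Rightarrow> nat \<Rightarrow> (nat \<Rightarrow> 'a \<Rightarrow> 'a cvec) \<Rightarrow> bool" where
  "represents A T V \<tau> r Z \<longleftrightarrow> (\<forall>j<r. Z j \<in> CR_sections A T V) \<and>
     (\<forall>q\<in>V. \<tau> q = (\<Sum>j<r. tensor (Z j q) (vconj (Z j q))))"

definition ker_levi ::
  "('a::topological_space, 'n::finite) chart set \<Rightarrow> ('a \<Rightarrow> 'a cvec set) \<Rightarrow> 'a set \<Rightarrow> ('a \<Rightarrow> 'a ctensor) set" where
  "ker_levi A T U = {\<tau>. open U \<and> (\<forall>p\<in>U. \<tau> p \<in> ker_levi_at A T p) \<and>
     (\<forall>p\<in>U. \<exists>V r Z. open V \<and> p \<in> V \<and> V \<subseteq> U \<and> represents A T V \<tau> r Z)}"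

text \<open>Sections over \<open>V\<close> of \<open>\<Theta>(\<tau>)\<close> and of \<open>\<Theta>\<close>; \<open>\<tau>\<close> ranges over all local sections.\<close>

definition Theta_of ::
  "('a::topological_space, 'n::finite) chart set \<Rightarrow> ('a \<Rightarrow> 'a cvec set) \<Rightarrow> ('a \<Rightarrow> 'a ctensor) \<Rightarrow>
     'a set \<Rightarrow> ('a \<Rightarrow> 'a cvec) set" where
  "Theta_of A T \<tau> V = {W. \<exists>r Z a. represents A T V \<tau> r Z \<and> (\<forall>j<r. smooth_fun A V (a j)) \<and>
     (\<forall>q\<in>V. W q = (\<Sum>j<r. cscale (a j q) (Z j q)))}"

definition Theta ::
  "('a::topological_space, 'n::finite) chart set \<Rightarrow> ('a \<Rightarrow> 'a cvec set) \<Rightarrow> 'a set \<Rightarrow> ('a \<Rightarrow> 'a cvec) set" where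
  "Theta A T V = (\<Union>U\<in>{U. open V \<and> V \<subseteq> U}. \<Union>\<tau>\<in>ker_levi A T U. Theta_of A T \<tau> V)"


section \<open>Hypersurfaces\<close>

text \<open>\<open>\<complex>T\<^sub>pN\<close> for an embedded submanifold \<open>N\<close>: the vectors that annihilate all smooth functions
  vanishing on \<open>N\<close> near \<open>p\<close>.\<close>

definition ctangent_sub ::
  "('a::topological_space, 'n::finite) chart set \<Rightarrow> 'a set \<Rightarrow> 'a \<Rightarrow> 'a cvec set" where
  "ctangent_sub A N p = {X \<in> ctangent A p.
     \<forall>g. smooth_near A p g \<longrightarrow> (\<forall>\<^sub>F q in nhds p. q \<in> N \<longrightarrow> g q = 0) \<longrightarrow> X g = 0}"

definition tangent_sub ::
  "('a::topological_space, 'n::finite) chart set \<Rightarrow> 'a set \<Rightarrow> 'a \<Rightarrow> 'a cvec set" where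
  "tangent_sub A N p = tangent A p \<inter> ctangent_sub A N p"

definition Theta_noncharacteristic ::
  "('a::topological_space, 'n::finite) chart set \<Rightarrow> ('a \<Rightarrow> 'a cvec set) \<Rightarrow> 'a set \<Rightarrow> 'a \<Rightarrow> bool" where
  "Theta_noncharacteristic A T N p \<longleftrightarrow>
     {X + vRe (W p) | X W. X \<in> tangent_sub A N p \<and> (\<exists>V. p \<in> V \<and> W \<in> Theta A T V)} = tangent A p"

text \<open>The existence of a defining function at \<open>p\<close> says that \<open>\<partial>\<Omega>\<close> is smooth near \<open>p\<close>, with
  \<open>\<Omega>\<close> on one side of it.\<close>

definition defining_function ::
  "('a::topological_space, 'n::finite) chart set \<Rightarrow> 'a set \<Rightarrow> 'a \<Rightarrow> ('a \<Rightarrow> real) \<Rightarrow> bool" where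
  "defining_function A \<Omega> p \<rho> \<longleftrightarrow>
     (\<exists>U. p \<in> U \<and> smooth_fun A U (\<lambda>q. complex_of_real (\<rho> q)) \<and> \<Omega> \<inter> U = {q \<in> U. \<rho> q < 0}) \<and>
     (\<exists>X\<in>tangent A p. differential \<rho> X \<noteq> 0)"

text \<open>\<open>H\<^sup>0\<^sub>M\<^sub>,\<^sub>p(\<Omega>)\<close>, computed with the defining function \<open>\<rho>\<close>. Real covectors on \<open>\<partial>\<Omega>\<close> are represented
  by their complex-linear extensions to the complexified tangent space of \<open>\<partial>\<Omega>\<close>.\<close>

definition H0_M ::
  "('a::topological_space, 'n::finite) chart set \<Rightarrow> ('a \<Rightarrow> 'a cvec set) \<Rightarrow> 'a set \<Rightarrow> 'a \<Rightarrow> ('a \<Rightarrow> real) \<Rightarrow>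
     ('a cvec \<Rightarrow> complex) set" where
  "H0_M A T \<Omega> p \<rho> =
     {restrict \<xi> (ctangent_sub A (frontier \<Omega>) p) | \<xi>. real_covector A p \<xi> \<and>
        (\<exists>\<mu>>0. covector_10 T p (\<lambda>X. complex_of_real \<mu> * differential \<rho> X + \<i> * \<xi> X))}"

text \<open>Smooth sections near \<open>N\<close> of \<open>T\<^sup>0\<^sup>,\<^sup>1N = T\<^sup>0\<^sup>,\<^sup>1M \<inter> \<complex>TN\<close> are given by smooth extensions to open
  sets of the manifold (arbitrary off \<open>N\<close>); brackets may be computed with such extensions.\<close>

definition CR_sections_sub ::
  "('a::topological_space, 'n::finite) chart set \<Rightarrow> ('a \<Rightarrow> 'a cvec set) \<Rightarrow> 'a set \<Rightarrow> 'a set \<Rightarrow>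
     ('a \<Rightarrow> 'a cvec) set" where
  "CR_sections_sub A T N U =
     {Z. smooth_field A U Z \<and> (\<forall>p\<in>U \<inter> N. Z p \<in> T p \<inter> ctangent_sub A N p)}"

text \<open>\<open>i[Z, conj Z]\<close> is a real vector, so its pairing with a real covector is a real number.\<close>

definition scalar_levi ::
  "('a::topological_space, 'n::finite) chart set \<Rightarrow> 'a \<Rightarrow> ('a cvec \<Rightarrow> complex) \<Rightarrow> ('a \<Rightarrow> 'a cvec) \<Rightarrow> real" where
  "scalar_levi A p \<xi> Z = - Re (\<xi> (cscale \<i> (bracket A Z (field_conj Z) p)))"

definition scalar_levi_nonneg ::
  "('a::topological_space, 'n::finite) chart set \<Rightarrow> ('a \<Rightarrow> 'a cvec set) \<Rightarrow> 'a set \<Rightarrow> 'a \<Rightarrow>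
     ('a cvec \<Rightarrow> complex) \<Rightarrow> bool" where
  "scalar_levi_nonneg A T N p \<xi> \<longleftrightarrow>
     (\<forall>U Z. p \<in> U \<longrightarrow> Z \<in> CR_sections_sub A T N U \<longrightarrow> 0 \<le> scalar_levi A p \<xi> Z)"

end

theory Submission
  imports Defs
begin

text \<open>After dividing by \<open>f p0\<close>, the function \<open>u = Re f - 1\<close> is negative on \<open>\<Omega>\<close> and vanishes at \<open>p0\<close>. A section
  \<open>\<tau> = \<Sum> Z\<^sub>j \<otimes> conj Z\<^sub>j\<close> of the kernel of the Levi form says that \<open>- i \<Sum> [Z\<^sub>j, conj Z\<^sub>j] = Re W\<close> with \<open>W\<close> in
  \<open>T\<close>; since \<open>Z\<^sub>j f = W f = 0\<close>, it follows that \<open>u\<close> solves the degenerate elliptic real equation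
  \<open>\<Sum> ((Re Z\<^sub>j)\<^sup>2 + (Im Z\<^sub>j)\<^sup>2) u - (1/2) Im W u = 0\<close>. As the boundary is non-characteristic for it, the Hopf
  lemma gives \<open>du = \<mu> d\<rho>\<close> at \<open>p0\<close> with \<open>\<mu> > 0\<close>, so \<open>\<xi> = d (Im f)\<close> is the required covector. It does not
  vanish on the boundary because \<open>\<mu> d\<rho> + i \<xi>\<close> kills \<open>T\<close>, while \<open>d\<rho>\<close> does not. Finally, \<open>u\<close> restricted to
  the boundary is maximal at \<open>p0\<close>, and for a section \<open>Z\<close> of \<open>T\<close> tangent to the boundary the Levi form is
  \<open>- 2 ((Re Z)\<^sup>2 + (Im Z)\<^sup>2) u \<ge> 0\<close> at \<open>p0\<close>.\<close>


section \<open>Second order conditions on hypersurfaces\<close>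

text \<open>The kernel condition is pointwise: at each point it yields some \<open>W\<close> in
  \<open>T\<close> whose real part is prescribed by the sections \<open>Z j\<close>, and nothing
  provides a continuous choice of \<open>W\<close>. So the Hopf lemma is proved for first order
  coefficients that are merely bounded. The bound comes from \<open>T\<close> meeting its conjugate
  only in 0: near \<open>p0\<close> the imaginary part of a vector of \<open>T\<close> is controlled
  by its real part. To exploit the kernel condition at all, the Levi form, given by a definite
  description, has to be shown independent of the representing sections. Both facts rest on the
  closedness of the bundle \<open>T\<close> under limits (\<open>TC_limit\<close>).

  The other obstacle is the boundary. \<open>f\<close> is CR only inside \<Omega>, and its C^2
  extension \<open>g\<close> is arbitrary outside the closure; so the second order equation is used
  on \<Omega> only, and the first order one on the closure. The hypersurface is given as the
  topological frontier of \<Omega>: instead of straightening it, tangent directions are reached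
  through short segments that must cross it.\<close>

definition has_derivs2 ::
  "('e::real_normed_vector \<Rightarrow> 'b::real_normed_vector) \<Rightarrow> ('e \<Rightarrow> 'e \<Rightarrow> 'b) \<Rightarrow> ('e \<Rightarrow> 'e \<Rightarrow> 'e \<Rightarrow> 'b) \<Rightarrow> 'e set \<Rightarrow> bool" where
  "has_derivs2 f f' f'' S \<longleftrightarrow> (\<forall>x\<in>S. (f has_derivative f' x) (at x) \<and>
     (\<forall>w. ((\<lambda>y. f' y w) has_derivative (\<lambda>v. f'' x v w)) (at x)))"

lemma has_derivs2D:
  assumes "has_derivs2 f f' f'' S" "x \<in> S"
  shows "(f has_derivative f' x) (at x)" "((\<lambda>y. f' y w) has_derivative (\<lambda>v. f'' x v w)) (at x)"
  using assms by (auto simp: has_derivs2_def)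

lemma has_derivs2_subset: "has_derivs2 f f' f'' S \<Longrightarrow> S' \<subseteq> S \<Longrightarrow> has_derivs2 f f' f'' S'"
  by (auto simp: has_derivs2_def)

lemma has_derivs2_add:
  assumes "has_derivs2 f f' f'' S" "has_derivs2 g g' g'' S"
  shows "has_derivs2 (\<lambda>x. f x + g x) (\<lambda>x v. f' x v + g' x v) (\<lambda>x v w. f'' x v w + g'' x v w) S"
  using assms unfolding has_derivs2_def by (auto intro!: has_derivative_add)

lemma has_derivs2_cmult:
  fixes f :: "'e::real_normed_vector \<Rightarrow> real"
  assumes "has_derivs2 f f' f'' S"
  shows "has_derivs2 (\<lambda>x. a * f x) (\<lambda>x v. a * f' x v) (\<lambda>x v w. a * f'' x v w) S"
  using assms unfolding has_derivs2_def by (auto intro!: derivative_eq_intros)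

lemma has_derivs2_power2:
  fixes f :: "'e::real_normed_vector \<Rightarrow> real"
  assumes "has_derivs2 f f' f'' S"
  shows "has_derivs2 (\<lambda>x. (f x)\<^sup>2) (\<lambda>x v. 2 * f x * f' x v)
    (\<lambda>x v w. 2 * f' x v * f' x w + 2 * f x * f'' x v w) S"
  unfolding has_derivs2_def
proof (intro ballI conjI allI)
  fix x assume x: "x \<in> S"
  note d = has_derivs2D[OF assms x]
  show "((\<lambda>x. (f x)\<^sup>2) has_derivative (\<lambda>v. 2 * f x * f' x v)) (at x)"
    using has_derivative_mult[OF d(1) d(1)] by (simp add: power2_eq_square algebra_simps)
  fix w
  show "((\<lambda>y. 2 * f y * f' y w) has_derivative (\<lambda>v. 2 * f' x v * f' x w + 2 * f x * f'' x v w)) (at x)"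
    using has_derivative_mult[OF has_derivative_mult_right[OF d(1), of 2] d(2)[of w]]
    by (simp add: algebra_simps)
qed

lemma has_derivs2_norm_square:
  fixes x0 :: "'e::real_inner"
  shows "has_derivs2 (\<lambda>x. (x - x0) \<bullet> (x - x0)) (\<lambda>x v. 2 * ((x - x0) \<bullet> v)) (\<lambda>x v w. 2 * (v \<bullet> w)) S"
  unfolding has_derivs2_def
  by (auto intro!: derivative_eq_intros simp: inner_commute)

lemma LIMSEQ_1_over_Suc: "(\<lambda>n. 1 / real (Suc n)) \<longlonglongrightarrow> 0"
  using LIMSEQ_inverse_real_of_nat by (simp add: inverse_eq_divide)

text \<open>The direction \<open>y n\<close> varies with the step because a boundary point near
  \<open>x\<close> need not lie on the line through \<open>x\<close> along \<open>v\<close>; later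
  the \<open>y n\<close> are chosen so that every test point is on the hypersurface.\<close>

lemma has_derivative_sequence:
  fixes f :: "'e::real_normed_vector \<Rightarrow> 'b::real_normed_vector"
  assumes f: "(f has_derivative f') (at x)" and t: "t \<longlonglongrightarrow> 0" "\<And>n. 0 < t n" and y: "y \<longlonglongrightarrow> v"
  shows "(\<lambda>n. (f (x + t n *\<^sub>R y n) - f x) /\<^sub>R t n) \<longlonglongrightarrow> f' v"
proof -
  interpret bounded_linear f' using f by (rule has_derivative_bounded_linear)
  let ?q = "\<lambda>n. (f (x + t n *\<^sub>R y n) - f x) /\<^sub>R t n"
  have "(\<lambda>n. ?q n - f' (y n)) \<longlonglongrightarrow> 0"
  proof (rule tendstoI)
    fix e :: real assume "e > 0"
    define e' where "e' = e / (2 * (norm v + 1))"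
    have "e' > 0" using \<open>e > 0\<close> norm_ge_zero[of v] unfolding e'_def
      by (smt (verit) divide_pos_pos)
    then obtain d where d: "d > 0"
      "\<And>z. norm (z - x) < d \<Longrightarrow> norm (f z - f x - f' (z - x)) \<le> e' * norm (z - x)"
      using f unfolding has_derivative_at_alt by blast
    have "(\<lambda>n. t n *\<^sub>R y n) \<longlonglongrightarrow> 0 *\<^sub>R v" using t y by (intro tendsto_intros)
    then have ev1: "\<forall>\<^sub>F n in sequentially. norm (t n *\<^sub>R y n) < d"
      using d(1) by (auto dest: tendstoD simp: dist_norm)
    have ev2: "\<forall>\<^sub>F n in sequentially. norm (y n) < norm v + 1"
      using tendsto_norm[OF y] by (rule order_tendstoD) simp
    show "\<forall>\<^sub>F n in sequentially. dist (?q n - f' (y n)) 0 < e"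
      using ev1 ev2
    proof eventually_elim
      case (elim n)
      have tn: "t n > 0" by fact
      have "?q n - f' (y n) = (f (x + t n *\<^sub>R y n) - f x - f' (t n *\<^sub>R y n)) /\<^sub>R t n"
        using tn by (simp add: scaleR_diff_right scaleR scale_right_diff_distrib)
      then have "norm (?q n - f' (y n)) = norm (f (x + t n *\<^sub>R y n) - f x - f' (t n *\<^sub>R y n)) / t n"
        using tn by (simp add: divide_inverse mult.commute)
      also have "\<dots> \<le> (e' * norm (t n *\<^sub>R y n)) / t n"
        using d(2)[of "x + t n *\<^sub>R y n"] elim(1) tn by (intro divide_right_mono) auto
      also have "\<dots> = e' * norm (y n)" using tn by simp
      also have "\<dots> \<le> e' * (norm v + 1)" using elim(2) \<open>e' > 0\<close> by (intro mult_left_mono) auto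
      also have "\<dots> = e / 2"
      proof -
        have "norm v + 1 \<noteq> 0" using norm_ge_zero[of v] by linarith
        then show ?thesis unfolding e'_def by (simp add: field_simps)
      qed
      also have "\<dots> < e" using \<open>e > 0\<close> by simp
      finally show ?case by simp
    qed
  qed
  from tendsto_add[OF this tendsto[OF y]] show ?thesis by simp
qed

text \<open>Only the first-order expansion of the derivative is used: by the mean value theorem the
  increment is \<open>\<theta> t\<^sup>2 (h'' x v v + o(1))\<close> with \<open>\<theta> > 0\<close>. The direction may vary with the step, so
  that the test points can be taken on a hypersurface.\<close>

lemma second_order_necessary:
  fixes h :: "'e::euclidean_space \<Rightarrow> real"
  assumes S: "open S" "x \<in> S" and h: "has_derivs2 h h' h'' S" and crit: "\<And>v. h' x v = 0"
    and t: "t \<longlonglongrightarrow> 0" "\<And>n. 0 < t n" and y: "y \<longlonglongrightarrow> v"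
    and le: "\<forall>\<^sub>F n in sequentially. h (x + t n *\<^sub>R y n) \<le> h x"
  shows "h'' x v v \<le> 0"
proof -
  obtain d where d: "d > 0" "ball x d \<subseteq> S" using S by (meson openE)
  define good where "good n \<longleftrightarrow> norm (t n *\<^sub>R y n) < d \<and> h (x + t n *\<^sub>R y n) \<le> h x" for n
  have "(\<lambda>n. t n *\<^sub>R y n) \<longlonglongrightarrow> 0 *\<^sub>R v" using t y by (intro tendsto_intros)
  then have "\<forall>\<^sub>F n in sequentially. norm (t n *\<^sub>R y n) < d"
    using d(1) by (auto dest: tendstoD simp: dist_norm)
  with le have good: "\<forall>\<^sub>F n in sequentially. good n"
    by eventually_elim (simp add: good_def)
  have ex: "\<exists>\<theta>. 0 < \<theta> \<and> \<theta> \<le> 1 \<and> (good n \<longrightarrow> h' (x + (\<theta> * t n) *\<^sub>R y n) (y n) \<le> 0)" for n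
  proof (cases "good n")
    case True
    define \<phi> where "\<phi> s = h (x + s *\<^sub>R (t n *\<^sub>R y n))" for s
    define \<phi>' where "\<phi>' s = (\<lambda>a. h' (x + s *\<^sub>R (t n *\<^sub>R y n)) (a *\<^sub>R (t n *\<^sub>R y n)))" for s
    have in_S: "x + s *\<^sub>R (t n *\<^sub>R y n) \<in> S" if "0 \<le> s" "s \<le> 1" for s
    proof -
      have "norm (s *\<^sub>R (t n *\<^sub>R y n)) \<le> 1 * norm (t n *\<^sub>R y n)"
        unfolding norm_scaleR[of s] using that by (intro mult_right_mono) auto
      then show ?thesis using True d(2) by (force simp: good_def dist_norm)
    qed
    have der: "(\<phi> has_derivative \<phi>' s) (at s)" if "0 \<le> s" "s \<le> 1" for s
    proof -
      have "((\<lambda>s. x + s *\<^sub>R (t n *\<^sub>R y n)) has_derivative (\<lambda>a. a *\<^sub>R (t n *\<^sub>R y n))) (at s)"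
        by (auto intro!: derivative_eq_intros)
      then have "(h \<circ> (\<lambda>s. x + s *\<^sub>R (t n *\<^sub>R y n)) has_derivative
          h' (x + s *\<^sub>R (t n *\<^sub>R y n)) \<circ> (\<lambda>a. a *\<^sub>R (t n *\<^sub>R y n))) (at s)"
        by (rule diff_chain_at) (rule has_derivs2D(1)[OF h in_S[OF that]])
      then show ?thesis unfolding \<phi>_def \<phi>'_def o_def .
    qed
    have "\<exists>\<theta>\<in>{0<..<1}. \<phi> 1 - \<phi> 0 = \<phi>' \<theta> (1 - 0)"
      by (rule mvt_simple[of 0 1 \<phi> \<phi>']) (simp_all add: has_derivative_at_withinI der)
    then obtain \<theta> where \<theta>: "0 < \<theta>" "\<theta> < 1" "\<phi> 1 - \<phi> 0 = \<phi>' \<theta> 1" by auto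
    have "linear (h' (x + \<theta> *\<^sub>R (t n *\<^sub>R y n)))"
      using \<theta> by (intro has_derivative_linear[OF has_derivs2D(1)[OF h in_S]]) auto
    then have "\<phi>' \<theta> 1 = t n * h' (x + (\<theta> * t n) *\<^sub>R y n) (y n)"
      by (simp add: \<phi>'_def linear_scale)
    moreover have "\<phi> 1 - \<phi> 0 \<le> 0" using True by (simp add: good_def \<phi>_def)
    ultimately have "h' (x + (\<theta> * t n) *\<^sub>R y n) (y n) \<le> 0"
      using \<theta>(3) t(2)[of n] by (simp add: mult_le_0_iff)
    then show ?thesis using \<theta> by (intro exI[of _ \<theta>]) auto
  qed (auto intro!: exI[of _ 1])
  then obtain \<theta> where \<theta>: "\<And>n. 0 < \<theta> n" "\<And>n. \<theta> n \<le> 1"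
    and le0: "\<And>n. good n \<Longrightarrow> h' (x + (\<theta> n * t n) *\<^sub>R y n) (y n) \<le> 0"
    by metis
  define k where "k n = \<theta> n * t n" for n
  have k0: "0 < k n" for n using \<theta> t by (simp add: k_def)
  have k: "k \<longlonglongrightarrow> 0"
    by (rule tendsto_sandwich[OF _ _ tendsto_const t(1)])
      (use \<theta> t in \<open>auto simp: k_def mult_le_cancel_right1 intro!: always_eventually less_imp_le\<close>)
  have lim: "(\<lambda>n. h' (x + k n *\<^sub>R y n) w / k n) \<longlonglongrightarrow> h'' x v w" for w
    using has_derivative_sequence[OF has_derivs2D(2)[OF h S(2)] k k0 y, of w]
    by (simp add: crit divide_inverse mult.commute)
  \<comment> \<open>The quotients are known to converge for each fixed direction only. Hence
    \<open>y n\<close> is split into \<open>v\<close> and the basis expansion of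
    \<open>y n - v\<close>, whose coefficients tend to 0.\<close>
  have "(\<lambda>n. h' (x + k n *\<^sub>R y n) v / k n + (\<Sum>b\<in>Basis. ((y n - v) \<bullet> b) * (h' (x + k n *\<^sub>R y n) b / k n)))
    \<longlonglongrightarrow> h'' x v v + (\<Sum>b\<in>Basis. ((v - v) \<bullet> b) * h'' x v b)"
    by (intro tendsto_intros lim y)
  moreover have "\<forall>\<^sub>F n in sequentially. h' (x + k n *\<^sub>R y n) v / k n
      + (\<Sum>b\<in>Basis. ((y n - v) \<bullet> b) * (h' (x + k n *\<^sub>R y n) b / k n)) \<le> 0"
    using good
  proof eventually_elim
    case (elim n)
    have "norm (k n *\<^sub>R y n) \<le> norm (t n *\<^sub>R y n)"
      using \<theta>[of n] t(2)[of n] mult_right_mono[of "\<theta> n" 1 "t n * norm (y n)"]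
      by (simp add: k_def abs_mult mult.assoc)
    then have "x + k n *\<^sub>R y n \<in> S" using elim d(2) by (force simp: good_def dist_norm)
    then have lin: "linear (h' (x + k n *\<^sub>R y n))"
      by (rule has_derivative_linear[OF has_derivs2D(1)[OF h]])
    have "h' (x + k n *\<^sub>R y n) (y n - v) = h' (x + k n *\<^sub>R y n) (\<Sum>b\<in>Basis. ((y n - v) \<bullet> b) *\<^sub>R b)"
      by (simp add: euclidean_representation)
    also have "\<dots> = (\<Sum>b\<in>Basis. ((y n - v) \<bullet> b) * h' (x + k n *\<^sub>R y n) b)"
      using lin by (simp add: linear_sum linear_scale)
    finally have "(\<Sum>b\<in>Basis. ((y n - v) \<bullet> b) * (h' (x + k n *\<^sub>R y n) b / k n))
      = h' (x + k n *\<^sub>R y n) (y n - v) / k n" by (simp add: sum_divide_distrib)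
    then have "h' (x + k n *\<^sub>R y n) v / k n
      + (\<Sum>b\<in>Basis. ((y n - v) \<bullet> b) * (h' (x + k n *\<^sub>R y n) b / k n)) = h' (x + k n *\<^sub>R y n) (y n) / k n"
      using lin by (simp add: linear_diff add_divide_distrib[symmetric])
    also have "\<dots> \<le> 0" using le0[OF elim] k0[of n] by (simp add: k_def divide_le_0_iff)
    finally show ?case .
  qed
  ultimately have "h'' x v v + (\<Sum>b\<in>Basis. ((v - v) \<bullet> b) * h'' x v b) \<le> 0"
    by (rule tendsto_upperbound) simp
  then show ?thesis by simp
qed

text \<open>Stand-in for the implicit function theorem: this crossing property is the only geometric
  information on \<open>N\<close> from which tangent directions are produced. That \<open>r\<close>
  vanishes on \<open>N\<close> is assumed separately where it matters.\<close>

definition separates :: "'e::real_vector set \<Rightarrow> 'e set \<Rightarrow> ('e \<Rightarrow> real) \<Rightarrow> bool" where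
  "separates N S r \<longleftrightarrow> (\<forall>a b. closed_segment a b \<subseteq> S \<longrightarrow> r a < 0 \<longrightarrow> 0 < r b \<longrightarrow> closed_segment a b \<inter> N \<noteq> {})"

text \<open>With \<open>v\<close> tangent and \<open>w\<close> transverse, \<open>r\<close> has
  opposite signs at the two ends \<open>x + t (v - \<delta> w)\<close> and
  \<open>x + t (v + \<delta> w)\<close> once \<open>t\<close> is small, so the segment between them
  meets \<open>N\<close>. Its points are \<open>x + t y\<close> with \<open>y\<close> no farther
  from \<open>v\<close> than the norm of \<open>\<delta> w\<close>, and \<delta> is as small as
  desired.\<close>

lemma separates_tangent_sequence:
  fixes r :: "'e::real_normed_vector \<Rightarrow> real"
  assumes S: "open S" "x \<in> S" and N: "separates N S r" and r: "(r has_derivative r') (at x)" "r x = 0"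
    and w: "r' w \<noteq> 0" and v: "r' v = 0"
  obtains t y where "t \<longlonglongrightarrow> 0" "\<And>n::nat. (0::real) < t n" "y \<longlonglongrightarrow> v" "\<And>n. x + t n *\<^sub>R y n \<in> N"
proof -
  interpret bounded_linear r' using r(1) by (rule has_derivative_bounded_linear)
  obtain R where R: "R > 0" "ball x R \<subseteq> S" using S by (meson openE)
  have ex: "\<exists>t y. 0 < t \<and> t < e \<and> norm (y - v) < e \<and> x + t *\<^sub>R y \<in> N" if "e > 0" for e :: real
  proof -
    \<comment> \<open>The sign makes \<open>\<delta> * r' w\<close> positive, the size keeps the
      norm of \<open>\<delta> w\<close> at most \<open>e / 2\<close>.\<close>
    define \<delta> where "\<delta> = sgn (r' w) * (e / (2 * (norm w + 1)))"
    have nz: "norm w + 1 > 0" using norm_ge_zero[of w] by linarith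
    have \<delta>w: "norm (\<delta> *\<^sub>R w) < e"
    proof -
      have "norm (\<delta> *\<^sub>R w) = e / (2 * (norm w + 1)) * norm w"
        using w \<open>e > 0\<close> nz by (simp add: \<delta>_def abs_mult abs_sgn_eq)
      also have "\<dots> \<le> e / (2 * (norm w + 1)) * (norm w + 1)"
        using \<open>e > 0\<close> nz by (intro mult_left_mono) auto
      also have "\<dots> = e / 2" using nz by (simp add: field_simps)
      also have "\<dots> < e" using \<open>e > 0\<close> by simp
      finally show ?thesis .
    qed
    have pos: "0 < \<delta> * r' w"
    proof -
      have "\<delta> * r' w = \<bar>r' w\<bar> * (e / (2 * (norm w + 1)))"
        unfolding \<delta>_def abs_sgn[of "r' w"] by (simp only: mult_ac)
      then show ?thesis using w \<open>e > 0\<close> nz by (simp del: mult_eq_0_iff)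
    qed
    define t where "t n = 1 / real (Suc n)" for n
    have t: "t \<longlonglongrightarrow> 0" "\<And>n. 0 < t n"
      using LIMSEQ_1_over_Suc by (simp_all add: t_def[abs_def])
    have quot: "(\<lambda>n. r (x + t n *\<^sub>R (v + s *\<^sub>R w)) / t n) \<longlonglongrightarrow> s * r' w" for s
      using has_derivative_sequence[OF r(1) t tendsto_const, of "v + s *\<^sub>R w"] r(2) v
      by (simp add: add scaleR divide_inverse mult.commute)
    have ev1: "\<forall>\<^sub>F n in sequentially. 0 < r (x + t n *\<^sub>R (v + \<delta> *\<^sub>R w)) / t n"
      using quot pos by (rule order_tendstoD)
    have ev2: "\<forall>\<^sub>F n in sequentially. r (x + t n *\<^sub>R (v - \<delta> *\<^sub>R w)) / t n < 0"
      using order_tendstoD(2)[OF quot[of "- \<delta>"], of 0] pos by simp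
    have ev3: "\<forall>\<^sub>F n in sequentially. t n < e" using t(1) \<open>e > 0\<close> by (rule order_tendstoD)
    have "(\<lambda>n. t n * (norm v + e)) \<longlonglongrightarrow> 0 * (norm v + e)" by (intro tendsto_intros t)
    then have ev4: "\<forall>\<^sub>F n in sequentially. t n * (norm v + e) < R"
      using R(1) by (intro order_tendstoD(2)) auto
    from ev1 ev2 ev3 ev4 have "\<forall>\<^sub>F n in sequentially. \<exists>t y. 0 < t \<and> t < e \<and> norm (y - v) < e \<and> x + t *\<^sub>R y \<in> N"
    proof eventually_elim
      case (elim n)
      let ?a = "x + t n *\<^sub>R (v - \<delta> *\<^sub>R w)" and ?b = "x + t n *\<^sub>R (v + \<delta> *\<^sub>R w)"
      have seg: "\<exists>y. z = x + t n *\<^sub>R y \<and> norm (y - v) < e" if z: "z \<in> closed_segment ?a ?b" for z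
      proof -
        obtain s where s: "0 \<le> s" "s \<le> 1" "z = (1 - s) *\<^sub>R ?a + s *\<^sub>R ?b"
          using z by (auto simp: in_segment)
        have 1: "z = x + t n *\<^sub>R (v + (2 * s - 1) *\<^sub>R (\<delta> *\<^sub>R w))"
          unfolding s(3) by (simp add: algebra_simps scaleR_add_left[symmetric])
        have "norm ((2 * s - 1) *\<^sub>R (\<delta> *\<^sub>R w)) \<le> 1 * norm (\<delta> *\<^sub>R w)"
          unfolding norm_scaleR[of "2 * s - 1"] using s by (intro mult_right_mono) auto
        then have "norm ((2 * s - 1) *\<^sub>R (\<delta> *\<^sub>R w)) < e" using \<delta>w by linarith
        then show ?thesis using 1 by (intro exI[of _ "v + (2 * s - 1) *\<^sub>R (\<delta> *\<^sub>R w)"]) auto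
      qed
      have "closed_segment ?a ?b \<subseteq> S"
      proof
        fix z assume "z \<in> closed_segment ?a ?b"
        then obtain y where y: "z = x + t n *\<^sub>R y" "norm (y - v) < e" using seg by blast
        have "norm y \<le> norm v + e" using y(2) norm_triangle_sub[of y v] by linarith
        then have "t n * norm y \<le> t n * (norm v + e)" using t(2)[of n] by (intro mult_left_mono) auto
        then have "t n * norm y < R" using elim(4) by linarith
        then have "z \<in> ball x R" using y(1) t(2)[of n] by (simp add: dist_norm)
        then show "z \<in> S" using R(2) by blast
      qed
      moreover have "r ?a < 0" using elim(2) t(2)[of n] by (simp add: divide_less_0_iff)
      moreover have "0 < r ?b" using elim(1) t(2)[of n] by (simp add: zero_less_divide_iff)
      ultimately obtain z where "z \<in> closed_segment ?a ?b" "z \<in> N"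
        using N unfolding separates_def by blast
      then show ?case using seg t(2)[of n] elim(3) by blast
    qed
    then show ?thesis by (auto dest: eventually_happens'[OF sequentially_bot])
  qed
  have "\<forall>n. \<exists>t y. 0 < t \<and> t < 1 / real (Suc n) \<and> norm (y - v) < 1 / real (Suc n) \<and> x + t *\<^sub>R y \<in> N"
    using ex by auto
  then obtain t y where ty: "\<And>n. 0 < t n \<and> t n < 1 / real (Suc n) \<and> norm (y n - v) < 1 / real (Suc n) \<and> x + t n *\<^sub>R y n \<in> N"
    by metis
  have "t \<longlonglongrightarrow> 0"
    by (rule tendsto_sandwich[OF _ _ tendsto_const LIMSEQ_1_over_Suc]) (use ty in \<open>auto intro!: always_eventually less_imp_le\<close>)
  moreover have "(\<lambda>n. norm (y n - v)) \<longlonglongrightarrow> 0"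
    by (rule tendsto_sandwich[OF _ _ tendsto_const LIMSEQ_1_over_Suc]) (use ty in \<open>auto intro!: always_eventually less_imp_le\<close>)
  then have "y \<longlonglongrightarrow> v" by (simp add: LIM_zero_iff tendsto_norm_zero_iff)
  ultimately show ?thesis using that ty by blast
qed

text \<open>Serves both boundary conditions below: \<open>P\<close> says that a value is 0, or that
  it is at most \<open>\<phi> x\<close>.\<close>

lemma tangent_difference_quotients:
  fixes r :: "'e::real_normed_vector \<Rightarrow> real" and \<phi> :: "'e \<Rightarrow> 'b::real_normed_vector"
  assumes "open S" "x \<in> S" "separates N S r" "(r has_derivative r') (at x)" "r x = 0" "r' w \<noteq> 0" "r' v = 0"
    and \<phi>: "(\<phi> has_derivative \<phi>') (at x)" and P: "\<forall>\<^sub>F y in nhds x. y \<in> N \<longrightarrow> P (\<phi> y)"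
  obtains t d where "\<And>n::nat. (0::real) < t n" "(\<lambda>n. (d n - \<phi> x) /\<^sub>R t n) \<longlonglongrightarrow> \<phi>' v"
    "\<forall>\<^sub>F n in sequentially. P (d n)"
proof -
  obtain t y where ty: "t \<longlonglongrightarrow> 0" "\<And>n. (0::real) < t n" "y \<longlonglongrightarrow> v" "\<And>n. x + t n *\<^sub>R y n \<in> N"
    using separates_tangent_sequence[OF assms(1-7)] by metis
  have "(\<lambda>n. x + t n *\<^sub>R y n) \<longlonglongrightarrow> x + 0 *\<^sub>R v" by (intro tendsto_intros ty)
  then have lim: "filterlim (\<lambda>n. x + t n *\<^sub>R y n) (nhds x) sequentially" by simp
  have "\<forall>\<^sub>F n in sequentially. P (\<phi> (x + t n *\<^sub>R y n))"
    using eventually_compose_filterlim[OF P lim] ty(4) by simp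
  then show ?thesis by (rule that[OF ty(2) has_derivative_sequence[OF \<phi> ty(1-3)]])
qed

lemma derivative_tangent_eq_0:
  fixes r :: "'e::real_normed_vector \<Rightarrow> real" and \<phi> :: "'e \<Rightarrow> 'b::real_normed_vector"
  assumes "open S" "x \<in> S" "separates N S r" "(r has_derivative r') (at x)" "r x = 0" "r' w \<noteq> 0" "r' v = 0"
    and \<phi>: "(\<phi> has_derivative \<phi>') (at x)" and zero: "\<phi> x = 0" "\<forall>\<^sub>F y in nhds x. y \<in> N \<longrightarrow> \<phi> y = 0"
  shows "\<phi>' v = 0"
proof -
  obtain t d where d: "(\<lambda>n::nat. (d n - \<phi> x) /\<^sub>R t n) \<longlonglongrightarrow> \<phi>' v" "\<forall>\<^sub>F n in sequentially. d n = 0"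
    by (rule tangent_difference_quotients[where P = "\<lambda>y. y = 0", OF assms(1-8,10)]) (rule that)
  have "\<forall>\<^sub>F n in sequentially. (d n - \<phi> x) /\<^sub>R t n = 0" using d(2) by eventually_elim (simp add: zero)
  from LIMSEQ_unique[OF d(1) tendsto_eventually[OF this]] show ?thesis .
qed

lemma derivative_tangent_le_0:
  fixes r \<phi> :: "'e::real_normed_vector \<Rightarrow> real"
  assumes "open S" "x \<in> S" "separates N S r" "(r has_derivative r') (at x)" "r x = 0" "r' w \<noteq> 0" "r' v = 0"
    and \<phi>: "(\<phi> has_derivative \<phi>') (at x)" and max: "\<forall>\<^sub>F y in nhds x. y \<in> N \<longrightarrow> \<phi> y \<le> \<phi> x"
  shows "\<phi>' v \<le> 0"
proof -
  obtain t d where d: "\<And>n::nat. 0 < t n" "(\<lambda>n. (d n - \<phi> x) /\<^sub>R t n) \<longlonglongrightarrow> \<phi>' v"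
    "\<forall>\<^sub>F n in sequentially. d n \<le> \<phi> x"
    by (rule tangent_difference_quotients[where P = "\<lambda>y. y \<le> \<phi> x", OF assms]) (rule that)
  have "\<forall>\<^sub>F n in sequentially. (d n - \<phi> x) /\<^sub>R t n \<le> 0"
    using d(3) by eventually_elim (use d(1) in \<open>simp add: mult_le_0_iff less_imp_le\<close>)
  then show ?thesis using d(2) by (intro tendsto_upperbound[of _ "\<phi>' v"]) auto
qed

text \<open>Subtracting a suitable multiple of \<open>w\<close> makes any \<open>v\<close> tangent;
  the inequality for a tangent vector and for its negative then gives an equality.\<close>

lemma lagrange_multiplier:
  fixes r \<phi> :: "'e::real_normed_vector \<Rightarrow> real"
  assumes "open S" "x \<in> S" "separates N S r" "(r has_derivative r') (at x)" "r x = 0" "r' w \<noteq> 0"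
    and \<phi>: "(\<phi> has_derivative \<phi>') (at x)" and max: "\<forall>\<^sub>F y in nhds x. y \<in> N \<longrightarrow> \<phi> y \<le> \<phi> x"
  shows "\<phi>' v = \<phi>' w / r' w * r' v"
proof -
  interpret r: bounded_linear r' using assms(4) by (rule has_derivative_bounded_linear)
  interpret \<phi>: bounded_linear \<phi>' using \<phi> by (rule has_derivative_bounded_linear)
  have le: "\<phi>' v \<le> 0" if "r' v = 0" for v
    using derivative_tangent_le_0[OF assms(1-6) that \<phi> max] .
  let ?v = "v - (r' v / r' w) *\<^sub>R w"
  have "r' ?v = 0" using assms(6) by (simp add: r.diff r.scaleR)
  then have "\<phi>' ?v \<le> 0" "\<phi>' (- ?v) \<le> 0" using le by (auto simp only: r.neg intro!: le)
  then have "\<phi>' ?v = 0" unfolding \<phi>.neg by linarith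
  then show ?thesis by (simp add: \<phi>.diff \<phi>.scaleR)
qed


section \<open>The Hopf lemma\<close>

text \<open>The barrier is \<open>- \<sigma> + M \<sigma>\<^sup>2\<close> for a defining function \<open>\<sigma>\<close> whose domain touches the boundary
  of \<open>{r < 0}\<close> only at \<open>x0\<close>; of the ellipticity of the operator only the normal
  direction at \<open>x0\<close> is used.\<close>

lemma hopf_boundary_point:
  fixes u r :: "'e::euclidean_space \<Rightarrow> real" and v :: "'j \<Rightarrow> 'e \<Rightarrow> 'e" and b :: "'e \<Rightarrow> 'e"
  assumes S: "open S" "x0 \<in> S" and u: "has_derivs2 u u' u'' S" and r: "has_derivs2 r r' r'' S"
    and r0: "r x0 = 0" and neg: "\<And>x. x \<in> S \<Longrightarrow> r x < 0 \<Longrightarrow> u x < u x0"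
    and eq: "\<And>x. x \<in> S \<Longrightarrow> r x < 0 \<Longrightarrow> (\<Sum>j\<in>I. u'' x (v j x) (v j x)) + u' x (b x) = 0"
    and bnd: "\<And>x. x \<in> S \<Longrightarrow> \<bar>(\<Sum>j\<in>I. r'' x (v j x) (v j x)) + r' x (b x)\<bar> \<le> B"
      "\<And>x. x \<in> S \<Longrightarrow> (\<Sum>j\<in>I. v j x \<bullet> v j x) \<le> B" "\<And>x. x \<in> S \<Longrightarrow> norm (b x) \<le> B"
    and cont: "\<And>j. j \<in> I \<Longrightarrow> isCont (v j) x0" "\<And>j. j \<in> I \<Longrightarrow> isCont (\<lambda>x. r' x (v j x)) x0"
    and I: "finite I" "k \<in> I" "r' x0 (v k x0) \<noteq> 0"
    and w: "r' x0 w < 0"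
  shows "u' x0 w < 0"
proof -
  define \<sigma> where "\<sigma> x = r x + (x - x0) \<bullet> (x - x0)" for x
  define \<sigma>' where "\<sigma>' x v = r' x v + 2 * ((x - x0) \<bullet> v)" for x v
  define \<sigma>'' where "\<sigma>'' x v w = r'' x v w + 2 * (v \<bullet> w)" for x v w
  have \<sigma>: "has_derivs2 \<sigma> \<sigma>' \<sigma>'' S"
    unfolding \<sigma>_def[abs_def] \<sigma>'_def[abs_def] \<sigma>''_def[abs_def]
    by (intro has_derivs2_add r has_derivs2_norm_square)
  define P\<sigma> where "P\<sigma> x = (\<Sum>j\<in>I. \<sigma>'' x (v j x) (v j x)) + \<sigma>' x (b x)" for x
  define a where "a x = (\<Sum>j\<in>I. (\<sigma>' x (v j x))\<^sup>2)" for x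
  \<comment> \<open>On the unit ball about \<open>x0\<close> the modulus of \<open>P\<sigma>\<close>
    is at most 5 times that of \<open>B\<close>: once for \<open>r\<close>, twice for the Hessian
    and twice for the gradient of the squared distance. The 1 makes \<open>C\<close>
    positive.\<close>
  define C where "C = 5 * \<bar>B\<bar> + 1"
  define c where "c = a x0 / 2"
  \<comment> \<open>Near \<open>x0\<close> one has \<open>a x > c\<close> and the product of
    \<open>\<sigma> x\<close> and \<open>P\<sigma> x\<close> is at most \<open>c / 2\<close> in
    modulus. So the operator on the barrier is at least \<open>- C - M * c + 2 * M * c\<close>,
    which this choice makes equal to 1.\<close>
  define M where "M = (C + 1) / c"
  have C: "C > 0" by (simp add: C_def)
  have "0 < (\<sigma>' x0 (v k x0))\<^sup>2" using I(3) by (simp add: \<sigma>'_def)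
  also have "\<dots> \<le> a x0" unfolding a_def using I by (intro member_le_sum) auto
  finally have c: "c > 0" by (simp add: c_def)
  have M: "M > 0" "M * c = C + 1" using C c by (auto simp: M_def)
  have P\<sigma>_bound: "\<bar>P\<sigma> x\<bar> \<le> C" if x: "x \<in> S" "norm (x - x0) \<le> 1" for x
  proof -
    have "P\<sigma> x = ((\<Sum>j\<in>I. r'' x (v j x) (v j x)) + r' x (b x)) + 2 * (\<Sum>j\<in>I. v j x \<bullet> v j x) + 2 * ((x - x0) \<bullet> b x)"
      by (simp add: P\<sigma>_def \<sigma>''_def \<sigma>'_def sum.distrib sum_distrib_left)
    moreover have "0 \<le> (\<Sum>j\<in>I. v j x \<bullet> v j x)" by (intro sum_nonneg) auto
    moreover have "\<bar>(x - x0) \<bullet> b x\<bar> \<le> \<bar>B\<bar>"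
    proof -
      have "\<bar>(x - x0) \<bullet> b x\<bar> \<le> norm (x - x0) * norm (b x)" by (rule Cauchy_Schwarz_ineq2)
      also have "\<dots> \<le> 1 * \<bar>B\<bar>" using x bnd(3)[OF x(1)] by (intro mult_mono) auto
      finally show ?thesis by simp
    qed
    ultimately show ?thesis using bnd(1,2)[OF x(1)] unfolding C_def by linarith
  qed
  have \<sigma>0: "\<sigma> x0 = 0" by (simp add: \<sigma>_def r0)
  have \<sigma>_diff: "\<sigma> differentiable at x" if "x \<in> S" for x
    using has_derivs2D(1)[OF \<sigma> that] by (auto simp: differentiable_def)
  then have \<sigma>_isCont: "isCont \<sigma> x" if "x \<in> S" for x
    using that differentiable_imp_continuous_within by blast
  have u_isCont: "isCont u x" if "x \<in> S" for x
    using has_derivs2D(1)[OF u that] has_derivative_continuous by blast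
  have "isCont a x0" unfolding a_def[abs_def] \<sigma>'_def[abs_def] by (intro continuous_intros cont)
  then have ev1: "\<forall>\<^sub>F x in at x0. c < a x" unfolding isCont_def
    by (rule order_tendstoD) (use c in \<open>auto simp: c_def\<close>)
  have "(\<sigma> \<longlongrightarrow> 0) (at x0)" using \<sigma>_isCont[OF S(2)] \<sigma>0 by (simp add: isCont_def)
  then have ev2: "\<forall>\<^sub>F x in at x0. dist (\<sigma> x) 0 < c / (2 * C)"
    by (rule tendstoD) (use c C in auto)
  have ev3: "\<forall>\<^sub>F x in at x0. x \<in> S" using S eventually_at_in_open' by blast
  from ev1 ev2 ev3 have "\<forall>\<^sub>F x in at x0. x \<in> S \<and> c < a x \<and> \<bar>\<sigma> x\<bar> < c / (2 * C)"
    by eventually_elim auto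
  then obtain d where d: "d > 0" "\<And>x. x \<noteq> x0 \<Longrightarrow> dist x x0 < d \<Longrightarrow> x \<in> S \<and> c < a x \<and> \<bar>\<sigma> x\<bar> < c / (2 * C)"
    unfolding eventually_at by auto
  have d': "x \<in> S \<and> c < a x \<and> \<bar>\<sigma> x\<bar> < c / (2 * C)" if "norm (x - x0) < d" for x
    using that S c C d(2)[of x] \<sigma>0 by (cases "x = x0") (auto simp: c_def dist_norm)
  define R where "R = min 1 (d / 2)"
  have R: "0 < R" "R \<le> 1" "R < d" using d(1) by (auto simp: R_def)
  have R': "x \<in> S \<and> c < a x \<and> \<bar>\<sigma> x\<bar> < c / (2 * C)" if "x \<in> cball x0 R" for x
    using d'[of x] R that by (auto simp: dist_norm norm_minus_commute)
  define V where "V x = - \<sigma> x + M * (\<sigma> x)\<^sup>2" for x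
  define V' where "V' x w = - \<sigma>' x w + M * (2 * \<sigma> x * \<sigma>' x w)" for x w
  define V'' where "V'' x y w = - \<sigma>'' x y w + M * (2 * \<sigma>' x y * \<sigma>' x w + 2 * \<sigma> x * \<sigma>'' x y w)" for x y w
  have V: "has_derivs2 V V' V'' S"
    using has_derivs2_add[OF has_derivs2_cmult[OF \<sigma>, of "-1"] has_derivs2_cmult[OF has_derivs2_power2[OF \<sigma>], of M]]
    unfolding V_def[abs_def] V'_def[abs_def] V''_def[abs_def] by simp
  have PV: "0 < (\<Sum>j\<in>I. V'' x (v j x) (v j x)) + V' x (b x)" if x: "x \<in> cball x0 R" for x
  proof -
    have "(\<Sum>j\<in>I. V'' x (v j x) (v j x)) = - (\<Sum>j\<in>I. \<sigma>'' x (v j x) (v j x))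
        + 2 * M * a x + 2 * M * \<sigma> x * (\<Sum>j\<in>I. \<sigma>'' x (v j x) (v j x))"
      by (simp add: V''_def a_def sum.distrib sum_subtractf sum_distrib_left algebra_simps power2_eq_square)
    then have "(\<Sum>j\<in>I. V'' x (v j x) (v j x)) + V' x (b x) = - P\<sigma> x + 2 * M * (\<sigma> x * P\<sigma> x) + 2 * M * a x"
      by (simp add: P\<sigma>_def V'_def algebra_simps)
    moreover have "\<bar>P\<sigma> x\<bar> \<le> C" using P\<sigma>_bound[of x] R'[OF x] x R by (auto simp: dist_norm norm_minus_commute)
    moreover have "\<bar>\<sigma> x * P\<sigma> x\<bar> \<le> c / 2"
    proof -
      have "\<bar>\<sigma> x * P\<sigma> x\<bar> \<le> c / (2 * C) * C" unfolding abs_mult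
        using R'[OF x] \<open>\<bar>P\<sigma> x\<bar> \<le> C\<close> c C by (intro mult_mono) auto
      then show ?thesis using C by simp
    qed
    then have "2 * M * (\<sigma> x * P\<sigma> x) \<ge> 2 * M * (- (c / 2))"
      using M(1) by (intro mult_left_mono) auto
    moreover have "2 * M * a x \<ge> 2 * M * c" using R'[OF x] M(1) by (intro mult_left_mono) auto
    moreover have "2 * M * (- (c / 2)) + 2 * M * c = C + 1"
      using M(2) by (simp add: algebra_simps)
    ultimately show ?thesis by linarith
  qed
  have V_isCont: "isCont V x" if "x \<in> S" for x
    using has_derivs2D(1)[OF V that] has_derivative_continuous by blast
  let ?K = "cball x0 R \<inter> {x. \<sigma> x \<le> 0}"
  have \<sigma>_cont: "continuous_on (cball x0 R) \<sigma>"
    using R' \<sigma>_isCont by (auto intro!: continuous_at_imp_continuous_on)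
  have K: "compact ?K"
  proof -
    have "closed ?K"
      using continuous_closed_preimage[OF \<sigma>_cont closed_cball, of "{..0}"] by (simp add: vimage_def)
    moreover have "bounded ?K" by (rule bounded_subset[OF bounded_cball]) auto
    ultimately show ?thesis by (simp add: compact_eq_bounded_closed)
  qed
  have x0K: "x0 \<in> ?K" using R \<sigma>0 by simp
  \<comment> \<open>The squared distance added to \<open>r\<close> pushes the set where \<sigma>
    \<le> 0 into \<open>r < 0\<close>, except for \<open>x0\<close> itself; there \<open>u\<close>
    is strictly below \<open>u x0\<close>.\<close>
  have inside: "r x < 0" if "x \<noteq> x0" "\<sigma> x \<le> 0" for x
  proof -
    have "(x - x0) \<bullet> (x - x0) > 0" using that by simp
    then show ?thesis using that(2) unfolding \<sigma>_def by linarith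
  qed
  \<comment> \<open>This part of the sphere is compact and avoids \<open>x0\<close>, so
    \<open>u\<close> stays below \<open>u x0\<close> by a fixed gap; \<epsilon> is such that the
    barrier takes at most half of that gap.\<close>
  obtain \<epsilon> where \<epsilon>: "\<epsilon> > 0" "\<And>x. x \<in> ?K \<Longrightarrow> norm (x - x0) = R \<Longrightarrow> u x + \<epsilon> * V x < u x0"
  proof -
    let ?L = "?K \<inter> sphere x0 R"
    have L: "compact ?L" by (rule compact_Int[OF K compact_sphere])
    show ?thesis
    proof (cases "?L = {}")
      case True
      have "norm (x - x0) \<noteq> R" if "x \<in> ?K" for x
      proof
        assume "norm (x - x0) = R"
        then have "x \<in> ?L" using that by (simp add: dist_norm norm_minus_commute)
        then show False using True by blast
      qed
      then show ?thesis using that[of 1] by auto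
    next
      case False
      have L_S: "x \<in> S" if "x \<in> ?L" for x using R'[of x] that by auto
      have "continuous_on ?L u" using L_S u_isCont by (auto intro!: continuous_at_imp_continuous_on)
      from continuous_attains_sup[OF L False this] obtain y where
        y: "y \<in> ?L" "\<And>x. x \<in> ?L \<Longrightarrow> u x \<le> u y" by blast
      have "y \<noteq> x0" using y(1) R by auto
      then have uy: "u y < u x0" using y(1) L_S by (intro neg inside) auto
      have "continuous_on ?L V" using L_S V_isCont by (auto intro!: continuous_at_imp_continuous_on)
      from continuous_attains_sup[OF L False this] obtain z where
        z: "z \<in> ?L" "\<And>x. x \<in> ?L \<Longrightarrow> V x \<le> V z" by blast
      define \<epsilon> where "\<epsilon> = (u x0 - u y) / (2 * (\<bar>V z\<bar> + 1))"
      have \<epsilon>: "\<epsilon> > 0" using uy by (simp add: \<epsilon>_def)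
      show ?thesis
      proof (rule that[OF \<epsilon>])
        fix x assume "x \<in> ?K" "norm (x - x0) = R"
        then have x: "x \<in> ?L" by (auto simp: dist_norm norm_minus_commute)
        have "\<epsilon> * V x \<le> \<epsilon> * (\<bar>V z\<bar> + 1)" using z(2)[OF x] \<epsilon> by (intro mult_left_mono) auto
        also have "\<dots> = (u x0 - u y) / 2"
          unfolding \<epsilon>_def by (simp add: field_simps add_nonneg_eq_0_iff)
        finally show "u x + \<epsilon> * V x < u x0" using y(2)[OF x] uy by (simp add: field_simps)
      qed
    qed
  qed
  define h where "h x = u x + \<epsilon> * V x" for x
  define h' where "h' x w = u' x w + \<epsilon> * V' x w" for x w
  define h'' where "h'' x y w = u'' x y w + \<epsilon> * V'' x y w" for x y w
  have h: "has_derivs2 h h' h'' S"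
    unfolding h_def[abs_def] h'_def[abs_def] h''_def[abs_def]
    by (intro has_derivs2_add has_derivs2_cmult u V)
  \<comment> \<open>Where \<sigma> is 0 the barrier vanishes, and on the sphere \<epsilon> was
    chosen for this bound. A larger value would therefore be taken at an interior maximum, where the
    gradient of \<open>h\<close> is 0 and its Hessian is nonpositive, while the operator on
    \<open>h\<close> is positive.\<close>
  have hmax: "h x \<le> u x0" if xK: "x \<in> ?K" for x
  proof -
    have "continuous_on ?K h" unfolding h_def[abs_def] using R' u_isCont V_isCont
      by (auto intro!: continuous_at_imp_continuous_on continuous_intros)
    from continuous_attains_sup[OF K _ this] x0K obtain y where
      y: "y \<in> ?K" "\<And>x. x \<in> ?K \<Longrightarrow> h x \<le> h y" by blast
    have yS: "y \<in> S" using y(1) R' by auto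
    have "h y \<le> u x0"
    proof (rule ccontr)
      assume "\<not> ?thesis"
      then have gt: "u x0 < h y" by simp
      have "\<sigma> y \<noteq> 0"
      proof
        assume "\<sigma> y = 0"
        then have "h y = u y" by (simp add: h_def V_def)
        then show False using gt neg[OF yS inside] \<open>\<sigma> y = 0\<close> by (cases "y = x0") auto
      qed
      then have \<sigma>y: "\<sigma> y < 0" using y(1) by auto
      have "norm (y - x0) \<noteq> R" using \<epsilon>(2)[OF y(1)] gt by (auto simp: h_def)
      then have yR: "y \<in> ball x0 R" using y(1) by (auto simp: dist_norm norm_minus_commute)
      have "\<sigma> \<midarrow>y\<rightarrow> \<sigma> y" using \<sigma>_isCont[OF yS] by (simp add: isCont_def)
      then have "\<forall>\<^sub>F x in at y. \<sigma> x < 0" using \<sigma>y by (rule order_tendstoD)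
      moreover have "\<forall>\<^sub>F x in at y. x \<in> ball x0 R" using yR eventually_at_in_open' open_ball by blast
      ultimately have "\<forall>\<^sub>F x in at y. x \<in> ?K" by eventually_elim auto
      then obtain e where e: "e > 0" "\<And>x. x \<noteq> y \<Longrightarrow> dist x y < e \<Longrightarrow> x \<in> ?K"
        unfolding eventually_at by auto
      have loc: "h x \<le> h y" if "x \<in> ball y e" for x
        using that y(2)[of x] e(2)[of x] by (cases "x = y") (auto simp: dist_commute)
      have crit: "h' y = (\<lambda>v. 0)"
        using differential_zero_maxmin[OF _ open_ball has_derivs2D(1)[OF h yS], of y e] e loc by auto
      have second: "h'' y z z \<le> 0" for z
      proof (rule second_order_necessary[OF S(1) yS h])
        show "h' y v = 0" for v using crit by simp
        show lim: "(\<lambda>n. 1 / real (Suc n)) \<longlonglongrightarrow> 0" by (rule LIMSEQ_1_over_Suc)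
        show "(\<lambda>n. z) \<longlonglongrightarrow> z" by simp
        have "(\<lambda>n. y + (1 / real (Suc n)) *\<^sub>R z) \<longlonglongrightarrow> y + 0 *\<^sub>R z" by (intro tendsto_intros lim)
        then have "\<forall>\<^sub>F n in sequentially. y + (1 / real (Suc n)) *\<^sub>R z \<in> ball y e"
          using e(1) by (intro topological_tendstoD) auto
        then show "\<forall>\<^sub>F n in sequentially. h (y + (1 / real (Suc n)) *\<^sub>R z) \<le> h y"
          by eventually_elim (rule loc)
      qed simp
      have ry: "r y < 0" using \<sigma>y \<sigma>0 by (intro inside) auto
      have "(\<Sum>j\<in>I. h'' y (v j y) (v j y)) + h' y (b y)
        = ((\<Sum>j\<in>I. u'' y (v j y) (v j y)) + u' y (b y)) + \<epsilon> * ((\<Sum>j\<in>I. V'' y (v j y) (v j y)) + V' y (b y))"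
        by (simp add: h'_def h''_def sum.distrib sum_distrib_left algebra_simps)
      also have "\<dots> > 0" using PV[of y] y(1) \<epsilon>(1) eq[OF yS ry] by simp
      finally have "0 < (\<Sum>j\<in>I. h'' y (v j y) (v j y))" using crit by simp
      moreover have "(\<Sum>j\<in>I. h'' y (v j y) (v j y)) \<le> 0" by (intro sum_nonpos second)
      ultimately show False by simp
    qed
    then show ?thesis using y(2)[OF xK] by linarith
  qed
  define t where "t n = 1 / real (Suc n)" for n
  have t: "t \<longlonglongrightarrow> 0" "\<And>n. 0 < t n"
    using LIMSEQ_1_over_Suc by (simp_all add: t_def[abs_def])
  have h0: "h x0 = u x0" by (simp add: h_def V_def \<sigma>0)
  have "(\<lambda>n. (\<sigma> (x0 + t n *\<^sub>R w) - \<sigma> x0) /\<^sub>R t n) \<longlonglongrightarrow> \<sigma>' x0 w"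
    by (rule has_derivative_sequence[OF has_derivs2D(1)[OF \<sigma> S(2)] t tendsto_const])
  then have "\<forall>\<^sub>F n in sequentially. (\<sigma> (x0 + t n *\<^sub>R w) - \<sigma> x0) /\<^sub>R t n < 0"
    by (rule order_tendstoD) (use w in \<open>simp add: \<sigma>'_def\<close>)
  moreover have "\<forall>\<^sub>F n in sequentially. x0 + t n *\<^sub>R w \<in> ball x0 R"
  proof -
    have "(\<lambda>n. x0 + t n *\<^sub>R w) \<longlonglongrightarrow> x0 + 0 *\<^sub>R w" by (intro tendsto_intros t)
    then show ?thesis using R by (intro topological_tendstoD) auto
  qed
  ultimately have "\<forall>\<^sub>F n in sequentially. (h (x0 + t n *\<^sub>R w) - h x0) /\<^sub>R t n \<le> 0"
  proof eventually_elim
    case (elim n)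
    have "\<sigma> (x0 + t n *\<^sub>R w) < 0" using elim(1) t(2)[of n] \<sigma>0 by (simp add: mult_less_0_iff)
    then have "h (x0 + t n *\<^sub>R w) \<le> u x0" using elim(2) by (intro hmax) auto
    then show ?case using t(2)[of n] h0 by (simp add: mult_le_0_iff less_imp_le)
  qed
  then have "h' x0 w \<le> 0"
    using has_derivative_sequence[OF has_derivs2D(1)[OF h S(2)] t tendsto_const, of w]
    by (intro tendsto_upperbound[of _ "h' x0 w"]) auto
  \<comment> \<open>At \<open>x0\<close> both \<sigma> and the gradient of the squared distance
    vanish, so the barrier has derivative \<open>- r' x0\<close>; this supplies the strict
    inequality.\<close>
  then have "u' x0 w \<le> \<epsilon> * r' x0 w" by (simp add: h'_def V'_def \<sigma>0 \<sigma>'_def)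
  also have "\<dots> < 0" using w \<epsilon>(1) by (simp add: mult_pos_neg)
  finally show ?thesis .
qed


section \<open>Functions of class \<open>C\<^sup>k\<close>\<close>

definition D2 :: "('e::real_normed_vector \<Rightarrow> 'b::real_normed_vector) \<Rightarrow> 'e \<Rightarrow> 'e \<Rightarrow> 'e \<Rightarrow> 'b" where
  "D2 f x v w = frechet_derivative (\<lambda>y. frechet_derivative f (at y) w) (at x) v"

lemma frechet_derivative_eqI: "(f has_derivative f') (at x) \<Longrightarrow> frechet_derivative f (at x) = f'"
  using frechet_derivative_at by metis

lemma frechet_derivative_cong_open:
  assumes "open S" "x \<in> S" "\<And>y. y \<in> S \<Longrightarrow> f y = g y"
  shows "frechet_derivative f (at x) = frechet_derivative g (at x)"
proof -
  have "(f has_derivative f') (at x) \<longleftrightarrow> (g has_derivative f') (at x)" for f'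
    using assms by (metis has_derivative_transform_within_open)
  then show ?thesis by (simp add: frechet_derivative_def)
qed

lemma differentiable_cong_open:
  assumes "open S" "x \<in> S" "\<And>y. y \<in> S \<Longrightarrow> f y = g y" "f differentiable (at x)"
  shows "g differentiable (at x)"
  using assms unfolding differentiable_def by (metis has_derivative_transform_within_open)

lemma Ck_on_cong:
  assumes "open S" "\<And>y. y \<in> S \<Longrightarrow> f y = g y" "Ck_on k f S"
  shows "Ck_on k g S"
  using assms(2,3)
proof (induction k arbitrary: f g)
  case 0
  then show ?case by (simp cong: continuous_on_cong)
next
  case (Suc k)
  have "Ck_on k (\<lambda>x. frechet_derivative g (at x) v) S" for v
  proof (rule Suc.IH)
    show "Ck_on k (\<lambda>x. frechet_derivative f (at x) v) S" using Suc.prems by simp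
    show "frechet_derivative f (at y) v = frechet_derivative g (at y) v" if "y \<in> S" for y
      using frechet_derivative_cong_open[OF assms(1) that, of f g] Suc.prems(1) by simp
  qed
  moreover have "g differentiable (at x)" if "x \<in> S" for x
    by (rule differentiable_cong_open[OF assms(1) that, of f]) (use Suc.prems that in auto)
  ultimately show ?case by simp
qed

lemma Ck_on_subset: "Ck_on k f S \<Longrightarrow> S' \<subseteq> S \<Longrightarrow> Ck_on k f S'"
  by (induction k arbitrary: f) (auto intro: continuous_on_subset)

lemma Ck_on_lower: "Ck_on (Suc k) f S \<Longrightarrow> Ck_on k f S"
proof (induction k arbitrary: f)
  case 0
  then show ?case
    by (auto intro!: continuous_at_imp_continuous_on differentiable_imp_continuous_within)
qed auto

lemma Ck_on_bounded_linear:
  assumes "open S" "bounded_linear L" "Ck_on k f S"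
  shows "Ck_on k (\<lambda>x. L (f x)) S"
  using assms(3)
proof (induction k arbitrary: f)
  case 0
  then show ?case using bounded_linear.continuous_on[OF assms(2)] by simp
next
  case (Suc k)
  have d: "((\<lambda>x. L (f x)) has_derivative (\<lambda>v. L (frechet_derivative f (at x) v))) (at x)" if "x \<in> S" for x
    using Suc.prems that frechet_derivative_works bounded_linear.has_derivative[OF assms(2)]
    by (metis Ck_on.simps(2))
  have "Ck_on k (\<lambda>x. L (frechet_derivative f (at x) v)) S" for v
    using Suc by simp
  then have "Ck_on k (\<lambda>x. frechet_derivative (\<lambda>x. L (f x)) (at x) v) S" for v
    by (rule Ck_on_cong[OF assms(1), rotated]) (simp add: frechet_derivative_eqI[OF d])
  moreover have "(\<lambda>x. L (f x)) differentiable (at x)" if "x \<in> S" for x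
    using d[OF that] by (auto simp: differentiable_def)
  ultimately show ?case by simp
qed

lemma Ck_on_2D:
  assumes "Ck_on (Suc (Suc 0)) f S"
  shows "has_derivs2 f (\<lambda>x. frechet_derivative f (at x)) (D2 f) S"
    and "continuous_on S (\<lambda>x. D2 f x v w)"
  using assms unfolding has_derivs2_def D2_def by (auto simp: frechet_derivative_works[symmetric])

lemma Ck_on_1_continuous: "Ck_on (Suc 0) f S \<Longrightarrow> continuous_on S (\<lambda>x. frechet_derivative f (at x) v)"
  by simp

lemma has_derivs2_bounded_linear:
  assumes "bounded_linear L" "has_derivs2 f f' f'' S"
  shows "has_derivs2 (\<lambda>x. L (f x)) (\<lambda>x v. L (f' x v)) (\<lambda>x v w. L (f'' x v w)) S"
  using assms(2) bounded_linear.has_derivative[OF assms(1)] unfolding has_derivs2_def by blast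

lemma has_derivs2_linear_left: "has_derivs2 f f' f'' S \<Longrightarrow> x \<in> S \<Longrightarrow> linear (\<lambda>v. f'' x v w)"
  using has_derivs2D(2) has_derivative_linear by blast

text \<open>Linearity is inherited from \<open>f' y\<close> at the nearby points \<open>y\<close>,
  by uniqueness of the derivative.\<close>

lemma has_derivs2_linear_right:
  assumes "open S" "has_derivs2 f f' f'' S" "x \<in> S"
  shows "linear (f'' x v)"
proof -
  have lin: "linear (f' y)" if "y \<in> S" for y
    using has_derivs2D(1)[OF assms(2) that] has_derivative_linear by blast
  note d = has_derivs2D(2)[OF assms(2,3)]
  show ?thesis
  proof
    fix a b
    have "((\<lambda>y. f' y a + f' y b) has_derivative (\<lambda>v. f'' x v (a + b))) (at x)"
      by (rule has_derivative_transform_within_open[OF d[of "a + b"] assms(1,3)])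
        (simp add: linear_add[OF lin])
    then show "f'' x v (a + b) = f'' x v a + f'' x v b"
      using has_derivative_unique[OF _ has_derivative_add[OF d d]] by metis
  next
    fix c a
    have "((\<lambda>y. c *\<^sub>R f' y a) has_derivative (\<lambda>v. f'' x v (c *\<^sub>R a))) (at x)"
      by (rule has_derivative_transform_within_open[OF d[of "c *\<^sub>R a"] assms(1,3)])
        (simp add: linear_scale[OF lin])
    then show "f'' x v (c *\<^sub>R a) = c *\<^sub>R f'' x v a"
      using has_derivative_unique[OF _ has_derivative_scaleR_right[OF d]] by metis
  qed
qed

text \<open>The mean value theorem is applied twice: along \<open>v\<close> to the increment of
  \<open>f\<close> over the step \<open>t w\<close>, then along \<open>w\<close> to the derivative
  of \<open>f\<close> in direction \<open>v\<close>. The left-hand side is symmetric in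
  \<open>v\<close> and \<open>w\<close>, which is what forces the Hessian to be symmetric.\<close>

lemma second_difference_mvt:
  fixes f :: "'e::real_normed_vector \<Rightarrow> real"
  assumes f: "has_derivs2 f f' f'' S" and t: "0 < t"
    and sub: "\<And>a b. 0 \<le> a \<Longrightarrow> a \<le> t \<Longrightarrow> 0 \<le> b \<Longrightarrow> b \<le> t \<Longrightarrow> x + a *\<^sub>R v + b *\<^sub>R w \<in> S"
  shows "\<exists>a b. 0 < a \<and> a < t \<and> 0 < b \<and> b < t \<and>
    f (x + t *\<^sub>R v + t *\<^sub>R w) - f (x + t *\<^sub>R v) - f (x + t *\<^sub>R w) + f x = t\<^sup>2 * f'' (x + a *\<^sub>R v + b *\<^sub>R w) w v"
proof -
  have line: "((\<lambda>s. g (p + s *\<^sub>R u)) has_real_derivative g' u) (at s)"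
    if "(g has_derivative g') (at (p + s *\<^sub>R u))" for g :: "'e \<Rightarrow> real" and g' p u s
  proof -
    have "((\<lambda>s. p + s *\<^sub>R u) has_derivative (\<lambda>h. h *\<^sub>R u)) (at s)"
      by (auto intro!: derivative_eq_intros)
    then have "(g \<circ> (\<lambda>s. p + s *\<^sub>R u) has_derivative g' \<circ> (\<lambda>h. h *\<^sub>R u)) (at s)"
      by (rule diff_chain_at) (rule that)
    moreover have "g' \<circ> (\<lambda>h. h *\<^sub>R u) = (\<lambda>h. g' u * h)"
      using linear_scale[OF has_derivative_linear[OF that]] by (auto simp: fun_eq_iff)
    ultimately show ?thesis by (simp add: has_field_derivative_def o_def)
  qed
  define g where "g s = f (x + t *\<^sub>R w + s *\<^sub>R v) - f (x + s *\<^sub>R v)" for s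
  define g' where "g' s = f' (x + t *\<^sub>R w + s *\<^sub>R v) v - f' (x + s *\<^sub>R v) v" for s
  have "(g has_real_derivative g' s) (at s)" if s: "0 \<le> s" "s \<le> t" for s
  proof -
    have 1: "x + t *\<^sub>R w + s *\<^sub>R v \<in> S" using sub[of s t] s t by (simp add: add_ac)
    have 2: "x + s *\<^sub>R v \<in> S" using sub[of s 0] s t by simp
    show ?thesis unfolding g_def[abs_def] g'_def
      by (intro DERIV_diff line has_derivs2D(1)[OF f 1] has_derivs2D(1)[OF f 2])
  qed
  then have "\<exists>z>0. z < t \<and> g t - g 0 = (t - 0) * g' z" using t by (intro MVT2) auto
  then obtain a where a: "0 < a" "a < t" "g t - g 0 = t * g' a" by auto
  define k where "k s = f' (x + a *\<^sub>R v + s *\<^sub>R w) v" for s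
  have "(k has_real_derivative f'' (x + a *\<^sub>R v + s *\<^sub>R w) w v) (at s)" if s: "0 \<le> s" "s \<le> t" for s
  proof -
    have 1: "x + a *\<^sub>R v + s *\<^sub>R w \<in> S" using sub[of a s] s a by simp
    show ?thesis unfolding k_def[abs_def] by (intro line has_derivs2D(2)[OF f 1])
  qed
  then have "\<exists>z>0. z < t \<and> k t - k 0 = (t - 0) * f'' (x + a *\<^sub>R v + z *\<^sub>R w) w v"
    using t by (intro MVT2) auto
  then obtain b where b: "0 < b" "b < t" "k t - k 0 = t * f'' (x + a *\<^sub>R v + b *\<^sub>R w) w v" by auto
  have "g' a = k t - k 0" by (simp add: g'_def k_def add_ac)
  then have "g t - g 0 = t\<^sup>2 * f'' (x + a *\<^sub>R v + b *\<^sub>R w) w v"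
    using a(3) b(3) by (simp add: power2_eq_square)
  then have "f (x + t *\<^sub>R v + t *\<^sub>R w) - f (x + t *\<^sub>R v) - f (x + t *\<^sub>R w) + f x
      = t\<^sup>2 * f'' (x + a *\<^sub>R v + b *\<^sub>R w) w v"
    unfolding g_def by (simp add: algebra_simps)
  then show ?thesis using a b by blast
qed

lemma has_derivs2_symmetric_real:
  fixes f :: "'e::real_normed_vector \<Rightarrow> real"
  assumes S: "open S" "x \<in> S" and f: "has_derivs2 f f' f'' S"
    and cont: "isCont (\<lambda>y. f'' y v w) x" "isCont (\<lambda>y. f'' y w v) x"
  shows "f'' x v w = f'' x w v"
proof -
  obtain d where d: "d > 0" "ball x d \<subseteq> S" using S by (meson openE)
  \<comment> \<open>Scaled so that the parallelogram spanned at \<open>x\<close> by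
    \<open>T n\<close> times \<open>v\<close> and \<open>w\<close> stays inside the ball of radius
    \<open>d\<close>.\<close>
  define T where "T n = (d / (norm v + norm w + 1)) * (1 / real (Suc (Suc n)))" for n
  have nz: "norm v + norm w + 1 > 0" by (smt (verit) norm_ge_zero)
  have T0: "0 < T n" for n using d nz by (simp add: T_def)
  have T: "T \<longlonglongrightarrow> 0"
  proof -
    have "(\<lambda>n. 1 / real (Suc (Suc n))) \<longlonglongrightarrow> 0"
      using LIMSEQ_Suc[OF LIMSEQ_1_over_Suc] by simp
    then show ?thesis unfolding T_def[abs_def] by (rule tendsto_mult_right_zero)
  qed
  have sub: "x + a *\<^sub>R v + b *\<^sub>R w \<in> S" if "0 \<le> a" "a \<le> T n" "0 \<le> b" "b \<le> T n" for a b n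
  proof -
    have "norm (a *\<^sub>R v + b *\<^sub>R w) \<le> T n * norm v + T n * norm w"
      using that by (intro norm_triangle_mono) (auto intro!: mult_right_mono)
    also have "\<dots> < T n * (norm v + norm w + 1)" using T0[of n] by (simp add: algebra_simps)
    also have "\<dots> = d * (1 / real (Suc (Suc n)))" using nz by (simp add: T_def)
    also have "\<dots> \<le> d * 1" using d by (intro mult_left_mono) auto
    finally have "dist (x + (a *\<^sub>R v + b *\<^sub>R w)) x < d" by (simp add: dist_norm)
    then have "x + a *\<^sub>R v + b *\<^sub>R w \<in> ball x d" by (simp add: dist_commute add.assoc)
    then show ?thesis using d by auto
  qed
  have sub': "x + a *\<^sub>R w + b *\<^sub>R v \<in> S" if "0 \<le> a" "a \<le> T n" "0 \<le> b" "b \<le> T n" for a b n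
    using sub[of b n a] that by (simp add: add_ac)
  let ?D = "\<lambda>n. f (x + T n *\<^sub>R v + T n *\<^sub>R w) - f (x + T n *\<^sub>R v) - f (x + T n *\<^sub>R w) + f x"
  have 1: "\<forall>n. \<exists>a b. 0 < a \<and> a < T n \<and> 0 < b \<and> b < T n \<and> ?D n = (T n)\<^sup>2 * f'' (x + a *\<^sub>R v + b *\<^sub>R w) w v"
    by (intro allI second_difference_mvt[OF f T0] sub)
  have 2: "\<forall>n. \<exists>a b. 0 < a \<and> a < T n \<and> 0 < b \<and> b < T n \<and>
      f (x + T n *\<^sub>R w + T n *\<^sub>R v) - f (x + T n *\<^sub>R w) - f (x + T n *\<^sub>R v) + f x
      = (T n)\<^sup>2 * f'' (x + a *\<^sub>R w + b *\<^sub>R v) v w"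
    by (intro allI second_difference_mvt[OF f T0] sub')
  obtain a b where ab: "\<And>n. 0 < a n \<and> a n < T n \<and> 0 < b n \<and> b n < T n \<and>
      ?D n = (T n)\<^sup>2 * f'' (x + a n *\<^sub>R v + b n *\<^sub>R w) w v"
    using 1 by metis
  obtain a' b' where ab': "\<And>n. 0 < a' n \<and> a' n < T n \<and> 0 < b' n \<and> b' n < T n \<and>
      f (x + T n *\<^sub>R w + T n *\<^sub>R v) - f (x + T n *\<^sub>R w) - f (x + T n *\<^sub>R v) + f x
      = (T n)\<^sup>2 * f'' (x + a' n *\<^sub>R w + b' n *\<^sub>R v) v w"
    using 2 by metis
  have eq: "f'' (x + a n *\<^sub>R v + b n *\<^sub>R w) w v = f'' (x + a' n *\<^sub>R w + b' n *\<^sub>R v) v w" for n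
  proof -
    have "(T n)\<^sup>2 * f'' (x + a n *\<^sub>R v + b n *\<^sub>R w) w v = (T n)\<^sup>2 * f'' (x + a' n *\<^sub>R w + b' n *\<^sub>R v) v w"
    proof -
      have "f (x + T n *\<^sub>R w + T n *\<^sub>R v) = f (x + T n *\<^sub>R v + T n *\<^sub>R w)" by (simp add: add_ac)
      then show ?thesis using ab[of n] ab'[of n] by - (elim conjE, linarith)
    qed
    then show ?thesis using T0[of n] by simp
  qed
  have sq: "s \<longlonglongrightarrow> 0" if "\<And>n. 0 < s n \<and> s n < T n" for s
    by (rule tendsto_sandwich[OF _ _ tendsto_const T]) (use that in \<open>auto intro!: always_eventually less_imp_le\<close>)
  have s: "a \<longlonglongrightarrow> 0" "b \<longlonglongrightarrow> 0" "a' \<longlonglongrightarrow> 0" "b' \<longlonglongrightarrow> 0"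
    using ab ab' by (auto intro!: sq)
  have l1: "(\<lambda>n. x + a n *\<^sub>R v + b n *\<^sub>R w) \<longlonglongrightarrow> x + 0 *\<^sub>R v + 0 *\<^sub>R w" by (intro tendsto_intros s)
  have l2: "(\<lambda>n. x + a' n *\<^sub>R w + b' n *\<^sub>R v) \<longlonglongrightarrow> x + 0 *\<^sub>R w + 0 *\<^sub>R v" by (intro tendsto_intros s)
  have "(\<lambda>n. f'' (x + a n *\<^sub>R v + b n *\<^sub>R w) w v) \<longlonglongrightarrow> f'' x w v"
    using isCont_tendsto_compose[OF cont(2)] l1 by simp
  moreover have "(\<lambda>n. f'' (x + a n *\<^sub>R v + b n *\<^sub>R w) w v) \<longlonglongrightarrow> f'' x v w"
    unfolding eq using isCont_tendsto_compose[OF cont(1)] l2 by simp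
  ultimately show ?thesis using LIMSEQ_unique by blast
qed

lemma D2_symmetric:
  fixes f :: "'e::real_normed_vector \<Rightarrow> complex"
  assumes "open S" "x \<in> S" "Ck_on (Suc (Suc 0)) f S"
  shows "D2 f x v w = D2 f x w v"
proof -
  have c: "isCont (\<lambda>y. D2 f y v w) x" for v w
    using Ck_on_2D(2)[OF assms(3)] assms(1,2) continuous_on_eq_continuous_at by blast
  note d = Ck_on_2D(1)[OF assms(3)]
  have "Re (D2 f x v w) = Re (D2 f x w v)"
    by (rule has_derivs2_symmetric_real[OF assms(1,2) has_derivs2_bounded_linear[OF bounded_linear_Re d]])
      (simp_all add: c)
  moreover have "Im (D2 f x v w) = Im (D2 f x w v)"
    by (rule has_derivs2_symmetric_real[OF assms(1,2) has_derivs2_bounded_linear[OF bounded_linear_Im d]])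
      (simp_all add: c)
  ultimately show ?thesis by (simp add: complex_eq_iff)
qed


section \<open>Complex directional derivatives\<close>

definition Re_vec :: "complex ^ 'n \<Rightarrow> real ^ 'n" where "Re_vec z = (\<chi> i. Re (z $ i))"
definition Im_vec :: "complex ^ 'n \<Rightarrow> real ^ 'n" where "Im_vec z = (\<chi> i. Im (z $ i))"
definition cnj_vec :: "complex ^ 'n \<Rightarrow> complex ^ 'n" where "cnj_vec z = (\<chi> i. cnj (z $ i))"

lemma Re_vec_nth [simp]: "Re_vec z $ i = Re (z $ i)" by (simp add: Re_vec_def)
lemma Im_vec_nth [simp]: "Im_vec z $ i = Im (z $ i)" by (simp add: Im_vec_def)
lemma cnj_vec_nth [simp]: "cnj_vec z $ i = cnj (z $ i)" by (simp add: cnj_vec_def)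

lemma Re_vec_cnj_vec [simp]: "Re_vec (cnj_vec z) = Re_vec z" by (simp add: vec_eq_iff)
lemma Im_vec_cnj_vec [simp]: "Im_vec (cnj_vec z) = - Im_vec z" by (simp add: vec_eq_iff)

text \<open>Written with the partial derivatives, as in \<open>coord_vec\<close>, so that it is
  complex linear in \<open>z\<close> even where \<open>F\<close> is not differentiable.\<close>

definition cderiv :: "(real ^ 'n \<Rightarrow> complex) \<Rightarrow> real ^ 'n \<Rightarrow> complex ^ 'n::finite \<Rightarrow> complex" where
  "cderiv F x z = (\<Sum>i\<in>UNIV. z $ i * frechet_derivative F (at x) (axis i 1))"

lemma linear_axis_sum:
  assumes "linear L"
  shows "L (v :: real ^ 'n::finite) = (\<Sum>i\<in>UNIV. (v $ i) *\<^sub>R L (axis i 1))"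
proof -
  have "L v = L (\<Sum>i\<in>UNIV. (v $ i) *\<^sub>R axis i 1)"
    by (simp add: basis_expansion scalar_mult_eq_scaleR[symmetric])
  then show ?thesis using assms by (simp add: linear_sum linear_scale)
qed

lemma cderiv_eq:
  assumes "(F has_derivative F') (at x)"
  shows "cderiv F x z = F' (Re_vec z) + \<i> * F' (Im_vec z)"
proof -
  have lin: "linear F'" using assms by (rule has_derivative_linear)
  have "F' (Re_vec z) + \<i> * F' (Im_vec z)
      = (\<Sum>i\<in>UNIV. of_real (Re (z $ i)) * F' (axis i 1)) + (\<Sum>i\<in>UNIV. \<i> * of_real (Im (z $ i)) * F' (axis i 1))"
    by (simp add: linear_axis_sum[OF lin, of "Re_vec z"] linear_axis_sum[OF lin, of "Im_vec z"]
        sum_distrib_left scaleR_conv_of_real mult.assoc)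
  also have "\<dots> = (\<Sum>i\<in>UNIV. (of_real (Re (z $ i)) + \<i> * of_real (Im (z $ i))) * F' (axis i 1))"
    by (simp add: sum.distrib distrib_right)
  finally show ?thesis by (simp add: cderiv_def frechet_derivative_eqI[OF assms] complex_eq[symmetric])
qed

lemma cderiv_add_arg: "cderiv F x (z + w) = cderiv F x z + cderiv F x w"
  by (simp add: cderiv_def distrib_right sum.distrib)

lemma cderiv_diff_arg: "cderiv F x (z - w) = cderiv F x z - cderiv F x w"
  by (simp add: cderiv_def left_diff_distrib sum_subtractf)

lemma cderiv_scale_arg: "cderiv F x (a *s z) = a * cderiv F x z"
  by (simp add: cderiv_def sum_distrib_left mult.assoc)

lemma cderiv_0_arg [simp]: "cderiv F x 0 = 0"
  by (simp add: cderiv_def)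

lemma cderiv_sum_arg: "cderiv F x (\<Sum>j\<in>I. z j) = (\<Sum>j\<in>I. cderiv F x (z j))"
  by (induction I rule: infinite_finite_induct) (auto simp: cderiv_add_arg)

lemma cderiv_const [simp]: "cderiv (\<lambda>x. a) x z = 0"
  by (simp add: cderiv_def)

lemma cderiv_add:
  assumes "F differentiable (at x)" "G differentiable (at x)"
  shows "cderiv (\<lambda>x. F x + G x) x z = cderiv F x z + cderiv G x z"
proof -
  obtain F' G' where d: "(F has_derivative F') (at x)" "(G has_derivative G') (at x)"
    using assms by (auto simp: differentiable_def)
  show ?thesis
    by (simp add: cderiv_eq[OF d(1)] cderiv_eq[OF d(2)] cderiv_eq[OF has_derivative_add[OF d]] algebra_simps)
qed

lemma cderiv_mult:
  assumes "F differentiable (at x)" "G differentiable (at x)"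
  shows "cderiv (\<lambda>x. F x * G x) x z = cderiv F x z * G x + F x * cderiv G x z"
proof -
  obtain F' G' where d: "(F has_derivative F') (at x)" "(G has_derivative G') (at x)"
    using assms by (auto simp: differentiable_def)
  show ?thesis
    by (simp add: cderiv_eq[OF d(1)] cderiv_eq[OF d(2)] cderiv_eq[OF has_derivative_mult[OF d]] algebra_simps)
qed

lemma cderiv_cmult:
  assumes "F differentiable (at x)"
  shows "cderiv (\<lambda>x. a * F x) x z = a * cderiv F x z"
  using cderiv_mult[OF differentiable_const assms, of a z] by simp

lemma cderiv_sum:
  assumes "finite I" "\<And>i. i \<in> I \<Longrightarrow> F i differentiable (at x)"
  shows "cderiv (\<lambda>x. \<Sum>i\<in>I. F i x) x z = (\<Sum>i\<in>I. cderiv (F i) x z)"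
  using assms by (induction I) (auto simp: cderiv_add)

lemma cderiv_cnj:
  assumes "F differentiable (at x)"
  shows "cderiv (\<lambda>x. cnj (F x)) x z = cnj (cderiv F x (cnj_vec z))"
proof -
  obtain F' where d: "(F has_derivative F') (at x)" using assms by (auto simp: differentiable_def)
  have "F' (- Im_vec z) = - F' (Im_vec z)"
    using linear_neg[OF has_derivative_linear[OF d]] .
  then show ?thesis
    by (simp add: cderiv_eq[OF d] cderiv_eq[OF bounded_linear.has_derivative[OF bounded_linear_cnj d]])
qed

lemma cderiv_cong_open:
  assumes "open S" "x \<in> S" "\<And>y. y \<in> S \<Longrightarrow> F y = G y"
  shows "cderiv F x z = cderiv G x z"
  unfolding cderiv_def by (subst frechet_derivative_cong_open[OF assms]) auto

lemma D2_axis_sum: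
  assumes "open S" "x \<in> S" "Ck_on (Suc (Suc 0)) F S"
  shows "D2 F x a c = (\<Sum>k\<in>UNIV. \<Sum>i\<in>UNIV. of_real (a $ k * c $ i) * (D2 F x (axis k 1) (axis i 1) :: complex))"
proof -
  note d = Ck_on_2D(1)[OF assms(3)]
  have "D2 F x a c = (\<Sum>k\<in>UNIV. (a $ k) *\<^sub>R D2 F x (axis k 1) c)"
    by (rule linear_axis_sum[OF has_derivs2_linear_left[OF d assms(2)]])
  also have "\<dots> = (\<Sum>k\<in>UNIV. (a $ k) *\<^sub>R (\<Sum>i\<in>UNIV. (c $ i) *\<^sub>R D2 F x (axis k 1) (axis i 1)))"
    using linear_axis_sum[OF has_derivs2_linear_right[OF assms(1) d assms(2)], of _ c] by simp
  finally show ?thesis by (simp add: scaleR_conv_of_real sum_distrib_left mult.assoc)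
qed

text \<open>The point is the shape of the second order term. By symmetry of the Hessian it cancels
  in brackets, and when \<open>w\<close> is the conjugate of \<open>z x\<close> it becomes an
  operator with real coefficients.\<close>

lemma cderiv_cderiv:
  assumes F: "open S" "x \<in> S" "Ck_on (Suc (Suc 0)) F S"
    and z: "\<And>i. (\<lambda>y. z y $ i) differentiable (at x)"
  shows "cderiv (\<lambda>y. cderiv F y (z y)) x w = cderiv F x (\<chi> i. cderiv (\<lambda>y. z y $ i) x w)
    + (\<Sum>k\<in>UNIV. \<Sum>i\<in>UNIV. w $ k * z x $ i * D2 F x (axis k 1) (axis i 1))"
proof -
  have dF: "(\<lambda>y. frechet_derivative F (at y) (axis i 1)) differentiable (at x)" for i
    using F(2,3) by simp
  have "cderiv (\<lambda>y. cderiv F y (z y)) x w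
      = (\<Sum>i\<in>UNIV. cderiv (\<lambda>y. z y $ i * frechet_derivative F (at y) (axis i 1)) x w)"
    unfolding cderiv_def[of F] by (intro cderiv_sum) (auto intro!: differentiable_mult z dF)
  also have "\<dots> = (\<Sum>i\<in>UNIV. cderiv (\<lambda>y. z y $ i) x w * frechet_derivative F (at x) (axis i 1))
      + (\<Sum>i\<in>UNIV. z x $ i * cderiv (\<lambda>y. frechet_derivative F (at y) (axis i 1)) x w)"
    by (simp add: cderiv_mult z dF sum.distrib)
  also have "(\<Sum>i\<in>UNIV. z x $ i * cderiv (\<lambda>y. frechet_derivative F (at y) (axis i 1)) x w)
      = (\<Sum>k\<in>UNIV. \<Sum>i\<in>UNIV. w $ k * z x $ i * D2 F x (axis k 1) (axis i 1))"
    unfolding cderiv_def D2_def sum_distrib_left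
    by (subst sum.swap) (simp add: mult_ac)
  finally show ?thesis by (simp add: cderiv_def)
qed

text \<open>The field conj Z applied to the coefficients of Z: the first order part of the operator
  (conj Z) Z. Its imaginary part carries the Levi form, see \<open>levi_bracket_eq\<close>.\<close>

definition conj_deriv :: "(real ^ 'n \<Rightarrow> complex ^ 'n) \<Rightarrow> real ^ 'n \<Rightarrow> complex ^ 'n::finite" where
  "conj_deriv z x = (\<chi> i. cderiv (\<lambda>y. z y $ i) x (cnj_vec (z x)))"

text \<open>For \<open>z = a + \<i> b\<close> the Hessian on the pair of conj z and z is
  \<open>D2 F a a + D2 F b b\<close> plus \<i> times \<open>D2 F a b - D2 F b a\<close>, and the
  last difference vanishes by symmetry. This is how a sum of squares of real fields arises from
  complex ones.\<close>

lemma cderiv_conj_cderiv: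
  assumes F: "open S" "x \<in> S" "Ck_on (Suc (Suc 0)) F S"
    and z: "\<And>i. (\<lambda>y. z y $ i) differentiable (at x)"
  shows "cderiv (\<lambda>y. cderiv F y (z y)) x (cnj_vec (z x)) = cderiv F x (conj_deriv z x)
    + D2 F x (Re_vec (z x)) (Re_vec (z x)) + D2 F x (Im_vec (z x)) (Im_vec (z x))"
proof -
  let ?a = "Re_vec (z x)" and ?b = "Im_vec (z x)"
  have "D2 F x ?a ?a + D2 F x ?b ?b = D2 F x ?a ?a + D2 F x ?b ?b + \<i> * (D2 F x ?a ?b - D2 F x ?b ?a)"
    using D2_symmetric[OF F] by simp
  also have "\<dots> = (\<Sum>k\<in>UNIV. \<Sum>i\<in>UNIV. cnj_vec (z x) $ k * z x $ i * D2 F x (axis k 1) (axis i 1))"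
    unfolding D2_axis_sum[OF F, of ?a ?a] D2_axis_sum[OF F, of ?b ?b] D2_axis_sum[OF F, of ?a ?b]
      D2_axis_sum[OF F, of ?b ?a] sum.distrib[symmetric] sum_subtractf[symmetric] sum_distrib_left
    by (intro sum.cong refl) (simp add: complex_eq_iff algebra_simps)
  finally show ?thesis
    unfolding cderiv_cderiv[OF assms] conj_deriv_def by simp
qed

text \<open>With \<open>q = \<Sum> (conj Z) z\<^sub>i \<partial>\<^sub>i\<close> one has \<open>[Z, conj Z] = conj q - q\<close>. The Hessian of \<open>Re G - \<mu> r\<close>,
  whose differential vanishes at \<open>x0\<close>, computes the Levi form.\<close>

lemma levi_nonneg_at_max:
  fixes G :: "real ^ 'n::finite \<Rightarrow> complex" and r :: "real ^ 'n \<Rightarrow> real"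
  assumes S: "open S" "x0 \<in> S" and G: "Ck_on (Suc (Suc 0)) G S"
    and r: "Ck_on (Suc (Suc 0)) (\<lambda>x. complex_of_real (r x)) S"
    and N: "separates N S r" "x0 \<in> N" and rN: "\<And>x. x \<in> N \<inter> S \<Longrightarrow> r x = 0"
    and w: "frechet_derivative r (at x0) w \<noteq> 0"
    and \<mu>: "\<And>v. Re (frechet_derivative G (at x0) v) = \<mu> * frechet_derivative r (at x0) v"
    and max: "\<And>x. x \<in> N \<inter> S \<Longrightarrow> Re (G x) \<le> Re (G x0)"
    and z: "\<And>i. (\<lambda>y. z y $ i) differentiable (at x0)"
    and zG: "\<And>x. x \<in> N \<inter> S \<Longrightarrow> cderiv G x (z x) = 0"
    and zr: "\<And>x. x \<in> N \<inter> S \<Longrightarrow> cderiv (\<lambda>x. complex_of_real (r x)) x (z x) = 0"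
  shows "Im (frechet_derivative G (at x0) (Im_vec (conj_deriv z x0))) \<le> 0"
proof -
  let ?rc = "\<lambda>x. complex_of_real (r x)"
  define G' where "G' x = frechet_derivative G (at x)" for x
  define r' where "r' x v = Re (frechet_derivative ?rc (at x) v)" for x v
  define r'' where "r'' x v w = Re (D2 ?rc x v w)" for x v w
  have G2: "has_derivs2 G G' (D2 G) S" unfolding G'_def[abs_def] by (rule Ck_on_2D(1)[OF G])
  have r2: "has_derivs2 r r' r'' S"
    using has_derivs2_bounded_linear[OF bounded_linear_Re Ck_on_2D(1)[OF r]]
    by (simp add: r'_def[abs_def] r''_def[abs_def])
  note dr = has_derivs2D(1)[OF r2 S(2)]
  have drc: "(?rc has_derivative (\<lambda>v. complex_of_real (r' x0 v))) (at x0)"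
    using bounded_linear.has_derivative[OF bounded_linear_of_real dr] .
  have r'_eq: "frechet_derivative r (at x0) = r' x0" by (rule frechet_derivative_eqI[OF dr])
  have D2rc: "D2 ?rc x0 v w = complex_of_real (r'' x0 v w)" for v w
  proof -
    have 1: "frechet_derivative ?rc (at y) w = complex_of_real (r' y w)" if "y \<in> S" for y
      by (subst frechet_derivative_eqI[OF bounded_linear.has_derivative[OF bounded_linear_of_real has_derivs2D(1)[OF r2 that]]]) simp
    have "D2 ?rc x0 v w = frechet_derivative (\<lambda>y. complex_of_real (r' y w)) (at x0) v"
      unfolding D2_def by (subst frechet_derivative_cong_open[OF S 1]) auto
    then show ?thesis
      by (subst (asm) frechet_derivative_eqI[OF bounded_linear.has_derivative[OF bounded_linear_of_real has_derivs2D(2)[OF r2 S(2)]]])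
  qed
  define a where "a = Re_vec (z x0)"
  define b where "b = Im_vec (z x0)"
  define \<alpha> where "\<alpha> = Re_vec (conj_deriv z x0)"
  define \<beta> where "\<beta> = Im_vec (conj_deriv z x0)"
  have x0: "x0 \<in> N \<inter> S" using N S by simp
  note r0 = rN[OF x0]
  have "complex_of_real (r' x0 a) + \<i> * complex_of_real (r' x0 b) = 0"
    using zr[OF x0] cderiv_eq[OF drc, of "z x0"] by (simp add: a_def b_def)
  then have ab: "r' x0 a = 0" "r' x0 b = 0" by (auto simp: complex_eq_iff)
  have w': "r' x0 w \<noteq> 0" using w r'_eq by simp
  \<comment> \<open>The function \<open>Z F\<close> vanishes on \<open>N\<close>, hence so do its
    derivatives along vectors tangent to \<open>N\<close>. The real and imaginary parts of the
    conjugate of \<open>z x0\<close> are such vectors by \<open>ab\<close>.\<close>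
  have kill: "cderiv (\<lambda>y. cderiv F y (z y)) x0 (cnj_vec (z x0)) = 0"
    if F: "Ck_on (Suc (Suc 0)) F S" and zero: "\<And>x. x \<in> N \<inter> S \<Longrightarrow> cderiv F x (z x) = 0" for F
  proof -
    have "(\<lambda>y. cderiv F y (z y)) differentiable (at x0)"
      unfolding cderiv_def using F S by (auto intro!: differentiable_sum differentiable_mult z)
    then obtain \<phi>' where \<phi>': "((\<lambda>y. cderiv F y (z y)) has_derivative \<phi>') (at x0)"
      by (auto simp: differentiable_def)
    have ev: "\<forall>\<^sub>F y in nhds x0. y \<in> N \<longrightarrow> cderiv F y (z y) = 0"
      using eventually_nhds_in_open[OF S] by eventually_elim (use zero in auto)
    have "\<phi>' v = 0" if "r' x0 v = 0" for v
      by (rule derivative_tangent_eq_0[OF S N(1) dr r0 w' that \<phi>' zero[OF x0] ev])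
    moreover have "r' x0 (- b) = 0" using linear_neg[OF has_derivative_linear[OF dr]] ab by simp
    ultimately show ?thesis using ab by (simp add: cderiv_eq[OF \<phi>'] a_def b_def)
  qed
  have eqG: "G' x0 \<alpha> + \<i> * G' x0 \<beta> + D2 G x0 a a + D2 G x0 b b = 0"
    using kill[OF G zG] cderiv_eq[OF has_derivs2D(1)[OF G2 S(2)], of "conj_deriv z x0"]
    unfolding cderiv_conj_cderiv[OF S G z] a_def b_def \<alpha>_def \<beta>_def by simp
  have eqr: "complex_of_real (r' x0 \<alpha>) + \<i> * complex_of_real (r' x0 \<beta>) + complex_of_real (r'' x0 a a) + complex_of_real (r'' x0 b b) = 0"
    using kill[OF r zr] cderiv_eq[OF drc, of "conj_deriv z x0"]
    unfolding cderiv_conj_cderiv[OF S r z] a_def b_def \<alpha>_def \<beta>_def D2rc by simp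
  \<comment> \<open>On \<open>N\<close> near \<open>x0\<close> the correction is 0, so
    \<open>h\<close> has the same maximum there as \<open>Re G\<close>; in addition its full
    differential vanishes at \<open>x0\<close>, so its Hessian on tangent vectors has a sign
    although \<open>N\<close> is curved.\<close>
  define h where "h x = Re (G x) + (- \<mu>) * r x" for x
  define h' where "h' x v = Re (G' x v) + (- \<mu>) * r' x v" for x v
  define h'' where "h'' x v w = Re (D2 G x v w) + (- \<mu>) * r'' x v w" for x v w
  have h: "has_derivs2 h h' h'' S"
    unfolding h_def[abs_def] h'_def[abs_def] h''_def[abs_def]
    by (intro has_derivs2_add has_derivs2_cmult r2 has_derivs2_bounded_linear[OF bounded_linear_Re G2])
  have crit: "h' x0 v = 0" for v using \<mu>[of v] by (simp add: h'_def G'_def r'_eq)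
  have second: "h'' x0 v v \<le> 0" if v: "r' x0 v = 0" for v
  proof -
    obtain t y where ty: "t \<longlonglongrightarrow> 0" "\<And>n. (0::real) < t n" "y \<longlonglongrightarrow> v" "\<And>n. x0 + t n *\<^sub>R y n \<in> N"
      using separates_tangent_sequence[OF S N(1) dr r0 w' v] by metis
    have "(\<lambda>n. x0 + t n *\<^sub>R y n) \<longlonglongrightarrow> x0 + 0 *\<^sub>R v" by (intro tendsto_intros ty)
    then have "\<forall>\<^sub>F n in sequentially. x0 + t n *\<^sub>R y n \<in> S"
      using S by (intro topological_tendstoD) auto
    then have "\<forall>\<^sub>F n in sequentially. h (x0 + t n *\<^sub>R y n) \<le> h x0"
      by eventually_elim (use ty(4) max rN x0 in \<open>auto simp: h_def\<close>)
    then show ?thesis by (rule second_order_necessary[OF S h crit ty(1-3)])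
  qed
  have "Re (G' x0 \<alpha>) - Im (G' x0 \<beta>) + Re (D2 G x0 a a) + Re (D2 G x0 b b) = 0"
    using eqG by (simp add: complex_eq_iff)
  moreover have "r' x0 \<alpha> + r'' x0 a a + r'' x0 b b = 0"
    using eqr by (simp add: complex_eq_iff)
  then have "\<mu> * r' x0 \<alpha> + \<mu> * r'' x0 a a + \<mu> * r'' x0 b b = 0"
    by (simp add: distrib_left[symmetric] del: mult_eq_0_iff)
  moreover have "Re (G' x0 \<alpha>) = \<mu> * r' x0 \<alpha>" using \<mu>[of \<alpha>] by (simp add: G'_def r'_eq)
  \<comment> \<open>Real part of \<open>eqG\<close> minus \<mu> times the real part of
    \<open>eqr\<close>: the first order terms in \<alpha> cancel because \<open>Re G\<close> and
    \<open>\<mu> r\<close> have the same differential at \<open>x0\<close>.\<close>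
  ultimately have "Im (G' x0 \<beta>) = h'' x0 a a + h'' x0 b b" by (simp add: h''_def)
  then show ?thesis using second[OF ab(1)] second[OF ab(2)] by (simp add: G'_def \<beta>_def)
qed


section \<open>Tangent vectors in a chart\<close>

definition crd :: "('a, 'n) chart \<Rightarrow> 'n::finite \<Rightarrow> 'a \<Rightarrow> complex" where
  "crd c i = (\<lambda>q. complex_of_real (snd c q $ i))"

text \<open>Components are read off by applying the operator to the coordinate functions, so they
  make sense for a vector that was given in another chart.\<close>

definition comps :: "('a, 'n::finite) chart \<Rightarrow> 'a cvec \<Rightarrow> complex ^ 'n" where
  "comps c X = (\<chi> i. X (crd c i))"

definition field_comps :: "('a, 'n::finite) chart \<Rightarrow> ('a \<Rightarrow> 'a cvec) \<Rightarrow> real ^ 'n \<Rightarrow> complex ^ 'n" where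
  "field_comps c Z x = comps c (Z (chart_inv c x))"

lemma comps_add: "comps c (X + Y) = comps c X + comps c Y"
  by (simp add: comps_def vec_eq_iff)

lemma comps_0 [simp]: "comps c 0 = 0"
  by (simp add: comps_def vec_eq_iff)

lemma sum_fun_apply: "(\<Sum>j\<in>I. X j) f = (\<Sum>j\<in>I. X j f :: 'b::comm_monoid_add)"
  by (induction I rule: infinite_finite_induct) auto

lemma comps_sum: "comps c (\<Sum>j\<in>I. X j) = (\<Sum>j\<in>I. comps c (X j))"
  by (simp add: comps_def vec_eq_iff sum_fun_apply)

lemma comps_cscale: "comps c (cscale a X) = a *s comps c X"
  by (simp add: comps_def vec_eq_iff cscale_def)

lemma scaleR_eq_cscale: "t *\<^sub>R X = cscale (complex_of_real t) X"
  by (simp add: scaleR_fun_def cscale_def scaleR_conv_of_real)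

lemma comps_vconj: "comps c (vconj X) = cnj_vec (comps c X)"
  by (simp add: comps_def vec_eq_iff vconj_def crd_def)

lemma comps_vRe: "comps c (vRe X) = (\<chi> i. complex_of_real (Re (comps c X $ i)))"
  unfolding vRe_def scaleR_eq_cscale comps_cscale comps_add comps_vconj
  by (simp add: vec_eq_iff complex_eq_iff)

lemma smooth_fun_subset: "smooth_fun A U f \<Longrightarrow> open V \<Longrightarrow> V \<subseteq> U \<Longrightarrow> smooth_fun A V f"
  unfolding smooth_fun_def Ck_fun_def by (meson Ck_on_subset Int_mono image_mono order_refl)

lemma bounded_linear_of_real_nth: "bounded_linear (\<lambda>v. complex_of_real (v $ i))"
  by (intro bounded_linear_compose[OF bounded_linear_of_real] bounded_linear_vec_nth)

section \<open>Vectors, fields and brackets in a fixed chart\<close>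

locale manifold_chart =
  fixes A :: "('a::{t2_space,second_countable_topology}, 'n::finite) chart set" and c :: "('a, 'n) chart"
  assumes manifold: "smooth_manifold A" and chart: "c \<in> A"
begin

lemma open_dom: "d \<in> A \<Longrightarrow> open (fst d)"
  using manifold by (auto simp: smooth_manifold_def)

lemma chart_homeomorphism: "d \<in> A \<Longrightarrow> homeomorphism (fst d) (snd d ` fst d) (snd d) (chart_inv d)"
  using manifold by (auto simp: smooth_manifold_def)

lemma chart_inv_left: "d \<in> A \<Longrightarrow> q \<in> fst d \<Longrightarrow> chart_inv d (snd d q) = q"
  using chart_homeomorphism by (auto simp: homeomorphism_def)

lemma open_chart_image:
  assumes "d \<in> A" "open U"
  shows "open (snd d ` (U \<inter> fst d))"
proof -
  have "openin (top_of_set (fst d)) (U \<inter> fst d)" using openin_open_Int[OF assms(2), of "fst d"] by (simp add: Int_commute)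
  then have "openin (top_of_set (snd d ` fst d)) (snd d ` (U \<inter> fst d))"
    by (rule homeomorphism_imp_open_map[OF chart_homeomorphism[OF assms(1)]])
  moreover have "open (snd d ` fst d)" using manifold assms(1) by (auto simp: smooth_manifold_def)
  ultimately show ?thesis using openin_open_trans by blast
qed

lemma chart_image_inv:
  assumes "d \<in> A" "x \<in> snd d ` (U \<inter> fst d)"
  shows "chart_inv d x \<in> U \<inter> fst d" "snd d (chart_inv d x) = x"
  using chart_inv_left[OF assms(1)] assms(2) by auto

lemma isCont_chart:
  assumes "p \<in> fst c"
  shows "isCont (snd c) p"
  using chart_homeomorphism[OF chart] open_dom[OF chart] assms
  by (auto simp: homeomorphism_def continuous_on_eq_continuous_at)

lemma isCont_chart_inv:
  assumes "x \<in> snd c ` fst c"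
  shows "isCont (chart_inv c) x"
  using chart_homeomorphism[OF chart] open_chart_image[OF chart open_UNIV] assms
  by (auto simp: homeomorphism_def continuous_on_eq_continuous_at)

lemma transition_Ck:
  assumes "d \<in> A"
  shows "Ck_on k (snd c \<circ> chart_inv d) (snd d ` (fst c \<inter> fst d))"
  using manifold assms chart unfolding smooth_manifold_def by (subst Int_commute) blast

lemma smooth_crd: "smooth_fun A (fst c) (crd c i)"
  unfolding smooth_fun_def Ck_fun_def
proof (intro allI conjI ballI)
  show "open (fst c)" using open_dom chart by blast
  fix k d assume d: "d \<in> A"
  have eq: "crd c i \<circ> chart_inv d = (\<lambda>x. complex_of_real ((snd c \<circ> chart_inv d) x $ i))"
    by (simp add: crd_def fun_eq_iff)
  show "Ck_on k (crd c i \<circ> chart_inv d) (snd d ` (fst c \<inter> fst d))"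
    unfolding eq by (intro Ck_on_bounded_linear[OF _ bounded_linear_of_real_nth] open_chart_image[OF d] open_dom chart transition_Ck d)
qed

lemma smooth_near_crd: "p \<in> fst c \<Longrightarrow> smooth_near A p (crd c i)"
  using smooth_crd by (auto simp: smooth_near_def)

lemma smooth_fun_cnj:
  assumes "smooth_fun A U f"
  shows "smooth_fun A U (\<lambda>q. cnj (f q))"
  unfolding smooth_fun_def Ck_fun_def
proof (intro allI conjI ballI)
  show U: "open U" using assms by (auto simp: smooth_fun_def Ck_fun_def)
  fix k d assume d: "d \<in> A"
  have "Ck_on k (f \<circ> chart_inv d) (snd d ` (U \<inter> fst d))"
    using assms d by (auto simp: smooth_fun_def Ck_fun_def)
  from Ck_on_bounded_linear[OF open_chart_image[OF d U] bounded_linear_cnj this]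
  show "Ck_on k ((\<lambda>q. cnj (f q)) \<circ> chart_inv d) (snd d ` (U \<inter> fst d))" by (simp add: o_def)
qed

lemma smooth_near_cnj: "smooth_near A p (\<lambda>q. cnj (f q)) \<longleftrightarrow> smooth_near A p f"
  unfolding smooth_near_def using smooth_fun_cnj by fastforce

lemma smooth_near_Ck:
  assumes "smooth_near A p f" "d \<in> A" "p \<in> fst d"
  obtains U where "open U" "p \<in> U" "\<And>k. Ck_on k (f \<circ> chart_inv d) (snd d ` (U \<inter> fst d))"
  using assms unfolding smooth_near_def smooth_fun_def Ck_fun_def by blast

lemma smooth_near_differentiable:
  assumes "smooth_near A p f" "d \<in> A" "p \<in> fst d"
  shows "(f \<circ> chart_inv d) differentiable (at (snd d p))"
proof -
  obtain U where "p \<in> U" "Ck_on (Suc 0) (f \<circ> chart_inv d) (snd d ` (U \<inter> fst d))"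
    using smooth_near_Ck[OF assms] by metis
  then show ?thesis using assms(3) by (metis Ck_on.simps(2) IntI imageI)
qed

lemma coord_vec_apply:
  "coord_vec A d p v f = (if smooth_near A p f then cderiv (f \<circ> chart_inv d) (snd d p) v else 0)"
  by (simp add: coord_vec_def cderiv_def)

text \<open>The vector may come from another chart \<open>d\<close>; the chain rule for the
  transition map \<open>snd c \<circ> chart_inv d\<close> converts its coefficients into the
  components with respect to \<open>c\<close>.\<close>

lemma ctangent_apply:
  assumes X: "X \<in> ctangent A p" and p: "p \<in> fst c" and f: "smooth_near A p f"
  shows "X f = cderiv (f \<circ> chart_inv c) (snd c p) (comps c X)"
proof -
  obtain d v where d: "d \<in> A" "p \<in> fst d" and Xd: "X = coord_vec A d p v"
    using X by (auto simp: ctangent_def)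
  let ?J = "snd c \<circ> chart_inv d" and ?x = "snd c p" and ?y = "snd d p"
  let ?S = "snd d ` (fst c \<inter> fst d)"
  have S: "open ?S" "?y \<in> ?S" using open_chart_image[OF d(1) open_dom[OF chart]] p d(2) by auto
  obtain J' where J': "(?J has_derivative J') (at ?y)"
    using transition_Ck[OF d(1), of "Suc 0"] S(2) unfolding Ck_on.simps differentiable_def by blast
  have Jy: "?J ?y = ?x" using chart_inv_left[OF d] by simp
  obtain F' where F': "((f \<circ> chart_inv c) has_derivative F') (at ?x)"
    using smooth_near_differentiable[OF f chart p] by (auto simp: differentiable_def)
  have "((f \<circ> chart_inv c) \<circ> ?J has_derivative F' \<circ> J') (at ?y)"
    by (rule diff_chain_at[OF J']) (use F' Jy in simp)
  then have "((f \<circ> chart_inv d) has_derivative F' \<circ> J') (at ?y)"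
  proof (rule has_derivative_transform_within_open[OF _ S])
    fix y assume "y \<in> ?S"
    then show "((f \<circ> chart_inv c) \<circ> ?J) y = (f \<circ> chart_inv d) y"
      using chart_inv_left[OF chart] chart_inv_left[OF d(1)] by auto
  qed
  then have fd: "frechet_derivative (f \<circ> chart_inv d) (at ?y) = F' \<circ> J'" by (rule frechet_derivative_eqI)
  have "comps c X $ j = (\<Sum>i\<in>UNIV. v $ i * of_real (J' (axis i 1) $ j))" for j
  proof -
    have "((\<lambda>x. complex_of_real (?J x $ j)) has_derivative (\<lambda>h. complex_of_real (J' h $ j))) (at ?y)"
      by (rule bounded_linear.has_derivative[OF bounded_linear_of_real_nth J'])
    then have "frechet_derivative (crd c j \<circ> chart_inv d) (at ?y) = (\<lambda>h. complex_of_real (J' h $ j))"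
      by (intro frechet_derivative_eqI) (simp add: crd_def o_def)
    then show ?thesis
      unfolding comps_def Xd coord_vec_def using smooth_near_crd[OF p] by simp
  qed
  then have "cderiv (f \<circ> chart_inv c) ?x (comps c X)
      = (\<Sum>j\<in>UNIV. \<Sum>i\<in>UNIV. v $ i * of_real (J' (axis i 1) $ j) * F' (axis j 1))"
    unfolding cderiv_def frechet_derivative_eqI[OF F'] by (simp add: sum_distrib_right)
  also have "\<dots> = (\<Sum>i\<in>UNIV. v $ i * (\<Sum>j\<in>UNIV. (J' (axis i 1) $ j) *\<^sub>R F' (axis j 1)))"
    by (subst sum.swap) (simp add: sum_distrib_left scaleR_conv_of_real mult.assoc)
  also have "\<dots> = (\<Sum>i\<in>UNIV. v $ i * F' (J' (axis i 1)))"
    by (simp only: linear_axis_sum[OF has_derivative_linear[OF F'], symmetric])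
  also have "\<dots> = X f" unfolding Xd coord_vec_def fd using f by simp
  finally show ?thesis by simp
qed

text \<open>Vectors are 0 by convention on functions that are not smooth near \<open>p\<close>, so
  agreement on the smooth ones already gives equality of the operators.\<close>

lemma ctangent_eq_coord_vec:
  assumes "X \<in> ctangent A p" "p \<in> fst c"
  shows "X = coord_vec A c p (comps c X)"
proof
  fix f
  show "X f = coord_vec A c p (comps c X) f"
  proof (cases "smooth_near A p f")
    case True
    then show ?thesis using ctangent_apply[OF assms] by (simp add: coord_vec_apply)
  next
    case False
    then show ?thesis using assms(1) by (auto simp: ctangent_def coord_vec_def)
  qed
qed

lemma coord_vec_in_ctangent [intro]: "p \<in> fst c \<Longrightarrow> coord_vec A c p v \<in> ctangent A p"
  using chart unfolding ctangent_def by blast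

lemma comps_coord_vec [simp]:
  assumes "p \<in> fst c"
  shows "comps c (coord_vec A c p v) = v"
proof -
  have S: "open (snd c ` fst c)" "snd c p \<in> snd c ` fst c"
    using open_chart_image[OF chart open_UNIV] assms by auto
  have "frechet_derivative (crd c j \<circ> chart_inv c) (at (snd c p)) = (\<lambda>h. complex_of_real (h $ j))" for j
  proof (rule frechet_derivative_eqI, rule has_derivative_transform_within_open[OF _ S])
    show "((\<lambda>x. complex_of_real (x $ j)) has_derivative (\<lambda>h. complex_of_real (h $ j))) (at (snd c p))"
      by (rule bounded_linear_imp_has_derivative[OF bounded_linear_of_real_nth])
    show "complex_of_real (y $ j) = (crd c j \<circ> chart_inv c) y" if "y \<in> snd c ` fst c" for y
      using that chart_inv_left[OF chart] by (auto simp: crd_def)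
  qed
  then show ?thesis
    unfolding vec_eq_iff comps_def coord_vec_def using smooth_near_crd[OF assms]
    by (simp add: axis_def if_distrib if_distribR cong: if_cong)
qed

lemma ctangent_eqI:
  assumes "X \<in> ctangent A p" "Y \<in> ctangent A p" "p \<in> fst c" "comps c X = comps c Y"
  shows "X = Y"
  using ctangent_eq_coord_vec assms by metis

lemma coord_vec_add: "coord_vec A c p (v + w) = coord_vec A c p v + coord_vec A c p w"
  by (simp add: fun_eq_iff coord_vec_apply cderiv_add_arg)

lemma coord_vec_scale: "coord_vec A c p (a *s v) = cscale a (coord_vec A c p v)"
  by (simp add: fun_eq_iff coord_vec_apply cderiv_scale_arg cscale_def)

lemma coord_vec_0 [simp]: "coord_vec A c p 0 = 0"
  by (simp add: fun_eq_iff coord_vec_apply)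

lemma coord_vec_sum: "coord_vec A c p (\<Sum>j\<in>I. v j) = (\<Sum>j\<in>I. coord_vec A c p (v j))"
  by (induction I rule: infinite_finite_induct) (auto simp: coord_vec_add)

lemma vconj_coord_vec:
  assumes "p \<in> fst c"
  shows "vconj (coord_vec A c p v) = coord_vec A c p (cnj_vec v)"
proof
  fix f
  have "cderiv (\<lambda>x. cnj (f (chart_inv c x))) (snd c p) v = cnj (cderiv (f \<circ> chart_inv c) (snd c p) (cnj_vec v))"
    if "smooth_near A p f"
    using cderiv_cnj[OF smooth_near_differentiable[OF that chart assms]] by (simp add: o_def)
  then show "vconj (coord_vec A c p v) f = coord_vec A c p (cnj_vec v) f"
    by (simp add: vconj_def coord_vec_apply smooth_near_cnj o_def)
qed

lemma ctangent_subspace: "p \<in> fst c \<Longrightarrow> cvec.subspace (ctangent A p)"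
  unfolding cvec.subspace_def
  by (metis coord_vec_0 coord_vec_add coord_vec_scale coord_vec_in_ctangent ctangent_eq_coord_vec)

lemma ctangent_vconj: "p \<in> fst c \<Longrightarrow> X \<in> ctangent A p \<Longrightarrow> vconj X \<in> ctangent A p"
  by (metis vconj_coord_vec coord_vec_in_ctangent ctangent_eq_coord_vec)

lemma ctangent_vRe:
  assumes "p \<in> fst c" "X \<in> ctangent A p"
  shows "vRe X \<in> ctangent A p"
  unfolding vRe_def scaleR_eq_cscale
  using ctangent_subspace[OF assms(1)] ctangent_vconj[OF assms] assms(2)
  by (simp add: cvec.subspace_add cvec.subspace_scale)

lemma tangent_iff:
  assumes "p \<in> fst c"
  shows "X \<in> tangent A p \<longleftrightarrow> X \<in> ctangent A p \<and> cnj_vec (comps c X) = comps c X"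
  unfolding tangent_def
  using assms comps_vconj[of c X] ctangent_vconj[OF assms] ctangent_eqI[OF _ _ assms] by force

lemma smooth_field_open: "smooth_field A U Z \<Longrightarrow> open U"
  by (simp add: smooth_field_def)

lemma smooth_field_subset: "smooth_field A U Z \<Longrightarrow> open V \<Longrightarrow> V \<subseteq> U \<Longrightarrow> smooth_field A V Z"
  unfolding smooth_field_def by (meson subset_iff subset_trans)

lemma field_comps_Ck:
  assumes Z: "smooth_field A U Z"
  shows "Ck_on k (\<lambda>x. field_comps c Z x $ i) (snd c ` (U \<inter> fst c))"
proof -
  have U: "open (U \<inter> fst c)" using smooth_field_open[OF Z] open_dom[OF chart] by auto
  have "smooth_fun A (U \<inter> fst c) (crd c i)" using smooth_fun_subset[OF smooth_crd U] by auto
  then have "smooth_fun A (U \<inter> fst c) (\<lambda>p. Z p (crd c i))"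
    using Z by (auto simp: smooth_field_def)
  then have "Ck_on k ((\<lambda>p. Z p (crd c i)) \<circ> chart_inv c) (snd c ` (U \<inter> fst c \<inter> fst c))"
    using chart unfolding smooth_fun_def Ck_fun_def by blast
  then show ?thesis by (simp add: o_def field_comps_def comps_def Int_assoc)
qed

lemma field_comps_differentiable:
  assumes "smooth_field A U Z" "x \<in> snd c ` (U \<inter> fst c)"
  shows "(\<lambda>x. field_comps c Z x $ i) differentiable (at x)"
  using field_comps_Ck[OF assms(1), of "Suc 0"] assms(2) unfolding Ck_on.simps by blast

lemma field_comps_isCont:
  assumes "smooth_field A U Z" "x \<in> snd c ` (U \<inter> fst c)"
  shows "isCont (field_comps c Z) x"
  unfolding isCont_def
proof (rule vec_tendstoI)
  show "((\<lambda>y. field_comps c Z y $ i) \<longlongrightarrow> field_comps c Z x $ i) (at x)" for i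
    using differentiable_imp_continuous_within[OF field_comps_differentiable[OF assms]]
    by (simp add: continuous_within)
qed

lemma field_apply:
  assumes Z: "smooth_field A U Z" and f: "smooth_fun A V f" and x: "x \<in> snd c ` (U \<inter> V \<inter> fst c)"
  shows "Z (chart_inv c x) f = cderiv (f \<circ> chart_inv c) x (field_comps c Z x)"
proof -
  note i = chart_image_inv[OF chart x]
  have "smooth_near A (chart_inv c x) f" using f i by (auto simp: smooth_near_def)
  moreover have "Z (chart_inv c x) \<in> ctangent A (chart_inv c x)" using Z i by (auto simp: smooth_field_def)
  ultimately show ?thesis using ctangent_apply[of _ "chart_inv c x" f] i by (simp add: field_comps_def)
qed

lemma field_field_apply:
  assumes Z: "smooth_field A U Z" and W: "smooth_field A U W" and f: "smooth_fun A V f"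
    and p: "p \<in> U \<inter> V \<inter> fst c"
  shows "Z p (\<lambda>q. W q f)
    = cderiv (\<lambda>y. cderiv (f \<circ> chart_inv c) y (field_comps c W y)) (snd c p) (field_comps c Z (snd c p))"
proof -
  have UV: "open (U \<inter> V)" using smooth_field_open[OF Z] f by (auto simp: smooth_fun_def Ck_fun_def)
  have "smooth_fun A (U \<inter> V) (\<lambda>q. W q f)"
    using W smooth_fun_subset[OF f UV] by (auto simp: smooth_field_def)
  then have "Z p (\<lambda>q. W q f) = cderiv ((\<lambda>q. W q f) \<circ> chart_inv c) (snd c p) (field_comps c Z (snd c p))"
    using field_apply[OF Z, of "U \<inter> V" _ "snd c p"] p chart_inv_left[OF chart, of p] by simp
  also have "\<dots> = cderiv (\<lambda>y. cderiv (f \<circ> chart_inv c) y (field_comps c W y)) (snd c p) (field_comps c Z (snd c p))"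
  proof (rule cderiv_cong_open[OF open_chart_image[OF chart UV]])
    show "snd c p \<in> snd c ` (U \<inter> V \<inter> fst c)" using p by auto
  qed (simp add: field_apply[OF W f])
  finally show ?thesis .
qed

text \<open>The second order terms of the two compositions cancel by symmetry of the Hessian. In
  particular the bracket is a tangent vector, which its definition as an operator does not
  show.\<close>

lemma bracket_eq:
  assumes Z: "smooth_field A U Z" and W: "smooth_field A U W" and p: "p \<in> U \<inter> fst c"
  shows "bracket A Z W p = coord_vec A c p (\<chi> i.
     cderiv (\<lambda>y. field_comps c W y $ i) (snd c p) (field_comps c Z (snd c p)) -
     cderiv (\<lambda>y. field_comps c Z y $ i) (snd c p) (field_comps c W (snd c p)))" (is "_ = coord_vec A c p ?b")
proof
  fix f :: "'a \<Rightarrow> complex"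
  let ?x = "snd c p" and ?F = "f \<circ> chart_inv c"
  show "bracket A Z W p f = coord_vec A c p ?b f"
  proof (cases "smooth_near A p f")
    case True
    then obtain V where V: "p \<in> V" "smooth_fun A V f" by (auto simp: smooth_near_def)
    let ?S = "snd c ` (V \<inter> fst c)"
    have S: "open ?S" "?x \<in> ?S" "Ck_on (Suc (Suc 0)) ?F ?S"
      using V p chart open_chart_image[OF chart, of V] unfolding smooth_fun_def Ck_fun_def by blast+
    have x: "?x \<in> snd c ` (U \<inter> fst c)" using p by auto
    have pV: "p \<in> U \<inter> V \<inter> fst c" using p V by auto
    let ?z = "field_comps c Z ?x" and ?w = "field_comps c W ?x"
    have "(\<Sum>k\<in>UNIV. \<Sum>i\<in>UNIV. ?z $ k * ?w $ i * D2 ?F ?x (axis k 1) (axis i 1))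
        = (\<Sum>k\<in>UNIV. \<Sum>i\<in>UNIV. ?w $ k * ?z $ i * D2 ?F ?x (axis k 1) (axis i 1))"
      by (subst sum.swap) (simp add: D2_symmetric[OF S] mult_ac)
    then show ?thesis
      using True
      by (simp add: bracket_def coord_vec_apply field_field_apply[OF Z W V(2) pV] field_field_apply[OF W Z V(2) pV]
          cderiv_cderiv[OF S field_comps_differentiable[OF W x]] cderiv_cderiv[OF S field_comps_differentiable[OF Z x]]
          cderiv_diff_arg[symmetric] vec_eq_iff minus_vec_def)
  next
    case False
    then show ?thesis by (simp add: bracket_def coord_vec_apply)
  qed
qed

lemma field_comps_conj: "field_comps c (field_conj Z) x = cnj_vec (field_comps c Z x)"
  by (simp add: field_comps_def field_conj_def comps_vconj)

end

lemma smooth_field_conj: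
  assumes "smooth_manifold A" "smooth_field A U Z"
  shows "smooth_field A U (field_conj Z)"
  unfolding smooth_field_def
proof (intro conjI ballI allI impI)
  show "open U" using assms by (simp add: smooth_field_def)
next
  fix p assume "p \<in> U"
  obtain c where c: "c \<in> A" "p \<in> fst c" using assms(1) unfolding smooth_manifold_def by (metis UNIV_I UN_E)
  interpret manifold_chart A c by unfold_locales (use assms c in auto)
  show "field_conj Z p \<in> ctangent A p"
    unfolding field_conj_def using assms(2) \<open>p \<in> U\<close> c by (intro ctangent_vconj) (auto simp: smooth_field_def)
next
  fix V f assume V: "V \<subseteq> U" "smooth_fun A V f"
  show "smooth_fun A V (\<lambda>p. field_conj Z p f)"
  \<comment> \<open>Without a chart the locale cannot be interpreted; over an empty atlas smoothness
    amounts to openness of the domain.\<close>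
  proof (cases "A = {}")
    case True
    then show ?thesis using V by (simp add: smooth_fun_def Ck_fun_def)
  next
    case False
    then obtain c where "c \<in> A" by blast
    interpret manifold_chart A c by unfold_locales (use assms \<open>c \<in> A\<close> in auto)
    have "smooth_fun A V (\<lambda>p. Z p (\<lambda>q. cnj (f q)))"
      using assms(2) V smooth_fun_cnj[OF V(2)] by (auto simp: smooth_field_def)
    from smooth_fun_cnj[OF this] show ?thesis by (simp add: field_conj_def vconj_def)
  qed
qed

context manifold_chart
begin

lemma levi_bracket_eq:
  assumes Z: "smooth_field A U Z" and p: "p \<in> U \<inter> fst c"
  shows "- cscale \<i> (bracket A Z (field_conj Z) p)
    = coord_vec A c p (\<chi> i. complex_of_real (- 2 * Im (conj_deriv (field_comps c Z) (snd c p) $ i)))"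
proof -
  have x: "snd c p \<in> snd c ` (U \<inter> fst c)" using p by auto
  have "cderiv (\<lambda>y. cnj (field_comps c Z y $ i)) (snd c p) (field_comps c Z (snd c p))
      = cnj (conj_deriv (field_comps c Z) (snd c p) $ i)" for i
    using cderiv_cnj[OF field_comps_differentiable[OF Z x]] by (simp add: conj_deriv_def)
  then have "bracket A Z (field_conj Z) p = coord_vec A c p (\<chi> i.
      cnj (conj_deriv (field_comps c Z) (snd c p) $ i) - conj_deriv (field_comps c Z) (snd c p) $ i)" (is "_ = coord_vec A c p ?v")
    unfolding bracket_eq[OF Z smooth_field_conj[OF manifold Z] p] by (simp add: field_comps_conj conj_deriv_def)
  moreover have "(\<chi> i. complex_of_real (- 2 * Im (conj_deriv (field_comps c Z) (snd c p) $ i))) = (- \<i>) *s ?v"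
    by (simp add: vec_eq_iff complex_eq_iff)
  ultimately show ?thesis by (simp only: coord_vec_scale cscale_def) (simp add: fun_eq_iff)
qed

end


section \<open>The vector valued Levi form\<close>

locale CR_chart =
  fixes A :: "('a::{t2_space,second_countable_topology}, 'n::finite) chart set"
    and T :: "'a \<Rightarrow> 'a cvec set" and c :: "('a, 'n) chart"
  assumes CR: "almost_CR_manifold A T" and chart_A: "c \<in> A"

sublocale CR_chart \<subseteq> manifold_chart A c
  using CR chart_A by unfold_locales (auto simp: almost_CR_manifold_def)

context CR_chart
begin

lemma T_ctangent: "X \<in> T p \<Longrightarrow> X \<in> ctangent A p"
  using CR by (auto simp: almost_CR_manifold_def)

lemma T_Int_vconj: "X \<in> T p \<Longrightarrow> X = vconj Y \<Longrightarrow> Y \<in> T p \<Longrightarrow> X = 0"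
  using CR unfolding almost_CR_manifold_def by (metis IntI imageI singletonD)

lemma T_subspace: "cvec.subspace (T p)"
proof -
  obtain m U E where "p \<in> U" "\<forall>q\<in>U. T q = cvec.span ((\<lambda>j. E j q) ` {..<m::nat})"
    using CR unfolding almost_CR_manifold_def smooth_subbundle_def by metis
  then show ?thesis by (metis cvec.subspace_span)
qed

lemma T_closed_ops:
  "0 \<in> T p" "X \<in> T p \<Longrightarrow> Y \<in> T p \<Longrightarrow> X + Y \<in> T p" "X \<in> T p \<Longrightarrow> cscale a X \<in> T p"
  "(\<And>j. j \<in> I \<Longrightarrow> Z j \<in> T p) \<Longrightarrow> (\<Sum>j\<in>I. Z j) \<in> T p"
  using T_subspace[of p] by (auto simp: cvec.subspace_def intro: cvec.subspace_sum[OF T_subspace])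

text \<open>The functionals are dual to the frame at the centre \<open>p\<close> only. At nearby
  points the matrix of values \<open>L k (E l q)\<close> is just close to the identity, which is
  enough to bound coefficients.\<close>

definition dual_frame ::
  "'a \<Rightarrow> nat \<Rightarrow> 'a set \<Rightarrow> (nat \<Rightarrow> 'a \<Rightarrow> 'a cvec) \<Rightarrow> (nat \<Rightarrow> 'a cvec \<Rightarrow> complex) \<Rightarrow> bool" where
  "dual_frame p m U E L \<longleftrightarrow> open U \<and> p \<in> U \<and> (\<forall>j<m. E j \<in> CR_sections A T U) \<and>
    (\<forall>q\<in>U. \<forall>W\<in>T q. \<exists>a. W = (\<Sum>j<m. cscale (a j) (E j q))) \<and>
    (\<forall>k X Y. L k (X + Y) = L k X + L k Y) \<and> (\<forall>k a X. L k (cscale a X) = a * L k X) \<and>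
    (\<forall>k<m. \<forall>l<m. L k (E l p) = (if k = l then 1 else 0))"

lemma dual_frameD:
  assumes "dual_frame p m U E L"
  shows "open U" "p \<in> U" "\<And>j. j < m \<Longrightarrow> E j \<in> CR_sections A T U"
    "\<And>j. j < m \<Longrightarrow> smooth_field A U (E j)" "\<And>j q. j < m \<Longrightarrow> q \<in> U \<Longrightarrow> E j q \<in> T q"
    "\<And>q W. q \<in> U \<Longrightarrow> W \<in> T q \<Longrightarrow> \<exists>a. W = (\<Sum>j<m. cscale (a j) (E j q))"
    "\<And>k X Y. L k (X + Y) = L k X + L k Y" "\<And>k a X. L k (cscale a X) = a * L k X"
    "\<And>k l. k < m \<Longrightarrow> l < m \<Longrightarrow> L k (E l p) = (if k = l then 1 else 0)"
  using assms by (simp_all add: dual_frame_def CR_sections_def)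

text \<open>When the rank is \<open>0\<close> the neighbourhood given by \<open>smooth_subbundle\<close> need not be open.\<close>

lemma ex_dual_frame: "\<exists>m U E L. dual_frame p m U E L"
proof -
  obtain m where m: "\<forall>p. \<exists>U E. p \<in> U \<and> (\<forall>j<m::nat. smooth_field A U (E j)) \<and>
     (\<forall>q\<in>U. inj_on (\<lambda>j. E j q) {..<m} \<and> cvec.independent ((\<lambda>j. E j q) ` {..<m}) \<and>
        T q = cvec.span ((\<lambda>j. E j q) ` {..<m}))"
    using CR unfolding almost_CR_manifold_def smooth_subbundle_def by blast
  then obtain U E where U: "p \<in> U" "\<And>j. j < m \<Longrightarrow> smooth_field A U (E j)"
     "\<And>q. q \<in> U \<Longrightarrow> inj_on (\<lambda>j. E j q) {..<m}" "\<And>q. q \<in> U \<Longrightarrow> cvec.independent ((\<lambda>j. E j q) ` {..<m})"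
     "\<And>q. q \<in> U \<Longrightarrow> T q = cvec.span ((\<lambda>j. E j q) ` {..<m})"
    by metis
  show ?thesis
  proof (cases "m = 0")
    case True
    have "T q = {0}" for q using m True by (metis cvec.span_empty image_empty lessThan_0)
    then have "dual_frame p 0 UNIV E (\<lambda>_ _. 0)" by (simp add: dual_frame_def)
    then show ?thesis by blast
  next
    case False
    have "open U" using U(2)[of 0] False by (simp add: smooth_field_def)
    interpret vector_space "(*) :: complex \<Rightarrow> complex \<Rightarrow> complex"
      by standard (simp_all add: algebra_simps)
    interpret pair: vector_space_pair "cscale :: complex \<Rightarrow> 'a cvec \<Rightarrow> 'a cvec" "(*) :: complex \<Rightarrow> complex \<Rightarrow> complex"
      by unfold_locales
    have "\<exists>g. Vector_Spaces.linear cscale (*) g \<and>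
        (\<forall>x\<in>(\<lambda>j. E j p) ` {..<m}. g x = (if x = E k p then 1 else 0 :: complex))" for k
      by (rule pair.linear_independent_extend[OF U(4)[OF U(1)]])
    then obtain L where L: "\<And>k. Vector_Spaces.linear cscale (*) (L k)"
      "\<And>k l. l < m \<Longrightarrow> L k (E l p) = (if E l p = E k p then 1 else 0)"
      by (metis (no_types, lifting) image_eqI lessThan_iff)
    have span: "\<exists>a. W = (\<Sum>j<m. cscale (a j) (E j q))" if "q \<in> U" "W \<in> T q" for q W
    proof -
      have "W \<in> range (\<lambda>u. \<Sum>v\<in>(\<lambda>j. E j q) ` {..<m}. cscale (u v) v)"
        using that U(5) cvec.span_finite[of "(\<lambda>j. E j q) ` {..<m}"] by simp
      then obtain u where "W = (\<Sum>v\<in>(\<lambda>j. E j q) ` {..<m}. cscale (u v) v)" by blast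
      also have "\<dots> = (\<Sum>j<m. cscale (u (E j q)) (E j q))"
        using U(3)[OF that(1)] by (simp add: sum.reindex)
      finally show ?thesis by (intro exI[of _ "\<lambda>j. u (E j q)"])
    qed
    have "E j \<in> CR_sections A T U" if "j < m" for j
      using that U(2,5) by (auto simp: CR_sections_def intro: cvec.span_base)
    moreover have "L k (E l p) = (if k = l then 1 else 0)" if "k < m" "l < m" for k l
      using that L(2) inj_onD[OF U(3)[OF U(1)], of l k] by auto
    ultimately have "dual_frame p m U E L"
      unfolding dual_frame_def using \<open>open U\<close> U(1) span L(1) by (simp add: Vector_Spaces.linear_iff)
    then show ?thesis by blast
  qed
qed

section \<open>The fibres of T in coordinates and their behaviour under limits\<close>

definition TC :: "real ^ 'n \<Rightarrow> (complex ^ 'n) set" where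
  "TC x = comps c ` T (chart_inv c x)"

lemma TC_ops:
  "0 \<in> TC x" "z \<in> TC x \<Longrightarrow> w \<in> TC x \<Longrightarrow> z + w \<in> TC x" "z \<in> TC x \<Longrightarrow> a *s z \<in> TC x"
proof -
  show "0 \<in> TC x" unfolding TC_def using T_closed_ops(1) comps_0 by (metis imageI)
  show "z \<in> TC x \<Longrightarrow> w \<in> TC x \<Longrightarrow> z + w \<in> TC x"
    unfolding TC_def using T_closed_ops(2) comps_add by (smt (verit) image_iff)
  show "z \<in> TC x \<Longrightarrow> a *s z \<in> TC x"
    unfolding TC_def using T_closed_ops(3) comps_cscale by (smt (verit) image_iff)
qed

lemma TC_sum: "(\<And>j. j \<in> I \<Longrightarrow> z j \<in> TC x) \<Longrightarrow> (\<Sum>j\<in>I. z j) \<in> TC x"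
  by (induction I rule: infinite_finite_induct) (auto intro: TC_ops)

lemma scaleR_vec_eq: "t *\<^sub>R (v :: complex ^ 'n) = complex_of_real t *s v"
  by (simp add: vec_eq_iff scaleR_conv_of_real[where 'a = complex])

lemma TC_closed: "closed (TC x)"
  by (rule closed_subspace) (simp add: subspace_def scaleR_vec_eq TC_ops)

lemma bounded_mult_tendsto_0:
  fixes a d :: "nat \<Rightarrow> complex"
  assumes "\<forall>\<^sub>F n in sequentially. norm (a n) \<le> K" "d \<longlonglongrightarrow> 0"
  shows "(\<lambda>n. a n * d n) \<longlonglongrightarrow> 0"
proof (rule Lim_null_comparison)
  show "\<forall>\<^sub>F n in sequentially. norm (a n * d n) \<le> K * norm (d n)"
    using assms(1) by eventually_elim (auto simp: norm_mult intro: mult_right_mono)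
  show "(\<lambda>n. K * norm (d n)) \<longlonglongrightarrow> 0"
    using assms(2) by (intro tendsto_mult_right_zero) (simp add: tendsto_norm_zero)
qed

text \<open>Closedness of the bundle. The coefficients of \<open>ws n\<close> in a local frame stay
  bounded, because the matrix of the dual functionals on the frame is close to the identity.
  Replacing the frame at \<open>xs n\<close> by the frame at the limit point then changes
  \<open>ws n\<close> by a null sequence, and a single fibre is closed.\<close>

lemma TC_limit:
  assumes p: "p \<in> fst c" and xs: "xs \<longlonglongrightarrow> snd c p" and ws: "\<forall>\<^sub>F n in sequentially. ws n \<in> TC (xs n)"
    and lim: "ws \<longlonglongrightarrow> w"
  shows "w \<in> TC (snd c p)"
proof -
  let ?x = "snd c p"
  obtain m U E L where F: "dual_frame p m U E L" using ex_dual_frame by blast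
  note U = dual_frameD(1,2,4-6)[OF F] and L = dual_frameD(7-9)[OF F]
  define e where "e j = field_comps c (E j)" for j
  define L' where "L' k v = L k (coord_vec A c p v)" for k v
  have L'_add: "L' k (v + w) = L' k v + L' k w" and L'_scale: "L' k (a *s v) = a * L' k v" for k a v w
    by (simp_all add: L'_def coord_vec_add coord_vec_scale L)
  have L'_0: "L' k 0 = 0" for k using L'_scale[of k 0 0] by simp
  have L'_sum: "L' k (\<Sum>j\<in>I. v j) = (\<Sum>j\<in>I. L' k (v j))" for k I and v :: "'i \<Rightarrow> _"
    by (induction I rule: infinite_finite_induct) (auto simp: L'_0 L'_add)
  have L'_expand: "L' k v = (\<Sum>i\<in>UNIV. v $ i * L' k (axis i 1))" for k v
    using L'_sum[of k "\<lambda>i. v $ i *s axis i 1" UNIV] by (simp add: basis_expansion L'_scale)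
  have L'_tendsto: "(\<lambda>n. L' k (v n)) \<longlonglongrightarrow> L' k a" if "v \<longlonglongrightarrow> a" for k v a
    unfolding L'_expand[of k "v _"] L'_expand[of k a]
    by (intro tendsto_intros that)
  have x: "?x \<in> snd c ` (U \<inter> fst c)" using p U(2) by auto
  have inv_x: "chart_inv c ?x = p" using chart_inv_left[OF chart p] .
  have e_tendsto: "(\<lambda>n. e l (xs n)) \<longlonglongrightarrow> e l ?x" if "l < m" for l
    unfolding e_def by (rule isCont_tendsto_compose[OF field_comps_isCont[OF U(3)[OF that] x] xs])
  have coord_e: "coord_vec A c p (e l ?x) = E l p" if "l < m" for l
    using ctangent_eq_coord_vec[OF T_ctangent[OF U(4)[OF that U(2)]] p]
    by (simp add: e_def field_comps_def inv_x)
  have L'_e: "L' k (e l ?x) = (if k = l then 1 else 0)" if "k < m" "l < m" for k l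
    using L(3)[OF that] coord_e[OF that(2)] by (simp add: L'_def)
  have evU: "\<forall>\<^sub>F n in sequentially. xs n \<in> snd c ` (U \<inter> fst c)"
    using xs open_chart_image[OF chart U(1)] x by (rule topological_tendstoD)
  have "\<forall>n. \<exists>a. xs n \<in> snd c ` (U \<inter> fst c) \<longrightarrow> ws n \<in> TC (xs n) \<longrightarrow> ws n = (\<Sum>j<m. a j *s e j (xs n))"
  proof
    fix n
    show "\<exists>a. xs n \<in> snd c ` (U \<inter> fst c) \<longrightarrow> ws n \<in> TC (xs n) \<longrightarrow> ws n = (\<Sum>j<m. a j *s e j (xs n))"
    proof (cases "xs n \<in> snd c ` (U \<inter> fst c) \<and> ws n \<in> TC (xs n)")
      case True
      then have "chart_inv c (xs n) \<in> U" using chart_image_inv(1)[OF chart] by blast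
      then obtain a where "ws n = comps c (\<Sum>j<m. cscale (a j) (E j (chart_inv c (xs n))))"
        using True U(5) by (auto simp: TC_def)
      then show ?thesis
        by (intro exI[of _ a]) (simp add: comps_sum comps_cscale e_def field_comps_def)
    qed auto
  qed
  then obtain a where a: "\<And>n. xs n \<in> snd c ` (U \<inter> fst c) \<Longrightarrow> ws n \<in> TC (xs n) \<Longrightarrow> ws n = (\<Sum>j<m. a n j *s e j (xs n))"
    by metis
  have rep: "\<forall>\<^sub>F n in sequentially. ws n = (\<Sum>j<m. a n j *s e j (xs n))"
    using evU ws by eventually_elim (rule a)
  define \<delta> where "\<delta> k l = (if k = l then 1 else 0 :: complex)" for k l :: nat
  \<comment> \<open>With \<open>S\<close> the sum of the moduli of the coefficients of
    \<open>ws n\<close>, the estimates give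
    \<open>S \<le> (\<Sum>k<m. norm (L' k (ws n))) + S / 2\<close>, and the sum on the right is
    eventually below its limit plus 1.\<close>
  define K where "K = 2 * ((\<Sum>k<m. norm (L' k w)) + 1)"
  \<comment> \<open>Summed over the \<open>m\<close> functionals, this tolerance contributes at most
    half of the sum of the coefficients; the 1 keeps the denominator positive for rank 0.\<close>
  have ev1: "\<forall>\<^sub>F n in sequentially. \<forall>k\<in>{..<m}. \<forall>l\<in>{..<m}. norm (L' k (e l (xs n)) - \<delta> k l) < 1 / (2 * (real m + 1))"
  proof (intro eventually_ball_finite ballI finite_lessThan)
    fix k l assume kl: "k \<in> {..<m}" "l \<in> {..<m}"
    have "(\<lambda>n. L' k (e l (xs n))) \<longlonglongrightarrow> \<delta> k l"
      using L'_tendsto[OF e_tendsto, of l k] kl L'_e[of k l] by (simp add: \<delta>_def)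
    then show "\<forall>\<^sub>F n in sequentially. norm (L' k (e l (xs n)) - \<delta> k l) < 1 / (2 * (real m + 1))"
      using tendstoD[of _ "\<delta> k l" sequentially "1 / (2 * (real m + 1))"] by (simp add: dist_norm)
  qed
  have "(\<lambda>n. \<Sum>k<m. norm (L' k (ws n))) \<longlonglongrightarrow> (\<Sum>k<m. norm (L' k w))"
    by (intro tendsto_intros L'_tendsto lim)
  then have ev2: "\<forall>\<^sub>F n in sequentially. (\<Sum>k<m. norm (L' k (ws n))) < (\<Sum>k<m. norm (L' k w)) + 1"
    by (rule order_tendstoD) simp
  have bound: "\<forall>\<^sub>F n in sequentially. (\<Sum>l<m. norm (a n l)) \<le> K"
    using ev1 ev2 rep
  proof eventually_elim
    case (elim n)
    let ?S = "\<Sum>l<m. norm (a n l)"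
    have "norm (a n k) \<le> norm (L' k (ws n)) + ?S / (2 * (real m + 1))" if k: "k < m" for k
    proof -
      have "L' k (ws n) = (\<Sum>l<m. a n l * L' k (e l (xs n)))"
        unfolding elim(3) by (simp add: L'_sum L'_scale)
      also have "\<dots> = (\<Sum>l<m. a n l * \<delta> k l) + (\<Sum>l<m. a n l * (L' k (e l (xs n)) - \<delta> k l))"
        by (simp add: algebra_simps sum.distrib[symmetric])
      also have "(\<Sum>l<m. a n l * \<delta> k l) = a n k"
        using k by (simp add: \<delta>_def if_distrib cong: if_cong)
      finally have "norm (a n k) = norm (L' k (ws n) - (\<Sum>l<m. a n l * (L' k (e l (xs n)) - \<delta> k l)))" by simp
      also have "\<dots> \<le> norm (L' k (ws n)) + norm (\<Sum>l<m. a n l * (L' k (e l (xs n)) - \<delta> k l))"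
        by (rule norm_triangle_ineq4)
      also have "norm (\<Sum>l<m. a n l * (L' k (e l (xs n)) - \<delta> k l)) \<le> (\<Sum>l<m. norm (a n l) * (1 / (2 * (real m + 1))))"
      proof (rule sum_norm_le)
        fix l assume "l \<in> {..<m}"
        then have "norm (L' k (e l (xs n)) - \<delta> k l) \<le> 1 / (2 * (real m + 1))"
          using elim(1) k by (auto intro: less_imp_le)
        then show "norm (a n l * (L' k (e l (xs n)) - \<delta> k l)) \<le> norm (a n l) * (1 / (2 * (real m + 1)))"
          unfolding norm_mult by (rule mult_left_mono) simp
      qed
      finally show ?thesis by (simp add: sum_divide_distrib)
    qed
    then have "?S \<le> (\<Sum>k<m. norm (L' k (ws n)) + ?S / (2 * (real m + 1)))" by (intro sum_mono) auto
    also have "\<dots> = (\<Sum>k<m. norm (L' k (ws n))) + real m * (?S / (2 * (real m + 1)))"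
      by (simp add: sum.distrib)
    also have "\<dots> \<le> (\<Sum>k<m. norm (L' k (ws n))) + ?S / 2"
    proof (rule add_left_mono)
      have "0 \<le> ?S" by (intro sum_nonneg) auto
      then have "real m * ?S \<le> (real m + 1) * ?S" by (intro mult_right_mono) auto
      then show "real m * (?S / (2 * (real m + 1))) \<le> ?S / 2" by (simp add: field_simps)
    qed
    finally have S: "?S \<le> (\<Sum>k<m. norm (L' k (ws n))) + ?S / 2" .
    have "s \<le> 2 * (q + 1)" if "s \<le> p + s / 2" "p < q + 1" for s p q :: real
      using that by (simp add: field_simps)
    from this[OF S elim(2)] show ?case unfolding K_def .
  qed
  have bound1: "\<forall>\<^sub>F n in sequentially. norm (a n l) \<le> K" if "l < m" for l
    using bound
  proof eventually_elim
    case (elim n)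
    have "norm (a n l) \<le> (\<Sum>l<m. norm (a n l))" using that by (intro member_le_sum) auto
    then show ?case using elim by linarith
  qed
  \<comment> \<open>The coefficients need not converge. Being bounded, they can be paired with the
    frame at the limit point without changing the limit of \<open>ws\<close>.\<close>
  define u where "u n = (\<Sum>l<m. a n l *s e l ?x)" for n
  have "u \<longlonglongrightarrow> w"
  proof (rule vec_tendstoI)
    fix i
    have "(\<lambda>n. ws n $ i - (\<Sum>l<m. a n l * (e l (xs n) $ i - e l ?x $ i))) \<longlonglongrightarrow> w $ i - (\<Sum>l<m. 0)"
    proof (intro tendsto_diff tendsto_sum bounded_mult_tendsto_0[OF bound1])
      show "(\<lambda>n. ws n $ i) \<longlonglongrightarrow> w $ i" by (intro tendsto_intros lim)
      show "(\<lambda>n. e l (xs n) $ i - e l ?x $ i) \<longlonglongrightarrow> 0" if "l \<in> {..<m}" for l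
        using tendsto_vec_nth[OF e_tendsto[of l], of i] that by (simp add: LIM_zero)
    qed auto
    moreover have "\<forall>\<^sub>F n in sequentially. ws n $ i - (\<Sum>l<m. a n l * (e l (xs n) $ i - e l ?x $ i)) = u n $ i"
      using rep by eventually_elim (simp add: u_def right_diff_distrib sum_subtractf)
    ultimately show "(\<lambda>n. u n $ i) \<longlonglongrightarrow> w $ i" using tendsto_cong by fastforce
  qed
  moreover have "u n \<in> TC ?x" for n
    unfolding u_def
  proof (intro TC_sum TC_ops(3))
    show "e l ?x \<in> TC ?x" if "l \<in> {..<m}" for l
      using U(4)[of l p] U(2) that by (auto simp: TC_def e_def field_comps_def inv_x)
  qed
  ultimately show ?thesis
    using closed_sequentially[OF TC_closed] by blast
qed

text \<open>As \<open>z\<close> vanishes at the point, its difference quotients are multiples of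
  values of \<open>z\<close> and lie in the neighbouring fibres; by \<open>TC_limit\<close> the
  derivative in a real direction lies in the fibre at the point itself. Complex directions follow by
  linearity.\<close>

lemma TC_derivative:
  assumes p: "p \<in> fst c" and z: "\<And>i. (\<lambda>y. z y $ i) differentiable (at (snd c p))"
    and TC: "\<forall>\<^sub>F x in nhds (snd c p). z x \<in> TC x" and zero: "z (snd c p) = 0"
  shows "(\<chi> i. cderiv (\<lambda>y. z y $ i) (snd c p) v) \<in> TC (snd c p)"
proof -
  let ?x = "snd c p"
  obtain D where D: "\<And>i. ((\<lambda>y. z y $ i) has_derivative D i) (at ?x)"
    using z unfolding differentiable_def by metis
  have real_dir: "(\<chi> i. D i u) \<in> TC ?x" for u
  proof -
    define t where "t n = 1 / real (Suc n)" for n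
    have t: "t \<longlonglongrightarrow> 0" "\<And>n. 0 < t n"
      using LIMSEQ_1_over_Suc by (simp_all add: t_def[abs_def])
    have "(\<lambda>n. ?x + t n *\<^sub>R u) \<longlonglongrightarrow> ?x + 0 *\<^sub>R u" by (intro tendsto_intros t)
    then have xs: "(\<lambda>n. ?x + t n *\<^sub>R u) \<longlonglongrightarrow> ?x" by simp
    show ?thesis
    proof (rule TC_limit[OF p xs])
      show "\<forall>\<^sub>F n in sequentially. complex_of_real (1 / t n) *s z (?x + t n *\<^sub>R u) \<in> TC (?x + t n *\<^sub>R u)"
        using eventually_compose_filterlim[OF TC xs] by eventually_elim (rule TC_ops)
      show "(\<lambda>n. complex_of_real (1 / t n) *s z (?x + t n *\<^sub>R u)) \<longlonglongrightarrow> (\<chi> i. D i u)"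
      proof (rule vec_tendstoI)
        fix i
        show "(\<lambda>n. (complex_of_real (1 / t n) *s z (?x + t n *\<^sub>R u)) $ i) \<longlonglongrightarrow> (\<chi> i. D i u) $ i"
          using has_derivative_sequence[OF D[of i] t tendsto_const, of u] zero
          by (simp add: scaleR_conv_of_real inverse_eq_divide)
      qed
    qed
  qed
  have "(\<chi> i. cderiv (\<lambda>y. z y $ i) ?x v) = (\<chi> i. D i (Re_vec v)) + \<i> *s (\<chi> i. D i (Im_vec v))"
    by (simp add: vec_eq_iff cderiv_eq[OF D])
  then show ?thesis using real_dir TC_ops(2,3) by metis
qed

lemma field_comps_TC:
  assumes "Z \<in> CR_sections A T U" "x \<in> snd c ` (U \<inter> fst c)"
  shows "field_comps c Z x \<in> TC x"
  using assms chart_image_inv(1)[OF chart assms(2)] by (auto simp: CR_sections_def TC_def field_comps_def)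

text \<open>The form \<open>Z \<mapsto> [Z, conj Z]\<close> is determined modulo \<open>T + conj T\<close> by the tensor \<open>Z \<otimes> conj Z\<close> at \<open>p\<close>: subtract
  the combination of the frame with constant coefficients and the same value at \<open>p\<close>; the derivative
  of the remainder is tangent to \<open>T\<close>.\<close>

lemma conj_deriv_sum_in_TC:
  assumes I: "finite I" and Z: "\<And>j. j \<in> I \<Longrightarrow> Z j \<in> CR_sections A T U" and p: "p \<in> U \<inter> fst c"
    and tensor0: "(\<Sum>j\<in>I. t j *\<^sub>R tensor (Z j p) (vconj (Z j p))) = 0"
  shows "(\<Sum>j\<in>I. complex_of_real (t j) *s conj_deriv (field_comps c (Z j)) (snd c p)) \<in> TC (snd c p)"
proof -
  let ?x = "snd c p"
  have pc: "p \<in> fst c" using p by simp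
  obtain m V E L where F: "dual_frame p m V E L" using ex_dual_frame by blast
  note V = dual_frameD(1,2,4-6)[OF F] and L = dual_frameD(7-9)[OF F] and EV = dual_frameD(3)[OF F]
  have L0: "L k 0 = 0" for k using L(2)[of k 0 0] by (simp add: cscale_def zero_fun_def)
  have L_sum: "L k (\<Sum>j\<in>J. X j) = (\<Sum>j\<in>J. L k (X j))" for k J and X :: "'i \<Rightarrow> _"
  proof (induction J rule: infinite_finite_induct)
    case (insert x F)
    then show ?case unfolding sum.insert[OF insert.hyps(1,2)] by (simp only: L(1))
  qed (simp_all only: sum.infinite sum.empty L0 not_False_eq_True)
  have ZT: "Z j p \<in> T p" if "j \<in> I" for j using Z[OF that] p by (auto simp: CR_sections_def)
  define a where "a j k = L k (Z j p)" for j k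
  have Z_rep: "Z j p = (\<Sum>k<m. cscale (a j k) (E k p))" if j: "j \<in> I" for j
  proof -
    obtain b where b: "Z j p = (\<Sum>k<m. cscale (b k) (E k p))" using V(5)[OF V(2) ZT[OF j]] by blast
    have "a j k = b k" if "k < m" for k
    proof -
      have "a j k = (\<Sum>l<m. b l * (if k = l then 1 else 0))"
        unfolding a_def b L_sum L(2) using L(3)[OF that] by (intro sum.cong) auto
      then show ?thesis using that by (simp add: if_distrib cong: if_cong)
    qed
    then show ?thesis unfolding b by (intro sum.cong) auto
  qed
  \<comment> \<open>Fixing the second argument of the vanishing tensor gives a linear relation
    between the \<open>Z j p\<close>, to which \<open>L k\<close> applies. The result holds for all
    arguments, so its conjugate is again a linear relation between the \<open>Z j p\<close>, and
    \<open>L l\<close> applies to that.\<close>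
  have gram: "(\<Sum>j\<in>I. complex_of_real (t j) * a j k * cnj (a j l)) = 0" for k l
  proof -
    have 1: "(\<Sum>j\<in>I. complex_of_real (t j) * cnj (Z j p h) * a j k) = 0" for h
    proof -
      have "(\<Sum>j\<in>I. cscale (complex_of_real (t j) * cnj (Z j p h)) (Z j p)) = 0"
      proof
        fix f
        have "(\<Sum>j\<in>I. t j *\<^sub>R tensor (Z j p) (vconj (Z j p))) f (\<lambda>q. cnj (h q)) = 0"
          unfolding tensor0 by simp
        then show "(\<Sum>j\<in>I. cscale (complex_of_real (t j) * cnj (Z j p h)) (Z j p)) f = 0 f"
          by (simp add: sum_fun_apply scaleR_fun_def tensor_def vconj_def cscale_def scaleR_conv_of_real mult_ac)
      qed
      then have "L k (\<Sum>j\<in>I. cscale (complex_of_real (t j) * cnj (Z j p h)) (Z j p)) = 0" by (simp only: L0)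
      then show ?thesis by (simp add: L_sum L(2) a_def)
    qed
    have "(\<Sum>j\<in>I. cscale (complex_of_real (t j) * cnj (a j k)) (Z j p)) = 0"
    proof
      fix h
      have "cnj (\<Sum>j\<in>I. complex_of_real (t j) * cnj (Z j p h) * a j k) = 0" unfolding 1 by simp
      then show "(\<Sum>j\<in>I. cscale (complex_of_real (t j) * cnj (a j k)) (Z j p)) h = 0 h"
        by (simp add: sum_fun_apply cscale_def mult_ac)
    qed
    then have "L l (\<Sum>j\<in>I. cscale (complex_of_real (t j) * cnj (a j k)) (Z j p)) = 0" by (simp only: L0)
    then have "(\<Sum>j\<in>I. complex_of_real (t j) * cnj (a j k) * a j l) = 0" by (simp add: L_sum L(2) a_def)
    then have "cnj (\<Sum>j\<in>I. complex_of_real (t j) * cnj (a j k) * a j l) = 0" by simp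
    then show ?thesis by (simp add: mult_ac)
  qed
  define e where "e k = field_comps c (E k)" for k
  define z where "z j = field_comps c (Z j)" for j
  define r where "r j y = z j y - (\<Sum>k<m. a j k *s e k y)" for j y
  define B where "B k l = (\<chi> i. cderiv (\<lambda>y. e k y $ i) ?x (cnj_vec (e l ?x)))" for k l
  let ?B = "\<lambda>j. \<Sum>k<m. \<Sum>l<m. (a j k * cnj (a j l)) *s B k l"
  define Y where "Y j = (\<chi> i. cderiv (\<lambda>y. r j y $ i) ?x (cnj_vec (z j ?x)))" for j
  have xU: "?x \<in> snd c ` (U \<inter> fst c)" and xV: "?x \<in> snd c ` (V \<inter> fst c)" using p V(2) by auto
  have inv_x: "chart_inv c ?x = p" using chart_inv_left[OF chart pc] .
  have z_diff: "(\<lambda>y. z j y $ i) differentiable (at ?x)" if "j \<in> I" for j i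
    unfolding z_def using Z[OF that] xU by (intro field_comps_differentiable) (auto simp: CR_sections_def)
  have e_diff: "(\<lambda>y. e k y $ i) differentiable (at ?x)" if "k < m" for k i
    unfolding e_def using V(3)[OF that] xV by (rule field_comps_differentiable)
  have r_diff: "(\<lambda>y. r j y $ i) differentiable (at ?x)" if "j \<in> I" for j i
    unfolding r_def using z_diff[OF that] e_diff
    by (auto intro!: differentiable_diff differentiable_sum differentiable_mult)
  have zx: "z j ?x = (\<Sum>k<m. a j k *s e k ?x)" if "j \<in> I" for j
    unfolding z_def e_def field_comps_def inv_x by (subst Z_rep[OF that]) (simp add: comps_sum comps_cscale)
  have Y: "Y j \<in> TC ?x" if j: "j \<in> I" for j
    unfolding Y_def
  proof (rule TC_derivative[OF pc r_diff[OF j]])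
    have UV: "open (U \<inter> V)" using Z[OF j] V(1) by (auto simp: CR_sections_def smooth_field_def)
    have "\<forall>\<^sub>F x in nhds ?x. x \<in> snd c ` (U \<inter> V \<inter> fst c)"
      using open_chart_image[OF chart UV] p V(2) by (intro eventually_nhds_in_open) auto
    then show "\<forall>\<^sub>F x in nhds ?x. r j x \<in> TC x"
    proof eventually_elim
      case (elim x)
      have eq: "r j x = z j x + (\<Sum>k<m. (- a j k) *s e k x)"
        by (simp add: r_def vec_eq_iff sum_negf)
      have "z j x \<in> TC x" unfolding z_def using field_comps_TC[OF Z[OF j]] elim by auto
      moreover have "e k x \<in> TC x" if "k < m" for k
        unfolding e_def using field_comps_TC[OF EV[OF that]] elim by auto
      ultimately show ?case unfolding eq by (intro TC_ops TC_sum) auto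
    qed
    show "r j ?x = 0" by (simp add: r_def zx[OF j])
  qed
  \<comment> \<open>\<open>z j\<close> is the remainder plus a frame combination with constant
    coefficients. On the latter the derivative falls on the frame alone, which leaves an expression
    sesquilinear in the coefficients.\<close>
  have conj_z: "conj_deriv (z j) ?x = Y j + ?B j" if j: "j \<in> I" for j
    unfolding vec_eq_iff
  proof
    fix i
    have "(\<lambda>y. z j y $ i) = (\<lambda>y. r j y $ i + (\<Sum>k<m. a j k * e k y $ i))"
      by (simp add: r_def)
    then have "conj_deriv (z j) ?x $ i
        = cderiv (\<lambda>y. r j y $ i + (\<Sum>k<m. a j k * e k y $ i)) ?x (cnj_vec (z j ?x))"
      by (simp add: conj_deriv_def)
    also have "\<dots> = Y j $ i + (\<Sum>k<m. a j k * cderiv (\<lambda>y. e k y $ i) ?x (cnj_vec (z j ?x)))"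
    proof -
      have "cderiv (\<lambda>y. \<Sum>k<m. a j k * e k y $ i) ?x (cnj_vec (z j ?x))
          = (\<Sum>k<m. cderiv (\<lambda>y. a j k * e k y $ i) ?x (cnj_vec (z j ?x)))"
        by (rule cderiv_sum) (auto intro!: differentiable_mult e_diff)
      also have "\<dots> = (\<Sum>k<m. a j k * cderiv (\<lambda>y. e k y $ i) ?x (cnj_vec (z j ?x)))"
        by (intro sum.cong refl cderiv_cmult e_diff) auto
      finally show ?thesis
        using r_diff[OF j] e_diff
        by (subst cderiv_add) (auto simp: Y_def intro!: differentiable_sum differentiable_mult)
    qed
    also have "cnj_vec (z j ?x) = (\<Sum>l<m. cnj (a j l) *s cnj_vec (e l ?x))"
      unfolding zx[OF j] by (simp add: vec_eq_iff)
    finally show "conj_deriv (z j) ?x $ i = (Y j + ?B j) $ i"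
      by (simp add: cderiv_sum_arg cderiv_scale_arg B_def sum_distrib_left mult.assoc)
  qed
  \<comment> \<open>The frame parts depend on the coefficients only through the Gram matrix, which
    is 0.\<close>
  have "(\<Sum>j\<in>I. complex_of_real (t j) *s ?B j) = 0"
    unfolding vec_eq_iff
  proof
    fix i
    have "(\<Sum>j\<in>I. complex_of_real (t j) *s ?B j) $ i
      = (\<Sum>j\<in>I. \<Sum>k<m. \<Sum>l<m. (complex_of_real (t j) * a j k * cnj (a j l)) * B k l $ i)"
      by (simp add: sum_distrib_left mult.assoc)
    also have "\<dots> = (\<Sum>k<m. \<Sum>l<m. (\<Sum>j\<in>I. complex_of_real (t j) * a j k * cnj (a j l)) * B k l $ i)"
      unfolding sum_distrib_right by (subst sum.swap, intro sum.cong refl, rule sum.swap)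
    finally show "(\<Sum>j\<in>I. complex_of_real (t j) *s ?B j) $ i = 0 $ i"
      by (simp add: gram)
  qed
  then have "(\<Sum>j\<in>I. complex_of_real (t j) *s conj_deriv (z j) ?x) = (\<Sum>j\<in>I. complex_of_real (t j) *s Y j)"
    by (simp add: conj_z vector_add_ldistrib sum.distrib)
  also have "\<dots> \<in> TC ?x" using Y by (intro TC_sum TC_ops(3))
  finally show ?thesis by (simp add: z_def)
qed

lemma levi_sum_eq:
  assumes Z: "\<And>j. j \<in> I \<Longrightarrow> smooth_field A U (Z j)" and p: "p \<in> U \<inter> fst c"
  shows "(\<Sum>j\<in>I. t j *\<^sub>R (- cscale \<i> (bracket A (Z j) (field_conj (Z j)) p))) = coord_vec A c p
    (\<chi> i. complex_of_real (- 2 * (\<Sum>j\<in>I. t j * Im (conj_deriv (field_comps c (Z j)) (snd c p) $ i))))"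
proof -
  let ?v = "\<lambda>j. \<chi> i. complex_of_real (- 2 * Im (conj_deriv (field_comps c (Z j)) (snd c p) $ i))"
  have "(\<Sum>j\<in>I. t j *\<^sub>R (- cscale \<i> (bracket A (Z j) (field_conj (Z j)) p)))
    = (\<Sum>j\<in>I. coord_vec A c p (complex_of_real (t j) *s
        ?v j))"
    by (intro sum.cong refl) (simp only: levi_bracket_eq[OF Z p] scaleR_eq_cscale coord_vec_scale)
  also have "\<dots> = coord_vec A c p (\<Sum>j\<in>I. complex_of_real (t j) *s
        ?v j)"
    by (simp only: coord_vec_sum)
  also have "(\<Sum>j\<in>I. complex_of_real (t j) *s
        ?v j)
     = (\<chi> i. complex_of_real (- 2 * (\<Sum>j\<in>I. t j * Im (conj_deriv (field_comps c (Z j)) (snd c p) $ i))))"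
    by (simp add: vec_eq_iff sum_distrib_left sum_negf mult_ac)
  finally show ?thesis .
qed

text \<open>This is the independence of the Levi form from the representation, stated for a
  difference of two representations; hence the real weights of either sign.\<close>

lemma levi_kernel:
  assumes I: "finite I" and Z: "\<And>j. j \<in> I \<Longrightarrow> Z j \<in> CR_sections A T U" and p: "p \<in> U \<inter> fst c"
    and tensor0: "(\<Sum>j\<in>I. t j *\<^sub>R tensor (Z j p) (vconj (Z j p))) = 0"
  shows "(\<Sum>j\<in>I. t j *\<^sub>R (- cscale \<i> (bracket A (Z j) (field_conj (Z j)) p))) \<in> HM T p"
proof -
  have pc: "p \<in> fst c" using p by simp
  obtain Y where Y: "Y \<in> T p"
    "comps c Y = (\<Sum>j\<in>I. complex_of_real (t j) *s conj_deriv (field_comps c (Z j)) (snd c p))"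
    using conj_deriv_sum_in_TC[OF assms] chart_inv_left[OF chart pc] by (auto simp: TC_def)
  \<comment> \<open>The factor is chosen because the real part of \<open>2 \<i> q\<close> is
    \<open>- 2 Im q\<close>, the form taken by the Levi vector in coordinates.\<close>
  have W: "cscale (2 * \<i>) Y \<in> T p" using Y(1) by (rule T_closed_ops)
  have "vRe (cscale (2 * \<i>) Y) = coord_vec A c p (comps c (vRe (cscale (2 * \<i>) Y)))"
    by (rule ctangent_eq_coord_vec[OF ctangent_vRe[OF pc T_ctangent[OF W]] pc])
  also have "comps c (vRe (cscale (2 * \<i>) Y)) =
      (\<chi> i. complex_of_real (- 2 * (\<Sum>j\<in>I. t j * Im (conj_deriv (field_comps c (Z j)) (snd c p) $ i))))"
    unfolding comps_vRe comps_cscale Y(2) by (simp add: vec_eq_iff)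
  also have "coord_vec A c p \<dots> = (\<Sum>j\<in>I. t j *\<^sub>R (- cscale \<i> (bracket A (Z j) (field_conj (Z j)) p)))"
    using Z p by (intro levi_sum_eq[symmetric]) (auto simp: CR_sections_def)
  finally show ?thesis unfolding HM_def using W by (metis imageI)
qed

lemma HM_subspace: "subspace (HM T p)"
proof -
  have add: "vRe (X + Y) = vRe X + vRe Y" for X Y :: "'a cvec"
    by (simp add: vRe_def vconj_def fun_eq_iff scaleR_fun_def algebra_simps)
  have scale: "vRe (cscale (complex_of_real r) X) = r *\<^sub>R vRe X" for r and X :: "'a cvec"
    by (simp add: vRe_def vconj_def fun_eq_iff scaleR_fun_def cscale_def scaleR_conv_of_real algebra_simps)
  have zero: "vRe (0 :: 'a cvec) = 0"
    by (simp add: vRe_def vconj_def fun_eq_iff scaleR_fun_def)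
  show ?thesis
    unfolding subspace_def HM_def
  proof (intro conjI ballI allI)
    show "0 \<in> vRe ` T p" using zero T_closed_ops(1) by (metis imageI)
    fix X assume "X \<in> vRe ` T p"
    then obtain X' where X: "X' \<in> T p" "X = vRe X'" by blast
    show "r *\<^sub>R X \<in> vRe ` T p" for r
      using scale[of r X'] T_closed_ops(3)[OF X(1), of "complex_of_real r"] X(2) by (metis imageI)
    fix Y assume "Y \<in> vRe ` T p"
    then obtain Y' where Y: "Y' \<in> T p" "Y = vRe Y'" by blast
    show "X + Y \<in> vRe ` T p"
      using add[of X' Y'] T_closed_ops(2)[OF X(1) Y(1)] X(2) Y(2) by (metis imageI)
  qed
qed

lemma proj_HM_eqI:
  assumes "X - Y \<in> HM T p"
  shows "proj_HM A T p X = proj_HM A T p Y"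
proof -
  have "W - X \<in> HM T p \<longleftrightarrow> W - Y \<in> HM T p" for W
  proof
    assume "W - X \<in> HM T p"
    from subspace_add[OF HM_subspace this assms] show "W - Y \<in> HM T p" by simp
  next
    assume "W - Y \<in> HM T p"
    from subspace_diff[OF HM_subspace this assms] show "W - X \<in> HM T p" by simp
  qed
  then show ?thesis by (simp add: proj_HM_def)
qed

lemma vector_levi_eq:
  fixes r :: nat
  assumes p: "p \<in> fst c" "p \<in> U" and Z: "\<And>j. j < r \<Longrightarrow> Z j \<in> CR_sections A T U"
    and \<tau>: "\<tau> = (\<Sum>j<r. tensor (Z j p) (vconj (Z j p)))"
  shows "vector_levi A T p \<tau> = proj_HM A T p (\<Sum>j<r. - cscale \<i> (bracket A (Z j) (field_conj (Z j)) p))"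
    (is "_ = proj_HM A T p (\<Sum>j<r. ?b (Z j))")
  unfolding vector_levi_def
proof (rule the_equality)
  show "\<exists>(r'::nat) t Z' U. p \<in> U \<and> (\<forall>j<r'. Z' j \<in> CR_sections A T U) \<and>
      \<tau> = (\<Sum>j<r'. t j *\<^sub>R tensor (Z' j p) (vconj (Z' j p))) \<and>
      proj_HM A T p (\<Sum>j<r. ?b (Z j)) =
      proj_HM A T p (\<Sum>j<r'. t j *\<^sub>R ?b (Z' j))"
    by (rule exI[of _ r], rule exI[of _ "\<lambda>_. 1"], rule exI[of _ Z], rule exI[of _ U]) (use p Z \<tau> in simp)
next
  fix C assume "\<exists>(r'::nat) t Z' U. p \<in> U \<and> (\<forall>j<r'. Z' j \<in> CR_sections A T U) \<and>
      \<tau> = (\<Sum>j<r'. t j *\<^sub>R tensor (Z' j p) (vconj (Z' j p))) \<and>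
      C = proj_HM A T p (\<Sum>j<r'. t j *\<^sub>R ?b (Z' j))"
  then obtain r' :: nat and t Z' U' where *: "p \<in> U' \<and> (\<forall>j<r'. Z' j \<in> CR_sections A T U') \<and>
      \<tau> = (\<Sum>j<r'. t j *\<^sub>R tensor (Z' j p) (vconj (Z' j p))) \<and>
      C = proj_HM A T p (\<Sum>j<r'. t j *\<^sub>R ?b (Z' j))"
    by (elim exE) (rule that)
  from * have p': "p \<in> U'" and Z': "\<And>j. j < r' \<Longrightarrow> Z' j \<in> CR_sections A T U'" by simp_all
  from * have \<tau>': "\<tau> = (\<Sum>j<r'. t j *\<^sub>R tensor (Z' j p) (vconj (Z' j p)))" by (elim conjE)
  from * have C: "C = proj_HM A T p (\<Sum>j<r'. t j *\<^sub>R ?b (Z' j))"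
    by (elim conjE)
  \<comment> \<open>Both representations of \<tau> are merged into one family, the second with
    weights -1, so that the total tensor is 0.\<close>
  let ?I = "{..<r'} <+> {..<r}"
  let ?Z = "case_sum Z' Z" and ?t = "case_sum t (\<lambda>_. - 1)"
  have restrict: "W \<in> CR_sections A T (U \<inter> U')"
    if "W \<in> CR_sections A T U'' \<and> open (U \<inter> U')" "U \<inter> U' \<subseteq> U''" for W U''
    using that smooth_field_subset[of U'' W "U \<inter> U'"] by (auto simp: CR_sections_def)
  have "(\<Sum>j\<in>?I. ?t j *\<^sub>R ?b (?Z j)) \<in> HM T p"
  \<comment> \<open>Openness of \<open>U\<close> and \<open>U'\<close> is known only through a
    section defined on them. If one family is empty, its set may fail to be open and the other set
    is used alone.\<close>
  proof (cases "r = 0 \<or> r' = 0")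
    case False
    have UU: "open (U \<inter> U')"
      using Z[of 0] Z'[of 0] False by (auto simp: CR_sections_def smooth_field_def)
    show ?thesis
    proof (rule levi_kernel)
      show "?Z j \<in> CR_sections A T (U \<inter> U')" if "j \<in> ?I" for j
        using that restrict[OF conjI[OF Z UU] Int_lower1] restrict[OF conjI[OF Z' UU] Int_lower2] by auto
      show "(\<Sum>j\<in>?I. ?t j *\<^sub>R tensor (?Z j p) (vconj (?Z j p))) = 0"
        using \<tau> \<tau>' by (simp add: sum.Plus sum_negf)
    qed (use p p' in auto)
  next
    case True
    show ?thesis
    proof (cases "r = 0")
      case True
      show ?thesis
        by (rule levi_kernel[where U = U']) (use True Z' p p' \<tau> \<tau>' in \<open>auto simp: sum.Plus sum_negf\<close>)
    next
      case False
      then have "r' = 0" using \<open>r = 0 \<or> r' = 0\<close> by simp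
      then show ?thesis
        by (intro levi_kernel[where U = U]) (use Z p p' \<tau> \<tau>' in \<open>auto simp: sum.Plus sum_negf\<close>)
    qed
  qed
  then have "(\<Sum>j<r'. t j *\<^sub>R ?b (Z' j))
      - (\<Sum>j<r. ?b (Z j)) \<in> HM T p"
    by (simp add: sum.Plus sum_negf)
  then show "C = proj_HM A T p (\<Sum>j<r. ?b (Z j))"
    unfolding C by (rule proj_HM_eqI)
qed

text \<open>The form in which the kernel condition enters the analysis: it identifies the imaginary
  part of the total first order term with the real part of a vector of \<open>T\<close>, along which
  CR functions have derivative 0.\<close>

lemma ker_levi_conj_deriv:
  assumes \<tau>: "\<tau> \<in> ker_levi A T U" and rep: "represents A T V \<tau> r Z" and V: "V \<subseteq> U" and p: "p \<in> V \<inter> fst c"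
  obtains w where "w \<in> TC (snd c p)"
    "Re_vec w = - 2 *\<^sub>R (\<Sum>j<r. Im_vec (conj_deriv (field_comps c (Z j)) (snd c p)))"
proof -
  have pc: "p \<in> fst c" "p \<in> V" using p by auto
  have Z: "Z j \<in> CR_sections A T V" if "j < r" for j using rep that by (auto simp: represents_def)
  have sf: "smooth_field A V (Z j)" if "j \<in> {..<r}" for j using Z[of j] that by (simp add: CR_sections_def)
  define B where "B = (\<Sum>j<r. - cscale \<i> (bracket A (Z j) (field_conj (Z j)) p))"
  have "vector_levi A T p (\<tau> p) = proj_HM A T p B"
    unfolding B_def by (rule vector_levi_eq[OF pc Z]) (use rep pc in \<open>simp_all add: represents_def\<close>)
  moreover have "\<tau> p \<in> ker_levi_at A T p" using \<tau> V pc by (auto simp: ker_levi_def)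
  ultimately have eq: "proj_HM A T p B = proj_HM A T p 0" by (simp add: ker_levi_at_def)
  \<comment> \<open>Equality of cosets is tested on the element 0. Cosets contain tangent vectors
    only, so 0 must be checked to be one.\<close>
  have "0 \<in> tangent A p"
    using cvec.subspace_0[OF ctangent_subspace[OF pc(1)]]
    by (simp add: tangent_def vconj_def fun_eq_iff)
  then have "0 \<in> proj_HM A T p 0" using subspace_0[OF HM_subspace, of p] by (simp add: proj_HM_def)
  then have "0 - B \<in> HM T p" unfolding eq[symmetric] by (simp add: proj_HM_def)
  then have "B \<in> HM T p" using subspace_neg[OF HM_subspace, of "0 - B" p] by simp
  then obtain W where W: "W \<in> T p" "B = vRe W" by (auto simp: HM_def)
  have "B = coord_vec A c p (\<chi> i. complex_of_real (- 2 * (\<Sum>j<r. 1 * Im (conj_deriv (field_comps c (Z j)) (snd c p) $ i))))"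
    using levi_sum_eq[where I = "{..<r}" and Z = Z and t = "\<lambda>_. 1", OF sf p] by (simp add: B_def)
  then have "comps c B = (\<chi> i. complex_of_real (- 2 * (\<Sum>j<r. 1 * Im (conj_deriv (field_comps c (Z j)) (snd c p) $ i))))"
    by (simp only: comps_coord_vec[OF pc(1)])
  then have "Re (comps c W $ i) = - 2 * (\<Sum>j<r. Im (conj_deriv (field_comps c (Z j)) (snd c p) $ i))" for i
    unfolding W(2) comps_vRe by (simp add: vec_eq_iff complex_eq_iff)
  then have "Re_vec (comps c W) = - 2 *\<^sub>R (\<Sum>j<r. Im_vec (conj_deriv (field_comps c (Z j)) (snd c p)))"
    by (simp add: vec_eq_iff)
  moreover have "comps c W \<in> TC (snd c p)" using W(1) chart_inv_left[OF chart pc(1)] by (simp add: TC_def)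
  ultimately show ?thesis using that by blast
qed

end


section \<open>Boundary behaviour at a peak point\<close>

text \<open>Continuity is asked at \<open>q\<close> alone, since a coordinate map is arbitrary off
  its chart.\<close>

lemma isCont_image_closure:
  assumes "isCont f q" "q \<in> closure B"
  shows "f q \<in> closure (f ` B)"
proof (rule ccontr)
  assume "f q \<notin> closure (f ` B)"
  then have "\<forall>\<^sub>F x in nhds q. f x \<in> - closure (f ` B)"
    using assms(1) by (intro topological_tendstoD[of f "f q"]) (auto simp: isCont_def tendsto_at_iff_tendsto_nhds)
  then obtain O' where O': "open O'" "q \<in> O'" "\<And>x. x \<in> O' \<Longrightarrow> f x \<in> - closure (f ` B)"
    unfolding eventually_nhds by blast
  then have "O' \<inter> B = {}" using closure_subset[of "f ` B"] by blast
  then have "O' \<inter> closure B = {}" using O'(1) by (simp add: open_Int_closure_eq_empty)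
  then show False using O'(2) assms(2) by blast
qed

lemma isCont_closure_le:
  fixes h :: "'e::metric_space \<Rightarrow> real"
  assumes "isCont h x" "x \<in> closure D" "\<And>y. y \<in> D \<Longrightarrow> h y \<le> b"
  shows "h x \<le> b"
proof -
  obtain y where y: "\<And>n. y n \<in> D" "y \<longlonglongrightarrow> x" using assms(2) closure_sequential by metis
  have "(\<lambda>n. h (y n)) \<longlonglongrightarrow> h x" by (rule isCont_tendsto_compose[OF assms(1) y(2)])
  then show ?thesis by (rule LIMSEQ_le_const2) (use assms(3) y(1) in auto)
qed

lemma compact_norm_bound:
  fixes f :: "'e::topological_space \<Rightarrow> 'b::real_normed_vector"
  assumes "compact K" "continuous_on K f"
  obtains B where "0 \<le> B" "\<And>x. x \<in> K \<Longrightarrow> norm (f x) \<le> B"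
proof -
  obtain B where "\<And>x. x \<in> K \<Longrightarrow> norm (f x) \<le> B"
    using compact_imp_bounded[OF compact_continuous_image[OF assms(2,1)]] by (auto simp: bounded_iff)
  then show ?thesis by (intro that[of "max 0 B"]) fastforce+
qed

lemma Re_vec_tendsto: "(f \<longlongrightarrow> a) F \<Longrightarrow> ((\<lambda>x. Re_vec (f x)) \<longlongrightarrow> Re_vec a) F"
  unfolding Re_vec_def by (intro tendsto_intros)

lemma Im_vec_tendsto: "(f \<longlongrightarrow> a) F \<Longrightarrow> ((\<lambda>x. Im_vec (f x)) \<longlongrightarrow> Im_vec a) F"
  unfolding Im_vec_def by (intro tendsto_intros)

context CR_chart
begin

text \<open>A vector of \<open>T\<close> with zero real part is the negative of its conjugate, hence
  lies in \<open>T\<close> and in its conjugate and is 0. Compactness of the unit sphere and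
  \<open>TC_limit\<close> make this quantitative and uniform near \<open>p\<close>. It bounds the
  vectors that the kernel condition provides, of which only the real part is prescribed.\<close>

lemma TC_Im_bound:
  assumes p: "p \<in> fst c"
  obtains C where "0 \<le> C" "\<forall>\<^sub>F x in nhds (snd c p). \<forall>w\<in>TC x. norm (Im_vec w) \<le> C * norm (Re_vec w)"
proof (rule ccontr)
  let ?x = "snd c p"
  assume no: "\<not> thesis"
  have "\<exists>x w. dist x ?x < 1 / real (Suc n) \<and> w \<in> TC x \<and> real (Suc n) * norm (Re_vec w) < norm (Im_vec w)" for n
  proof (rule ccontr)
    assume neg: "\<not> ?thesis"
    have "\<forall>\<^sub>F x in nhds ?x. dist x ?x < 1 / real (Suc n)"
      unfolding eventually_nhds_metric by (rule exI[of _ "1 / real (Suc n)"]) simp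
    then have "\<forall>\<^sub>F x in nhds ?x. \<forall>w\<in>TC x. norm (Im_vec w) \<le> real (Suc n) * norm (Re_vec w)"
      by eventually_elim (use neg in \<open>meson not_le\<close>)
    then show False using that[of "real (Suc n)"] no by simp
  qed
  then obtain xs ws where xw: "\<And>n. dist (xs n) ?x < 1 / real (Suc n)" "\<And>n. ws n \<in> TC (xs n)"
    "\<And>n. real (Suc n) * norm (Re_vec (ws n)) < norm (Im_vec (ws n))"
    by metis
  note null = LIMSEQ_1_over_Suc
  have le: "dist (xs n) ?x \<le> 1 / real (Suc n)" for n by (rule less_imp_le[OF xw(1)])
  have "(\<lambda>n. dist (xs n) ?x) \<longlonglongrightarrow> 0"
    by (rule tendsto_sandwich[OF _ _ tendsto_const null]) (intro always_eventually allI zero_le_dist le)+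
  then have xs: "xs \<longlonglongrightarrow> ?x" by (rule tendsto_dist_iff[THEN iffD2])
  have ws0: "ws n \<noteq> 0" for n
  proof
    assume "ws n = 0"
    moreover have "Im_vec 0 = (0 :: real ^ 'n)" by (simp add: vec_eq_iff)
    moreover have "Re_vec 0 = (0 :: real ^ 'n)" by (simp add: vec_eq_iff)
    ultimately show False using xw(3)[of n] by simp
  qed
  define w' where "w' n = (1 / norm (ws n)) *\<^sub>R ws n" for n
  have w'_TC: "w' n \<in> TC (xs n)" for n
    unfolding w'_def scaleR_vec_eq by (rule TC_ops(3)[OF xw(2)])
  have Re_w': "Re_vec (w' n) = (1 / norm (ws n)) *\<^sub>R Re_vec (ws n)"
    and Im_w': "Im_vec (w' n) = (1 / norm (ws n)) *\<^sub>R Im_vec (ws n)" for n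
    by (simp_all add: w'_def vec_eq_iff)
  have w'_bound: "norm (Re_vec (w' n)) \<le> (1 / real (Suc n)) * norm (Im_vec (w' n))" for n
  proof -
    have "norm (Re_vec (ws n)) \<le> (1 / real (Suc n)) * norm (Im_vec (ws n))"
      using xw(3)[of n] by (simp add: field_simps)
    then have "norm (Re_vec (ws n)) / norm (ws n) \<le> (1 / real (Suc n)) * norm (Im_vec (ws n)) / norm (ws n)"
      by (rule divide_right_mono) simp
    then show ?thesis unfolding Re_w' Im_w' by simp
  qed
  have "w' n \<in> sphere 0 1" for n using ws0[of n] by (simp add: w'_def)
  then obtain l s where l: "l \<in> sphere 0 1" and s: "strict_mono s" "(w' \<circ> s) \<longlonglongrightarrow> l"
    using compact_sphere[of "0 :: complex ^ 'n" 1] unfolding compact_def by metis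
  have "l \<in> TC ?x"
  proof (rule TC_limit[OF p])
    show "(xs \<circ> s) \<longlonglongrightarrow> ?x" by (rule LIMSEQ_subseq_LIMSEQ[OF xs s(1)])
    show "(w' \<circ> s) \<longlonglongrightarrow> l" by (rule s(2))
  qed (simp add: w'_TC)
  then obtain W where W: "W \<in> T p" "l = comps c W"
    using chart_inv_left[OF chart p] by (auto simp: TC_def)
  have l1: "(\<lambda>n. 1 / real (Suc (s n)) * norm (Im_vec ((w' \<circ> s) n))) \<longlonglongrightarrow> 0 * norm (Im_vec l)"
    using LIMSEQ_subseq_LIMSEQ[OF null s(1)] by (intro tendsto_intros Im_vec_tendsto s(2)) (simp add: o_def)
  have l2: "(\<lambda>n. norm (Re_vec ((w' \<circ> s) n))) \<longlonglongrightarrow> norm (Re_vec l)"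
    by (intro tendsto_intros Re_vec_tendsto s(2))
  have "norm (Re_vec l) \<le> 0 * norm (Im_vec l)"
    by (rule LIMSEQ_le[OF l2 l1]) (intro exI allI impI, simp only: o_def, rule w'_bound)
  \<comment> \<open>The limit is a unit vector of the fibre over \<open>p\<close> that is purely
    imaginary, which contradicts the transversality of \<open>T\<close> and its conjugate.\<close>
  then have "Re_vec l = 0" by simp
  then have "Re (l $ i) = 0" for i by (metis Re_vec_nth zero_index)
  then have "cnj_vec (comps c W) = (- 1) *s comps c W"
    unfolding W(2) by (simp add: vec_eq_iff complex_eq_iff)
  then have eq: "comps c (vconj W) = comps c (cscale (- 1) W)" by (simp only: comps_vconj comps_cscale)
  have "vconj W = cscale (- 1) W"
    by (rule ctangent_eqI[OF ctangent_vconj[OF p T_ctangent[OF W(1)]] T_ctangent[OF T_closed_ops(3)[OF W(1)]] p eq])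
  moreover have "cscale (- 1) W \<in> T p" by (rule T_closed_ops(3)[OF W(1)])
  ultimately have "cscale (- 1) W = 0" using T_Int_vconj[of "cscale (- 1) W" p W] W(1) by simp
  then have "(- 1) *s l = 0" unfolding W(2) comps_cscale[symmetric] by simp
  then have "l = 0" by (simp add: vec_eq_iff)
  then show False using l by simp
qed

text \<open>Bridge from vectors to sections: the CR condition is formulated for sections, and limits
  at boundary points need a vector to be continued to neighbouring points.\<close>

lemma TC_eq_frame:
  assumes x: "x \<in> snd c ` fst c" and w: "w \<in> TC x"
  obtains m :: nat and U E a where "open U" "chart_inv c x \<in> U" "\<And>j. j < m \<Longrightarrow> E j \<in> CR_sections A T U"
    "w = (\<Sum>j<m. a j *s field_comps c (E j) x)"
proof -
  let ?q = "chart_inv c x"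
  obtain m U E L where F: "dual_frame ?q m U E L" using ex_dual_frame by blast
  obtain W where W: "W \<in> T ?q" "w = comps c W" using w by (auto simp: TC_def)
  then obtain a where "W = (\<Sum>j<m. cscale (a j) (E j ?q))" using dual_frameD(6)[OF F dual_frameD(2)[OF F]] by blast
  then have "w = (\<Sum>j<m. a j *s field_comps c (E j) x)"
    unfolding W(2) by (simp add: comps_sum comps_cscale field_comps_def)
  then show ?thesis by (rule that[OF dual_frameD(1,2)[OF F], rotated]) (rule dual_frameD(3)[OF F])
qed

lemma CR_function_cderiv:
  assumes f: "f \<in> CR_functions A T \<Omega>" and x: "x \<in> snd c ` (\<Omega> \<inter> fst c)" and w: "w \<in> TC x"
  shows "cderiv (f \<circ> chart_inv c) x w = 0"
proof -
  note q = chart_image_inv[OF chart x]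
  have f': "smooth_fun A \<Omega> f" using f by (simp add: CR_functions_def)
  obtain m :: nat and U E a where U: "open U" "chart_inv c x \<in> U" "\<And>j. j < m \<Longrightarrow> E j \<in> CR_sections A T U"
    and w': "w = (\<Sum>j<m. a j *s field_comps c (E j) x)"
  proof -
    have xc: "x \<in> snd c ` fst c" using x by auto
    from that show thesis by (rule TC_eq_frame[OF xc w])
  qed
  have \<Omega>: "open (U \<inter> \<Omega>)" using U(1) f' by (auto simp: smooth_fun_def Ck_fun_def)
  have "cderiv (f \<circ> chart_inv c) x (field_comps c (E j) x) = 0" if j: "j < m" for j
  proof -
    have sf: "smooth_field A U (E j)" using U(3)[OF j] by (simp add: CR_sections_def)
    have "E j \<in> CR_sections A T (U \<inter> \<Omega>)"
      using U(3)[OF j] smooth_field_subset[OF sf \<Omega>] by (auto simp: CR_sections_def)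
    then have "E j (chart_inv c x) f = 0"
      using f q(1) U(2) unfolding CR_functions_def by (metis (mono_tags, lifting) IntD1 IntI Int_lower2 mem_Collect_eq)
    moreover have "x \<in> snd c ` (U \<inter> \<Omega> \<inter> fst c)" using q U(2) by (metis IntD1 IntD2 IntI imageI)
    ultimately show ?thesis using field_apply[OF sf f'] by metis
  qed
  then show ?thesis unfolding w' by (simp add: cderiv_sum_arg cderiv_scale_arg)
qed

end

section \<open>The domain and the peak function in coordinates\<close>

locale peak_point = CR_chart A T c
  for A :: "('a::{t2_space,second_countable_topology}, 'n::finite) chart set" and T c +
  fixes \<Omega> :: "'a set" and f g :: "'a \<Rightarrow> complex" and p0 :: 'a and \<rho> :: "'a \<Rightarrow> real" and U V :: "'a set"
  assumes open_\<Omega>: "open \<Omega>" and f_CR: "f \<in> CR_functions A T \<Omega>"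
    and p0: "p0 \<in> frontier \<Omega>" "p0 \<in> fst c"
    and peak: "\<And>p. p \<in> \<Omega> \<Longrightarrow> cmod (f p) < cmod (f p0)"
    and U: "p0 \<in> U" "smooth_fun A U (\<lambda>q. complex_of_real (\<rho> q))" "\<Omega> \<inter> U = {q \<in> U. \<rho> q < 0}"
    and V: "p0 \<in> V" "Ck_fun A 2 V g" "\<And>q. q \<in> V \<Longrightarrow> q \<in> closure \<Omega> \<Longrightarrow> f q = g q"
begin

definition x0 :: "real ^ 'n" where "x0 = snd c p0"
definition S :: "(real ^ 'n) set" where "S = snd c ` (U \<inter> V \<inter> fst c)"
definition N :: "(real ^ 'n) set" where "N = snd c ` (frontier \<Omega> \<inter> fst c)"
text \<open>Built from the extension \<open>g\<close>, which is C^2 across the boundary; agreement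
  with the normalised \<open>f\<close> is known on the closure of \<Omega> only.\<close>

definition G :: "real ^ 'n \<Rightarrow> complex" where "G x = g (chart_inv c x) / f p0"
definition r :: "real ^ 'n \<Rightarrow> real" where "r x = \<rho> (chart_inv c x)"
definition rc :: "real ^ 'n \<Rightarrow> complex" where "rc x = complex_of_real (r x)"
definition \<rho>c :: "'a \<Rightarrow> complex" where "\<rho>c q = complex_of_real (\<rho> q)"

lemma open_U: "open U" and open_V: "open V"
  using U(2) V(2) by (auto simp: smooth_fun_def Ck_fun_def)

lemma open_S: "open S"
  unfolding S_def by (intro open_chart_image[OF chart] open_Int open_U open_V)

lemma x0_S: "x0 \<in> S"
  using U(1) V(1) p0(2) by (auto simp: S_def x0_def)

lemma x0_N: "x0 \<in> N"
  using p0 by (auto simp: N_def x0_def)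

lemma inv_x0: "chart_inv c x0 = p0"
  unfolding x0_def by (rule chart_inv_left[OF chart p0(2)])

lemma S_D:
  assumes "x \<in> S"
  shows "chart_inv c x \<in> U" "chart_inv c x \<in> V" "chart_inv c x \<in> fst c" "snd c (chart_inv c x) = x"
  using chart_image_inv[OF chart assms[unfolded S_def]] by auto

lemma r_neg_iff: "x \<in> S \<Longrightarrow> r x < 0 \<longleftrightarrow> chart_inv c x \<in> \<Omega>"
  using S_D(1)[of x] U(3) by (auto simp: r_def)

lemma rc_Ck: "Ck_on k rc S"
proof -
  have "Ck_on k (\<rho>c \<circ> chart_inv c) (snd c ` (U \<inter> fst c))"
    using U(2) chart unfolding smooth_fun_def Ck_fun_def \<rho>c_def[abs_def] by blast
  moreover have "\<rho>c \<circ> chart_inv c = rc" by (simp add: fun_eq_iff \<rho>c_def rc_def r_def)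
  ultimately show ?thesis using Ck_on_subset[of k rc "snd c ` (U \<inter> fst c)" S] by (auto simp: S_def)
qed

lemma G_Ck: "Ck_on (Suc (Suc 0)) G S"
proof -
  have "Ck_on (Suc (Suc 0)) (g \<circ> chart_inv c) (snd c ` (V \<inter> fst c))"
    using V(2) chart unfolding Ck_fun_def numeral_2_eq_2 by blast
  then have "Ck_on (Suc (Suc 0)) (g \<circ> chart_inv c) S"
    by (rule Ck_on_subset) (auto simp: S_def)
  from Ck_on_bounded_linear[OF open_S bounded_linear_divide this, of "f p0"]
  show ?thesis by (simp add: G_def[abs_def])
qed

lemma f_p0_nonzero: "f p0 \<noteq> 0"
proof -
  have "\<Omega> \<noteq> {}" using p0(1) by auto
  then obtain p where "p \<in> \<Omega>" by blast
  then show ?thesis using peak[of p] by auto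
qed

lemma G_x0: "G x0 = 1"
  using V(3)[OF V(1)] p0(1) f_p0_nonzero by (simp add: G_def inv_x0 frontier_def)

lemma G_eq_f: "x \<in> S \<Longrightarrow> r x < 0 \<Longrightarrow> G x = f (chart_inv c x) / f p0"
  using V(3)[of "chart_inv c x"] S_D(2)[of x] r_neg_iff[of x] subsetD[OF closure_subset, of "chart_inv c x" \<Omega>]
  by (simp add: G_def)

lemma Re_G_less: 
  assumes "x \<in> S" "r x < 0"
  shows "Re (G x) < 1"
proof -
  have "cmod (G x) < 1"
    using peak[of "chart_inv c x"] r_neg_iff assms f_p0_nonzero by (simp add: G_eq_f norm_divide)
  then show ?thesis using complex_Re_le_cmod[of "G x"] by linarith
qed

lemma r_continuous_on: "continuous_on S r"
  using continuous_on_Re[of S rc] rc_Ck[of 0] by (simp add: rc_def)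

lemma open_neg: "open {x \<in> S. r x < 0}"
proof -
  from r_continuous_on have "open (S \<inter> r -` {..<0})" by (rule continuous_open_preimage) (simp_all add: open_S)
  then show ?thesis by (simp add: vimage_def Int_def)
qed

lemma G_TC_neg:
  assumes x: "x \<in> S" "r x < 0" and w: "w \<in> TC x"
  shows "cderiv G x w = 0"
proof -
  have x': "x \<in> snd c ` (\<Omega> \<inter> fst c)"
    using r_neg_iff[OF x(1)] x(2) S_D[OF x(1)] by (metis IntI imageI)
  have "smooth_near A (chart_inv c x) f"
    using f_CR r_neg_iff[OF x(1)] x(2) by (auto simp: CR_functions_def smooth_near_def)
  then have diff: "(f \<circ> chart_inv c) differentiable (at x)"
    using smooth_near_differentiable[OF _ chart S_D(3)[OF x(1)]] S_D(4)[OF x(1)] by simp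
  have "cderiv G x w = cderiv (\<lambda>x. (1 / f p0) * (f \<circ> chart_inv c) x) x w"
    by (rule cderiv_cong_open[OF open_neg]) (use x in \<open>simp_all add: G_eq_f\<close>)
  also have "\<dots> = (1 / f p0) * cderiv (f \<circ> chart_inv c) x w" by (rule cderiv_cmult[OF diff])
  also have "\<dots> = 0" using CR_function_cderiv[OF f_CR x' w] by simp
  finally show ?thesis .
qed

text \<open>The approximating points can be taken in any prescribed neighbourhood \<open>W\<close>,
  so that limits along them make sense for sections defined only there.\<close>

lemma closure_neg:
  assumes x: "x \<in> S" "chart_inv c x \<in> closure \<Omega>" and O: "open W" "x \<in> W"
  shows "x \<in> closure {y \<in> S \<inter> W. r y < 0}"
proof -
  let ?q = "chart_inv c x" and ?S = "S \<inter> W"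
  have oS: "open ?S" using open_S O by auto
  have q: "?q \<in> fst c" "snd c ?q = x" using S_D[OF x(1)] by auto
  let ?P = "fst c \<inter> snd c -` ?S"
  have "continuous_on (fst c) (snd c)"
    using chart_homeomorphism[OF chart] by (simp add: homeomorphism_def)
  then have "open ?P" by (rule continuous_open_preimage) (use open_dom[OF chart] oS in auto)
  moreover have "?q \<in> ?P" using q x O by auto
  ultimately have "?q \<in> closure (?P \<inter> \<Omega>)"
    using open_Int_closure_subset[of ?P \<Omega>] x(2) by blast
  then have x_cl: "x \<in> closure (snd c ` (?P \<inter> \<Omega>))"
    using isCont_image_closure[OF isCont_chart[OF q(1)]] unfolding q(2) by blast
  have "snd c ` (?P \<inter> \<Omega>) \<subseteq> {y \<in> S \<inter> W. r y < 0}"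
  proof
    fix y assume "y \<in> snd c ` (?P \<inter> \<Omega>)"
    then obtain q' where q': "q' \<in> fst c" "snd c q' \<in> ?S" "q' \<in> \<Omega>" "y = snd c q'" by auto
    then show "y \<in> {y \<in> S \<inter> W. r y < 0}"
      using r_neg_iff[of y] chart_inv_left[OF chart q'(1)] by auto
  qed
  from subsetD[OF closure_mono[OF this] x_cl] show ?thesis .
qed

text \<open>Inside \<Omega> this is the CR equation. At a boundary point the vector is expanded in a
  frame, whose fields continue it inwards, and the equation passes to the limit because the first
  derivatives of \<open>G\<close> are continuous.\<close>

lemma G_TC_closure:
  assumes x: "x \<in> S" "chart_inv c x \<in> closure \<Omega>" and w: "w \<in> TC x"
  shows "cderiv G x w = 0"
proof -
  obtain m :: nat and O' E a where O': "open O'" "chart_inv c x \<in> O'" "\<And>j. j < m \<Longrightarrow> E j \<in> CR_sections A T O'"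
    and w': "w = (\<Sum>j<m. a j *s field_comps c (E j) x)"
  proof -
    have xc: "x \<in> snd c ` fst c" using S_D(3,4)[OF x(1)] by (metis imageI)
    from that show thesis by (rule TC_eq_frame[OF xc w])
  qed
  let ?W = "snd c ` (O' \<inter> fst c)"
  have W: "open ?W" "x \<in> ?W"
    using open_chart_image[OF chart O'(1)] S_D(3,4)[OF x(1)] O'(2) by (auto intro: rev_image_eqI)
  have "cderiv G x (field_comps c (E j) x) = 0" if j: "j < m" for j
  proof -
    have sf: "smooth_field A O' (E j)" using O'(3)[OF j] by (simp add: CR_sections_def)
    obtain y where y: "\<And>n. y n \<in> {y \<in> S \<inter> ?W. r y < 0}" "y \<longlonglongrightarrow> x"
      using closure_neg[OF x W] unfolding closure_sequential by (elim exE conjE) (rule that, erule spec, assumption)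
    have dG: "(\<lambda>n. frechet_derivative G (at (y n)) v) \<longlonglongrightarrow> frechet_derivative G (at x) v" for v
    proof -
      have "continuous_on S (\<lambda>x. frechet_derivative G (at x) v)"
        by (rule Ck_on_1_continuous[OF Ck_on_lower[OF G_Ck]])
      then have "isCont (\<lambda>x. frechet_derivative G (at x) v) x"
        using open_S x(1) continuous_on_eq_continuous_at by blast
      then show ?thesis by (rule isCont_tendsto_compose[OF _ y(2)])
    qed
    have "(\<lambda>n. field_comps c (E j) (y n)) \<longlonglongrightarrow> field_comps c (E j) x"
      by (rule isCont_tendsto_compose[OF field_comps_isCont[OF sf W(2)] y(2)])
    then have "(\<lambda>n. cderiv G (y n) (field_comps c (E j) (y n))) \<longlonglongrightarrow> cderiv G x (field_comps c (E j) x)"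
      unfolding cderiv_def by (intro tendsto_intros dG)
    moreover have "cderiv G (y n) (field_comps c (E j) (y n)) = 0" for n
      using G_TC_neg[of "y n"] field_comps_TC[OF O'(3)[OF j], of "y n"] y(1)[of n] by simp
    ultimately show ?thesis by (simp add: LIMSEQ_const_iff)
  qed
  then show ?thesis unfolding w' by (simp add: cderiv_sum_arg cderiv_scale_arg)
qed

lemma N_S_D:
  assumes "x \<in> N \<inter> S"
  shows "chart_inv c x \<in> frontier \<Omega>" "chart_inv c x \<in> closure \<Omega>"
proof -
  show "chart_inv c x \<in> frontier \<Omega>"
    using assms chart_inv_left[OF chart] by (auto simp: N_def)
  then show "chart_inv c x \<in> closure \<Omega>" by (simp add: frontier_def)
qed

lemma r_isCont: "x \<in> S \<Longrightarrow> isCont r x"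
  using r_continuous_on open_S continuous_on_eq_continuous_at by blast

text \<open>An open set misses its frontier, so \<open>r\<close> is nonnegative there; as a limit of
  negative values it is also nonpositive.\<close>

lemma r_N:
  assumes x: "x \<in> N \<inter> S"
  shows "r x = 0"
proof -
  have xS: "x \<in> S" using x by simp
  have "chart_inv c x \<notin> \<Omega>"
    using N_S_D(1)[OF x] open_\<Omega> by (simp add: frontier_def interior_open)
  then have "0 \<le> r x" using r_neg_iff[OF xS] by simp
  moreover have "r x \<le> 0"
    by (rule isCont_closure_le[OF r_isCont[OF xS] closure_neg[OF xS N_S_D(2)[OF x] open_UNIV UNIV_I]]) auto
  ultimately show ?thesis by simp
qed

lemma Re_G_N:
  assumes x: "x \<in> N \<inter> S"
  shows "Re (G x) \<le> 1"
proof -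
  have xS: "x \<in> S" using x by simp
  have "continuous_on S G" using Ck_on_lower[OF Ck_on_lower[OF G_Ck]] by simp
  then have "isCont G x" using open_S xS continuous_on_eq_continuous_at by blast
  then have "isCont (\<lambda>x. Re (G x)) x" by simp
  then show ?thesis
    by (rule isCont_closure_le[OF _ closure_neg[OF xS N_S_D(2)[OF x] open_UNIV UNIV_I]])
      (use Re_G_less in \<open>auto intro: less_imp_le\<close>)
qed

text \<open>The image of the segment under the inverse chart is connected and contains points of
  \<Omega> and of its complement, so it meets the frontier.\<close>

lemma separates_N: "S' \<subseteq> S \<Longrightarrow> separates N S' r"
  unfolding separates_def
proof (intro allI impI)
  fix a b assume sub: "S' \<subseteq> S" "closed_segment a b \<subseteq> S'" and ab: "r a < 0" "0 < r b"
  have seg: "x \<in> S" if "x \<in> closed_segment a b" for x using sub that by blast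
  let ?C = "chart_inv c ` closed_segment a b"
  have "continuous_on (closed_segment a b) (chart_inv c)"
    using S_D(3,4)[OF seg] isCont_chart_inv by (intro continuous_at_imp_continuous_on ballI) (metis imageI)
  then have "connected ?C" by (rule connected_continuous_image) (rule connected_segment)
  moreover have "?C \<inter> \<Omega> \<noteq> {}" using r_neg_iff[of a] seg[of a] ab by auto
  moreover have "?C - \<Omega> \<noteq> {}" using r_neg_iff[of b] seg[of b] ab by fastforce
  ultimately have "?C \<inter> frontier \<Omega> \<noteq> {}" by (rule connected_Int_frontier)
  then obtain x where x: "x \<in> closed_segment a b" "chart_inv c x \<in> frontier \<Omega>" by blast
  then have "x \<in> N" using S_D(3,4)[OF seg[OF x(1)]] by (auto simp: N_def intro!: rev_image_eqI)
  then show "closed_segment a b \<inter> N \<noteq> {}" using x(1) by blast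
qed

definition r' :: "real ^ 'n \<Rightarrow> real ^ 'n \<Rightarrow> real" where "r' x v = Re (frechet_derivative rc (at x) v)"
definition r'' :: "real ^ 'n \<Rightarrow> real ^ 'n \<Rightarrow> real ^ 'n \<Rightarrow> real" where "r'' x v w = Re (D2 rc x v w)"
definition u :: "real ^ 'n \<Rightarrow> real" where "u x = Re (G x)"
definition u' :: "real ^ 'n \<Rightarrow> real ^ 'n \<Rightarrow> real" where "u' x v = Re (frechet_derivative G (at x) v)"
definition u'' :: "real ^ 'n \<Rightarrow> real ^ 'n \<Rightarrow> real ^ 'n \<Rightarrow> real" where "u'' x v w = Re (D2 G x v w)"

lemma r2: "has_derivs2 r r' r'' S"
proof -
  have "has_derivs2 (\<lambda>x. Re (rc x)) r' r'' S"
    unfolding r'_def[abs_def] r''_def[abs_def]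
    by (rule has_derivs2_bounded_linear[OF bounded_linear_Re Ck_on_2D(1)[OF rc_Ck]])
  then show ?thesis by (simp add: rc_def)
qed

lemma u2: "has_derivs2 u u' u'' S"
  unfolding u_def[abs_def] u'_def[abs_def] u''_def[abs_def]
  by (rule has_derivs2_bounded_linear[OF bounded_linear_Re Ck_on_2D(1)[OF G_Ck]])

lemma fd_r: "x \<in> S \<Longrightarrow> frechet_derivative r (at x) = r' x"
  by (rule frechet_derivative_eqI[OF has_derivs2D(1)[OF r2]])

lemma rc_derivative: "x \<in> S \<Longrightarrow> (rc has_derivative (\<lambda>v. complex_of_real (r' x v))) (at x)"
  unfolding rc_def[abs_def]
  by (rule bounded_linear.has_derivative[OF bounded_linear_of_real has_derivs2D(1)[OF r2]])

lemma cderiv_rc: "x \<in> S \<Longrightarrow> cderiv rc x w = complex_of_real (r' x (Re_vec w)) + \<i> * complex_of_real (r' x (Im_vec w))"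
  by (rule cderiv_eq[OF rc_derivative])

lemma cderiv_G: "x \<in> S \<Longrightarrow> cderiv G x w = frechet_derivative G (at x) (Re_vec w) + \<i> * frechet_derivative G (at x) (Im_vec w)"
  by (rule cderiv_eq[OF has_derivs2D(1)[OF Ck_on_2D(1)[OF G_Ck]]])

lemma \<rho>c_apply: "q \<in> U \<inter> fst c \<Longrightarrow> X \<in> ctangent A q \<Longrightarrow> X \<rho>c = cderiv rc (snd c q) (comps c X)"
proof -
  assume q: "q \<in> U \<inter> fst c" and X: "X \<in> ctangent A q"
  have "smooth_near A q \<rho>c" using q U(2) unfolding smooth_near_def \<rho>c_def[abs_def] by blast
  moreover have "\<rho>c \<circ> chart_inv c = rc" by (simp add: fun_eq_iff \<rho>c_def rc_def r_def)
  ultimately show ?thesis using ctangent_apply[OF X, of \<rho>c] q by simp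
qed

lemma eventually_N_transfer:
  assumes "\<forall>\<^sub>F q in nhds p0. q \<in> frontier \<Omega> \<longrightarrow> P q"
  shows "\<forall>\<^sub>F x in nhds x0. x \<in> N \<longrightarrow> P (chart_inv c x)"
proof -
  have "isCont (chart_inv c) x0" using isCont_chart_inv p0(2) by (auto simp: x0_def)
  then have "(chart_inv c \<longlongrightarrow> chart_inv c x0) (nhds x0)"
    by (simp only: isCont_def tendsto_at_iff_tendsto_nhds)
  then have "filterlim (chart_inv c) (nhds p0) (nhds x0)" by (simp only: inv_x0)
  from eventually_compose_filterlim[OF assms this] eventually_nhds_in_open[OF open_S x0_S]
  show ?thesis by eventually_elim (use N_S_D(1) in auto)
qed

lemma \<rho>c_frontier: "q \<in> frontier \<Omega> \<Longrightarrow> q \<in> U \<inter> V \<inter> fst c \<Longrightarrow> \<rho>c q = 0"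
  using r_N[of "snd c q"] chart_inv_left[OF chart, of q] by (auto simp: N_def S_def r_def \<rho>c_def)

lemma eventually_\<rho>c_frontier:
  assumes "q \<in> U \<inter> V \<inter> fst c"
  shows "\<forall>\<^sub>F q in nhds q. q \<in> frontier \<Omega> \<longrightarrow> \<rho>c q = 0"
proof -
  have "\<forall>\<^sub>F q in nhds q. q \<in> U \<inter> V \<inter> fst c"
    using assms open_U open_V open_dom[OF chart] by (intro eventually_nhds_in_open) auto
  then show ?thesis by eventually_elim (simp add: \<rho>c_frontier)
qed

lemma ctangent_sub_\<rho>c:
  assumes "q \<in> U \<inter> V \<inter> fst c" "X \<in> ctangent_sub A (frontier \<Omega>) q"
  shows "X \<rho>c = 0"
proof -
  have "smooth_near A q \<rho>c" using assms U(2) unfolding smooth_near_def \<rho>c_def[abs_def] by blast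
  then show ?thesis using assms eventually_\<rho>c_frontier[OF assms(1)] by (auto simp: ctangent_sub_def)
qed

end

lemma linear_Re_vec: "linear (Re_vec :: complex ^ 'n::finite \<Rightarrow> real ^ 'n)"
  by (rule linearI) (simp_all add: vec_eq_iff)

lemma linear_Im_vec: "linear (Im_vec :: complex ^ 'n::finite \<Rightarrow> real ^ 'n)"
  by (rule linearI) (simp_all add: vec_eq_iff)

lemma continuous_on_Re_vec: "continuous_on X f \<Longrightarrow> continuous_on X (\<lambda>x. Re_vec (f x :: complex ^ 'n::finite))"
  by (rule bounded_linear.continuous_on[OF linear_Re_vec[unfolded linear_conv_bounded_linear]])

lemma continuous_on_Im_vec: "continuous_on X f \<Longrightarrow> continuous_on X (\<lambda>x. Im_vec (f x :: complex ^ 'n::finite))"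
  by (rule bounded_linear.continuous_on[OF linear_Im_vec[unfolded linear_conv_bounded_linear]])

context manifold_chart
begin

lemma field_comps_continuous_on:
  assumes "smooth_field A U Z"
  shows "continuous_on (snd c ` (U \<inter> fst c)) (field_comps c Z)"
  using field_comps_isCont[OF assms] by (intro continuous_at_imp_continuous_on) blast

lemma conj_deriv_continuous_on:
  assumes "smooth_field A U Z"
  shows "continuous_on (snd c ` (U \<inter> fst c)) (conj_deriv (field_comps c Z))"
proof -
  have c1: "continuous_on (snd c ` (U \<inter> fst c)) (\<lambda>x. frechet_derivative (\<lambda>y. field_comps c Z y $ i) (at x) v)" for i v
    by (rule Ck_on_1_continuous[OF field_comps_Ck[OF assms]])
  have c2: "continuous_on (snd c ` (U \<inter> fst c)) (\<lambda>x. field_comps c Z x $ i)" for i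
    using field_comps_Ck[OF assms, of 0] by simp
  show ?thesis
    unfolding conj_deriv_def[abs_def] cderiv_def cnj_vec_nth
    by (intro continuous_on_vec_lambda continuous_on_sum continuous_on_mult continuous_on_cnj) (rule c1 c2)+
qed

end

section \<open>The Hopf lemma and the Levi form at the peak point\<close>

context peak_point
begin

lemma r'_linear: "x \<in> S \<Longrightarrow> linear (r' x)"
  using has_derivs2D(1)[OF r2] by (rule has_derivative_linear)

lemma r'_continuous_on: "continuous_on S (\<lambda>x. r' x v)"
  unfolding r'_def using Ck_on_1_continuous[OF rc_Ck] by (intro continuous_on_Re)

lemma r''_continuous_on: "continuous_on S (\<lambda>x. r'' x v w)"
  unfolding r''_def using Ck_on_2D(2)[OF rc_Ck] by (intro continuous_on_Re)

lemma r''_axis_sum: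
  assumes "x \<in> S"
  shows "r'' x a d = (\<Sum>k\<in>UNIV. \<Sum>i\<in>UNIV. a $ k * d $ i * r'' x (axis k 1) (axis i 1))"
  unfolding r''_def by (subst D2_axis_sum[OF open_S assms rc_Ck]) simp

text \<open>The direction \<open>w\<close> points into \<Omega>. The kernel condition turns the
  complex equation for \<open>G\<close> into a real one for its real part, and the real or the
  imaginary part of \<open>Z k\<close> is the transverse direction that the Hopf lemma asks
  for.\<close>

lemma normal_derivative_pos:
  fixes nr k :: nat
  assumes W: "open W" "p0 \<in> W" and Z: "\<And>j. j < nr \<Longrightarrow> Z j \<in> CR_sections A T W"
    and ker: "\<And>x. x \<in> snd c ` (W \<inter> fst c) \<Longrightarrow>
      \<exists>w\<in>TC x. Re_vec w = - 2 *\<^sub>R (\<Sum>j<nr. Im_vec (conj_deriv (field_comps c (Z j)) x))"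
    and k: "k < nr" "cderiv rc x0 (field_comps c (Z k) x0) \<noteq> 0"
    and w: "r' x0 w < 0"
  shows "u' x0 w < 0"
proof -
  define z where "z j = field_comps c (Z j)" for j
  define W' where "W' = snd c ` (W \<inter> fst c)"
  have W': "open W'" "x0 \<in> W'"
    unfolding W'_def using open_chart_image[OF chart W(1)] W(2) p0(2) by (auto simp: x0_def)
  have Zf: "smooth_field A W (Z j)" if "j < nr" for j using Z[OF that] by (simp add: CR_sections_def)
  obtain C where C: "0 \<le> C" "\<forall>\<^sub>F x in nhds x0. \<forall>w\<in>TC x. norm (Im_vec w) \<le> C * norm (Re_vec w)"
    using TC_Im_bound[OF p0(2)] unfolding x0_def by blast
  then obtain X where X: "open X" "x0 \<in> X" "\<And>x w. x \<in> X \<Longrightarrow> w \<in> TC x \<Longrightarrow> norm (Im_vec w) \<le> C * norm (Re_vec w)"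
    unfolding eventually_nhds by blast
  have "open (S \<inter> W' \<inter> X)" "x0 \<in> S \<inter> W' \<inter> X" using open_S x0_S W' X by auto
  then obtain R where R: "0 < R" "cball x0 R \<subseteq> S \<inter> W' \<inter> X" by (meson open_contains_cball)
  let ?K = "cball x0 R"
  have K: "x \<in> S" "x \<in> W'" "x \<in> X" if "x \<in> ?K" for x using R that by auto
  have KS: "?K \<subseteq> S" and KW: "?K \<subseteq> W'" using R by auto
  define \<alpha> where "\<alpha> x = (\<Sum>j<nr. Re_vec (conj_deriv (z j) x))" for x
  define \<beta> where "\<beta> x = (\<Sum>j<nr. Im_vec (conj_deriv (z j) x))" for x
  \<comment> \<open>A choice point by point: \<open>wf\<close> need not be continuous, and its
    imaginary part is bounded through \<open>TC_Im_bound\<close> instead.\<close>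
  have "\<forall>x. \<exists>w. x \<in> W' \<longrightarrow> w \<in> TC x \<and> Re_vec w = - 2 *\<^sub>R \<beta> x"
    using ker unfolding W'_def \<beta>_def z_def by blast
  then obtain wf where wf: "\<And>x. x \<in> W' \<Longrightarrow> wf x \<in> TC x" "\<And>x. x \<in> W' \<Longrightarrow> Re_vec (wf x) = - 2 *\<^sub>R \<beta> x"
    by metis
  \<comment> \<open>Summing the equations for the \<open>z j\<close> leaves the first order term
    \<open>dG (\<alpha>) + \<i> dG (\<beta>)\<close>. Since \<open>wf x\<close> lies in
    \<open>T\<close> and has real part \<open>- 2 \<beta>\<close>, the second summand equals
    \<open>- dG (Im wf) / 2\<close>, a derivative along a real vector; so taking real parts yields
    an equation for \<open>u\<close> alone.\<close>
  define b where "b x = \<alpha> x - (1 / 2) *\<^sub>R Im_vec (wf x)" for x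
  define I where "I = {..<nr} <+> {..<nr}"
  define v where "v = case_sum (\<lambda>j x. Re_vec (z j x)) (\<lambda>j x. Im_vec (z j x))"
  have z_cont: "continuous_on W' (z j)" if "j < nr" for j
    unfolding W'_def z_def by (rule field_comps_continuous_on[OF Zf[OF that]])
  have v_cont: "continuous_on W' (v j)" if "j \<in> I" for j
    using that z_cont by (auto simp: I_def v_def intro!: continuous_on_Re_vec continuous_on_Im_vec)
  have vi_cont: "continuous_on W' (\<lambda>x. v j x $ i)" if "j \<in> I" for j i
    by (intro continuous_intros v_cont that)
  have conj_cont: "continuous_on W' (conj_deriv (z j))" if "j < nr" for j
    unfolding W'_def z_def by (rule conj_deriv_continuous_on[OF Zf[OF that]])
  have \<alpha>_cont: "continuous_on W' \<alpha>" unfolding \<alpha>_def[abs_def]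
    using conj_cont by (intro continuous_on_sum continuous_on_Re_vec) auto
  have \<beta>_cont: "continuous_on W' \<beta>" unfolding \<beta>_def[abs_def]
    using conj_cont by (intro continuous_on_sum continuous_on_Im_vec) auto
  obtain B1 where B1: "0 \<le> B1" "\<And>x. x \<in> ?K \<Longrightarrow> norm (\<alpha> x) \<le> B1"
    using compact_norm_bound[OF compact_cball continuous_on_subset[OF \<alpha>_cont KW]] by blast
  obtain B2 where B2: "0 \<le> B2" "\<And>x. x \<in> ?K \<Longrightarrow> norm (\<beta> x) \<le> B2"
    using compact_norm_bound[OF compact_cball continuous_on_subset[OF \<beta>_cont KW]] by blast
  have "continuous_on ?K (\<lambda>x. \<Sum>j\<in>I. v j x \<bullet> v j x)"
    by (intro continuous_intros continuous_on_subset[OF v_cont KW])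
  then obtain B3 where B3: "0 \<le> B3" "\<And>x. x \<in> ?K \<Longrightarrow> norm (\<Sum>j\<in>I. v j x \<bullet> v j x) \<le> B3"
    using compact_norm_bound[OF compact_cball] by blast
  have "continuous_on ?K (\<lambda>x. \<Sum>j\<in>I. \<Sum>k\<in>UNIV. \<Sum>i\<in>UNIV. v j x $ k * v j x $ i * r'' x (axis k 1) (axis i 1))"
    by (intro continuous_on_sum continuous_on_mult continuous_on_subset[OF vi_cont KW] continuous_on_subset[OF r''_continuous_on KS])
  then obtain B4 where B4: "0 \<le> B4"
    "\<And>x. x \<in> ?K \<Longrightarrow> norm (\<Sum>j\<in>I. \<Sum>k\<in>UNIV. \<Sum>i\<in>UNIV. v j x $ k * v j x $ i * r'' x (axis k 1) (axis i 1)) \<le> B4"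
    using compact_norm_bound[OF compact_cball] by blast
  have "continuous_on ?K (\<lambda>x. \<Sum>i\<in>UNIV. \<bar>r' x (axis i 1)\<bar>)"
    by (intro continuous_intros continuous_on_subset[OF r'_continuous_on KS])
  then obtain B5 where B5: "0 \<le> B5" "\<And>x. x \<in> ?K \<Longrightarrow> norm (\<Sum>i\<in>UNIV. \<bar>r' x (axis i 1)\<bar>) \<le> B5"
    using compact_norm_bound[OF compact_cball] by blast
  \<comment> \<open>Half of the imaginary part of \<open>wf\<close> enters \<open>b\<close>, and its
    norm is at most half of \<open>C\<close> times that of \<open>2 \<beta>\<close>.\<close>
  define Bb where "Bb = B1 + C * B2"
  \<comment> \<open>A sum of nonnegative bounds, so that one constant serves all three boundedness
    conditions of the Hopf lemma; \<open>B5\<close> controls the sum of the absolute partial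
    derivatives of \<open>r\<close>.\<close>
  define B where "B = B3 + B4 + Bb + Bb * B5"
  have Bb: "0 \<le> Bb" using B1 B2 C by (simp add: Bb_def)
  have BbB5: "0 \<le> Bb * B5" using Bb B5 by simp
  have b_le: "norm (b x) \<le> Bb" if x: "x \<in> ?K" for x
  proof -
    have "norm (Im_vec (wf x)) \<le> C * norm (- 2 *\<^sub>R \<beta> x)"
      using X(3)[OF K(3)[OF x] wf(1)[OF K(2)[OF x]]] wf(2)[OF K(2)[OF x]] by simp
    also have "\<dots> = 2 * (C * norm (\<beta> x))" by simp
    also have "C * norm (\<beta> x) \<le> C * B2" using B2(2)[OF x] C(1) by (rule mult_left_mono)
    finally have 1: "norm ((1 / 2) *\<^sub>R Im_vec (wf x)) \<le> C * B2" by simp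
    have "norm (b x) \<le> norm (\<alpha> x) + norm ((1 / 2) *\<^sub>R Im_vec (wf x))"
      unfolding b_def by (rule norm_triangle_ineq4)
    then show ?thesis using 1 B1(2)[OF x] unfolding Bb_def by linarith
  qed
  have r'b_le: "\<bar>r' x (b x)\<bar> \<le> Bb * B5" if x: "x \<in> ?K" for x
  proof -
    have "r' x (b x) = (\<Sum>i\<in>UNIV. b x $ i * r' x (axis i 1))"
      using linear_axis_sum[OF r'_linear[OF K(1)[OF x]], of "b x"] by simp
    also have "\<bar>\<dots>\<bar> \<le> (\<Sum>i\<in>UNIV. Bb * \<bar>r' x (axis i 1)\<bar>)"
    proof (rule order_trans[OF sum_abs sum_mono])
      fix i
      have "\<bar>b x $ i\<bar> \<le> Bb" using component_le_norm_cart[of "b x" i] b_le[OF x] by linarith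
      then show "\<bar>b x $ i * r' x (axis i 1)\<bar> \<le> Bb * \<bar>r' x (axis i 1)\<bar>"
        unfolding abs_mult by (intro mult_right_mono) auto
    qed
    also have "\<dots> = Bb * (\<Sum>i\<in>UNIV. \<bar>r' x (axis i 1)\<bar>)" by (simp add: sum_distrib_left)
    also have "\<dots> \<le> Bb * B5" using B5(2)[OF x] Bb by (intro mult_left_mono) auto
    finally show ?thesis .
  qed
  have isCont_at: "isCont h x0" if "continuous_on W' h" for h :: "real ^ 'n \<Rightarrow> 'b::topological_space"
    using that W' continuous_on_eq_continuous_at by blast
  have r'_isCont: "isCont (\<lambda>x. r' x a) x0" for a
    using r'_continuous_on open_S x0_S continuous_on_eq_continuous_at by blast
  have kv: "\<exists>j\<in>I. r' x0 (v j x0) \<noteq> 0"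
  proof (rule ccontr)
    assume "\<not> ?thesis"
    then have "r' x0 (v (Inl k) x0) = 0" "r' x0 (v (Inr k) x0) = 0" using k(1) by (auto simp: I_def)
    then show False using k(2) by (simp add: cderiv_rc[OF x0_S] v_def z_def)
  qed
  then obtain j where j: "j \<in> I" "r' x0 (v j x0) \<noteq> 0" by blast
  have ballK: "x \<in> ?K" if "x \<in> ball x0 R" for x using that by auto
  show ?thesis
  proof (rule hopf_boundary_point[where S = "ball x0 R" and u = u and r = r and v = v and b = b and B = B and I = I
        and k = j and u'' = u'' and r'' = r'' and r' = r'])
    show "open (ball x0 R)" "x0 \<in> ball x0 R" using R by auto
    show "has_derivs2 u u' u'' (ball x0 R)" by (rule has_derivs2_subset[OF u2]) (use K ballK in auto)
    show "has_derivs2 r r' r'' (ball x0 R)" by (rule has_derivs2_subset[OF r2]) (use K ballK in auto)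
    show "r x0 = 0" using r_N x0_N x0_S by blast
    show "u x < u x0" if "x \<in> ball x0 R" "r x < 0" for x
      using Re_G_less[OF K(1)[OF ballK[OF that(1)]] that(2)] by (simp add: u_def G_x0)
    show "finite I" by (simp add: I_def)
    show "j \<in> I" "r' x0 (v j x0) \<noteq> 0" by fact+
    show "r' x0 w < 0" by fact
    show "isCont (v j) x0" if "j \<in> I" for j by (rule isCont_at[OF v_cont[OF that]])
    show "isCont (\<lambda>x. r' x (v j x)) x0" if "j \<in> I" for j
    proof -
      have ct: "isCont (\<lambda>x. \<Sum>i\<in>UNIV. v j x $ i * r' x (axis i 1)) x0"
        by (intro continuous_intros isCont_at[OF vi_cont[OF that]] r'_isCont)
      have ev: "\<forall>\<^sub>F x in nhds x0. (\<Sum>i\<in>UNIV. v j x $ i * r' x (axis i 1)) = r' x (v j x)"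
        using eventually_nhds_in_open[OF open_S x0_S]
      proof eventually_elim
        case (elim x)
        show ?case using linear_axis_sum[OF r'_linear[OF elim], of "v j x"] by simp
      qed
      show ?thesis by (rule isCont_cong[OF ev, THEN iffD1, OF ct])
    qed
    fix x assume x: "x \<in> ball x0 R"
    note xK = ballK[OF x]
    show "norm (b x) \<le> B"
      using b_le[OF xK] B3(1) B4(1) BbB5 unfolding B_def by linarith
    show "(\<Sum>j\<in>I. v j x \<bullet> v j x) \<le> B"
      using B3(2)[OF xK] B4(1) Bb BbB5 unfolding B_def real_norm_def by linarith
    show "\<bar>(\<Sum>j\<in>I. r'' x (v j x) (v j x)) + r' x (b x)\<bar> \<le> B"
    proof -
      have "\<bar>\<Sum>j\<in>I. r'' x (v j x) (v j x)\<bar> \<le> B4"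
        using B4(2)[OF xK] unfolding r''_axis_sum[OF K(1)[OF xK], of "v _ x"] real_norm_def .
      then show ?thesis using r'b_le[OF xK] B3(1) Bb unfolding B_def by linarith
    qed
    assume neg: "r x < 0"
    have xS: "x \<in> S" and xW: "x \<in> W'" using K xK by auto
    let ?F = "frechet_derivative G (at x)"
    have F: "linear ?F"
      using has_derivs2D(1)[OF Ck_on_2D(1)[OF G_Ck] xS] by (rule has_derivative_linear)
    have eqj: "?F (Re_vec (conj_deriv (z j) x)) + \<i> * ?F (Im_vec (conj_deriv (z j) x))
        + D2 G x (Re_vec (z j x)) (Re_vec (z j x)) + D2 G x (Im_vec (z j x)) (Im_vec (z j x)) = 0"
      if j: "j < nr" for j
    proof -
      have zd: "(\<lambda>y. z j y $ i) differentiable (at x)" for i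
        unfolding z_def using field_comps_differentiable[OF Zf[OF j]] xW by (simp add: W'_def)
      \<comment> \<open>On the open side \<open>r < 0\<close> the function \<open>Z j G\<close>
        vanishes identically, so it may be differentiated in every direction, in particular along
        the conjugate of \<open>z j\<close>.\<close>
      have "cderiv (\<lambda>y. cderiv G y (z j y)) x (cnj_vec (z j x)) = cderiv (\<lambda>y. 0) x (cnj_vec (z j x))"
      proof (rule cderiv_cong_open)
        show "open ({x \<in> S. r x < 0} \<inter> W')" by (intro open_Int open_neg W')
        show "x \<in> {x \<in> S. r x < 0} \<inter> W'" using xS xW neg by simp
        show "cderiv G y (z j y) = 0" if "y \<in> {x \<in> S. r x < 0} \<inter> W'" for y
        proof -
          have "z j y \<in> TC y" unfolding z_def using field_comps_TC[OF Z[OF j]] that by (simp add: W'_def)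
          then show ?thesis using G_TC_neg that by simp
        qed
      qed
      then show ?thesis
        unfolding cderiv_conj_cderiv[OF open_S xS G_Ck zd] by (simp add: cderiv_G[OF xS])
    qed
    let ?H = "\<Sum>j<nr. D2 G x (Re_vec (z j x)) (Re_vec (z j x)) + D2 G x (Im_vec (z j x)) (Im_vec (z j x))"
    have "(\<Sum>j<nr. ?F (Re_vec (conj_deriv (z j) x)) + \<i> * ?F (Im_vec (conj_deriv (z j) x))
        + D2 G x (Re_vec (z j x)) (Re_vec (z j x)) + D2 G x (Im_vec (z j x)) (Im_vec (z j x))) = 0"
      using eqj by (intro sum.neutral) auto
    then have 1: "?F (\<alpha> x) + \<i> * ?F (\<beta> x) + ?H = 0"
      by (simp add: \<alpha>_def \<beta>_def linear_sum[OF F] sum.distrib sum_distrib_left add.assoc)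
    have "?F (Re_vec (wf x)) + \<i> * ?F (Im_vec (wf x)) = 0"
      using G_TC_neg[OF xS neg wf(1)[OF xW]] by (simp add: cderiv_G[OF xS])
    then have "\<i> * ?F (Im_vec (wf x)) = 2 * ?F (\<beta> x)"
      unfolding wf(2)[OF xW] linear_scale[OF F] by (simp add: scaleR_conv_of_real)
    then have "(1 / 2) * (\<i> * (2 * ?F (\<beta> x))) = (1 / 2) * (\<i> * (\<i> * ?F (Im_vec (wf x))))" by (simp only:)
    then have 2: "\<i> * ?F (\<beta> x) = - (1 / 2) * ?F (Im_vec (wf x))" by simp
    have 3: "?F (b x) = ?F (\<alpha> x) + \<i> * ?F (\<beta> x)"
      unfolding b_def linear_diff[OF F] linear_scale[OF F] 2 by (simp add: scaleR_conv_of_real)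
    have "?H + ?F (b x) = 0" using 1 unfolding 3 by (simp only: add.commute)
    then have "Re (?H + ?F (b x)) = 0" by simp
    then show "(\<Sum>j\<in>I. u'' x (v j x) (v j x)) + u' x (b x) = 0"
      by (simp add: I_def v_def sum.Plus u''_def u'_def sum.distrib)
  qed
qed

text \<open>Transfers the maximum argument to the chart, on the part of \<open>S\<close> over which
  \<open>Z\<close> is smooth: \<open>Z G = 0\<close> on the boundary comes from
  \<open>G_TC_closure\<close>, and \<open>Z r = 0\<close> from tangency.\<close>

lemma levi_Im_nonpos:
  assumes \<mu>: "\<And>v. u' x0 v = \<mu> * r' x0 v" and w: "r' x0 w \<noteq> 0"
    and Z: "Z \<in> CR_sections_sub A T (frontier \<Omega>) W" "p0 \<in> W"
  shows "Im (frechet_derivative G (at x0) (Im_vec (conj_deriv (field_comps c Z) x0))) \<le> 0"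
proof -
  have Zf: "smooth_field A W Z" using Z by (simp add: CR_sections_sub_def)
  let ?W = "snd c ` (W \<inter> fst c)"
  have W: "open ?W" "x0 \<in> ?W"
    using open_chart_image[OF chart smooth_field_open[OF Zf]] p0(2) Z(2) by (auto simp: x0_def)
  have Zx: "Z (chart_inv c x) \<in> T (chart_inv c x)" "Z (chart_inv c x) \<in> ctangent_sub A (frontier \<Omega>) (chart_inv c x)"
    if "x \<in> N \<inter> (S \<inter> ?W)" for x
    using Z(1) that N_S_D(1)[of x] chart_image_inv(1)[OF chart, of x W] by (auto simp: CR_sections_sub_def)
  show ?thesis
  proof (rule levi_nonneg_at_max[where S = "S \<inter> ?W" and N = N and r = r and w = w and \<mu> = \<mu>])
    show "open (S \<inter> ?W)" "x0 \<in> S \<inter> ?W" using open_S x0_S W by auto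
    show "Ck_on (Suc (Suc 0)) G (S \<inter> ?W)" by (rule Ck_on_subset[OF G_Ck]) simp
    show "Ck_on (Suc (Suc 0)) (\<lambda>x. complex_of_real (r x)) (S \<inter> ?W)"
      using Ck_on_subset[OF rc_Ck, of "S \<inter> ?W"] by (simp only: rc_def[abs_def] Int_lower1)
    show "separates N (S \<inter> ?W) r" by (rule separates_N) simp
    show "x0 \<in> N" by (rule x0_N)
    show "r x = 0" if "x \<in> N \<inter> (S \<inter> ?W)" for x using r_N that by blast
    show "frechet_derivative r (at x0) w \<noteq> 0" using w by (simp add: fd_r[OF x0_S])
    show "Re (frechet_derivative G (at x0) v) = \<mu> * frechet_derivative r (at x0) v" for v
      using \<mu>[of v] by (simp add: fd_r[OF x0_S] u'_def)
    show "Re (G x) \<le> Re (G x0)" if "x \<in> N \<inter> (S \<inter> ?W)" for x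
      using Re_G_N[of x] that by (simp add: G_x0)
    show "(\<lambda>y. field_comps c Z y $ i) differentiable (at x0)" for i
      by (rule field_comps_differentiable[OF Zf W(2)])
    show "cderiv G x (field_comps c Z x) = 0" if x: "x \<in> N \<inter> (S \<inter> ?W)" for x
    proof (rule G_TC_closure)
      show "x \<in> S" "chart_inv c x \<in> closure \<Omega>" using x N_S_D(2)[of x] by auto
      show "field_comps c Z x \<in> TC x" using Zx(1)[OF x] by (simp add: TC_def field_comps_def)
    qed
    show "cderiv (\<lambda>x. complex_of_real (r x)) x (field_comps c Z x) = 0" if x: "x \<in> N \<inter> (S \<inter> ?W)" for x
    proof -
      have xS: "x \<in> S" using x by simp
      have "Z (chart_inv c x) \<rho>c = 0"
        using ctangent_sub_\<rho>c[OF _ Zx(2)[OF x]] S_D[OF xS] by simp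
      moreover have "Z (chart_inv c x) \<rho>c = cderiv rc x (field_comps c Z x)"
        using \<rho>c_apply[of "chart_inv c x" "Z (chart_inv c x)"] S_D[OF xS] T_ctangent[OF Zx(1)[OF x]]
        by (simp add: field_comps_def)
      ultimately show ?thesis by (simp add: rc_def[abs_def])
    qed
  qed
qed

text \<open>The covectors in \<open>H0_M\<close> are restricted to \<open>ctangent_sub\<close> and
  unspecified elsewhere, so the bracket has to lie in it. If \<open>h\<close> vanishes on the
  frontier near \<open>p0\<close>, then so do its derivatives along \<open>Z\<close> and its
  conjugate, and the other field kills these again.\<close>

lemma bracket_tangent_sub:
  assumes Z: "Z \<in> CR_sections_sub A T (frontier \<Omega>) W" "p0 \<in> W"
  shows "cscale a (bracket A Z (field_conj Z) p0) \<in> ctangent_sub A (frontier \<Omega>) p0"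
proof -
  let ?N = "frontier \<Omega>"
  have Zf: "smooth_field A W Z" using Z by (simp add: CR_sections_sub_def)
  note Zcf = smooth_field_conj[OF manifold Zf]
  have Zt: "Z q \<in> ctangent_sub A ?N q" if "q \<in> W" "q \<in> ?N" for q
    using Z that by (auto simp: CR_sections_sub_def)
  have Z_kill: "Z q h = 0" if "q \<in> W" "q \<in> ?N" "smooth_near A q h" "\<forall>\<^sub>F q in nhds q. q \<in> ?N \<longrightarrow> h q = 0" for q h
    using Zt[OF that(1,2)] that(3,4) by (simp add: ctangent_sub_def)
  have Zc_kill: "field_conj Z q h = 0" if "q \<in> W" "q \<in> ?N" "smooth_near A q h" "\<forall>\<^sub>F q in nhds q. q \<in> ?N \<longrightarrow> h q = 0" for q h
  proof -
    have "Z q (\<lambda>q. cnj (h q)) = 0"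
      by (rule Z_kill[OF that(1,2)]) (use that(3,4) smooth_near_cnj in simp_all)
    then show ?thesis by (simp add: field_conj_def vconj_def)
  qed
  have "bracket A Z (field_conj Z) p0 h = 0"
    if h: "smooth_near A p0 h" "\<forall>\<^sub>F q in nhds p0. q \<in> ?N \<longrightarrow> h q = 0" for h
  proof -
    obtain X where X: "p0 \<in> X" "smooth_fun A X h" using h(1) by (auto simp: smooth_near_def)
    obtain Y where Y: "open Y" "p0 \<in> Y" "\<And>q. q \<in> Y \<Longrightarrow> q \<in> ?N \<longrightarrow> h q = 0"
      using h(2) unfolding eventually_nhds by blast
    have oX: "open (X \<inter> W)" using X(2) smooth_field_open[OF Zf] by (auto simp: smooth_fun_def Ck_fun_def)
    have hXW: "smooth_fun A (X \<inter> W) h" by (rule smooth_fun_subset[OF X(2) oX]) simp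
    have s1: "smooth_near A p0 (\<lambda>q. Z q h)" and s2: "smooth_near A p0 (\<lambda>q. field_conj Z q h)"
      using Zf Zcf hXW X(1) Z(2) unfolding smooth_near_def smooth_field_def by (meson IntI Int_lower2)+
    have evY: "\<forall>\<^sub>F q in nhds p0. q \<in> X \<inter> W \<inter> Y"
      using oX Y X(1) Z(2) by (intro eventually_nhds_in_open) auto
    have near: "smooth_near A q h" "\<forall>\<^sub>F q in nhds q. q \<in> ?N \<longrightarrow> h q = 0" if "q \<in> X \<inter> W \<inter> Y" for q
    proof -
      show "smooth_near A q h" using X(2) that by (auto simp: smooth_near_def)
      show "\<forall>\<^sub>F q in nhds q. q \<in> ?N \<longrightarrow> h q = 0"
        using eventually_nhds_in_open[OF Y(1), of q] that by (auto elim!: eventually_mono dest: Y(3))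
    qed
    have e1: "\<forall>\<^sub>F q in nhds p0. q \<in> ?N \<longrightarrow> Z q h = 0"
      using evY by eventually_elim (use Z_kill near in blast)
    have e2: "\<forall>\<^sub>F q in nhds p0. q \<in> ?N \<longrightarrow> field_conj Z q h = 0"
      using evY by eventually_elim (use Zc_kill near in blast)
    show ?thesis
      using h(1) Z_kill[OF Z(2) p0(1) s2 e2] Zc_kill[OF Z(2) p0(1) s1 e1] by (simp add: bracket_def)
  qed
  moreover have "bracket A Z (field_conj Z) p0 \<in> ctangent A p0"
    using bracket_eq[OF Zf Zcf, of p0] p0(2) Z(2) by auto
  then have "cscale a (bracket A Z (field_conj Z) p0) \<in> ctangent A p0"
    by (rule cvec.subspace_scale[OF ctangent_subspace[OF p0(2)]])
  ultimately show ?thesis by (simp add: ctangent_sub_def cscale_def)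
qed

lemma exists_covector:
  assumes nonchar: "Theta_noncharacteristic A T (frontier \<Omega>) p0"
    and d\<rho>: "\<exists>X\<in>tangent A p0. differential \<rho> X \<noteq> 0"
  shows "\<exists>\<xi>\<in>H0_M A T \<Omega> p0 \<rho>. (\<exists>X\<in>tangent_sub A (frontier \<Omega>) p0. \<xi> X \<noteq> 0) \<and>
    scalar_levi_nonneg A T (frontier \<Omega>) p0 \<xi>"
proof -
  let ?N = "frontier \<Omega>"
  have p0UV: "p0 \<in> U \<inter> V \<inter> fst c" using U(1) V(1) p0(2) by simp
  have diff_\<rho>: "differential \<rho> X = X \<rho>c" for X by (simp add: differential_def \<rho>c_def[abs_def])
  have \<rho>_rc: "X \<rho>c = cderiv rc x0 (comps c X)" if "X \<in> ctangent A p0" for X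
    using \<rho>c_apply[OF _ that] p0UV by (simp add: x0_def)
  obtain X1 where X1: "X1 \<in> tangent A p0" "X1 \<rho>c \<noteq> 0" using d\<rho> diff_\<rho> by auto
  \<comment> \<open>A transverse vector is split by the noncharacteristic condition. The part
    tangent to the frontier kills \<rho>, so the field in Theta does not, and hence neither does one
    of the \<open>Z j\<close> that span it.\<close>
  then have "X1 \<in> {X + vRe (W p0) | X W. X \<in> tangent_sub A ?N p0 \<and> (\<exists>V. p0 \<in> V \<and> W \<in> Theta A T V)}"
    using nonchar by (simp add: Theta_noncharacteristic_def)
  then obtain X W V2 where X: "X1 = X + vRe (W p0)" "X \<in> tangent_sub A ?N p0"
    and W: "p0 \<in> V2" "W \<in> Theta A T V2" by blast
  have "X \<rho>c = 0" using ctangent_sub_\<rho>c[OF p0UV] X(2) by (simp add: tangent_sub_def)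
  then have "vRe (W p0) \<rho>c \<noteq> 0" using X1(2) unfolding X(1) by simp
  then have W\<rho>: "W p0 \<rho>c \<noteq> 0" by (auto simp: vRe_def vconj_def \<rho>c_def[abs_def] scaleR_fun_def)
  obtain UU \<tau> where \<tau>: "open V2" "V2 \<subseteq> UU" "\<tau> \<in> ker_levi A T UU" "W \<in> Theta_of A T \<tau> V2"
    using W(2) unfolding Theta_def by blast
  obtain nr Z a where Z: "represents A T V2 \<tau> nr Z"
    and WZ: "\<forall>q\<in>V2. W q = (\<Sum>j<nr. cscale (a j q) (Z j q))"
    using \<tau>(4) unfolding Theta_of_def by blast
  have ZV: "Z j \<in> CR_sections A T V2" if "j < nr" for j using Z that by (simp add: represents_def)
  have "W p0 \<rho>c = (\<Sum>j<nr. a j p0 * Z j p0 \<rho>c)"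
    using WZ W(1) by (simp add: sum_fun_apply cscale_def)
  then have "\<exists>k<nr. Z k p0 \<rho>c \<noteq> 0" using W\<rho> by (metis (no_types, lifting) lessThan_iff mult_zero_right sum.neutral)
  then obtain k where k: "k < nr" "Z k p0 \<rho>c \<noteq> 0" by blast
  have Zk: "Z k p0 \<in> T p0" using ZV[OF k(1)] W(1) by (simp add: CR_sections_def)
  define z where "z = comps c (Z k p0)"
  have fz: "field_comps c (Z k) x0 = z" by (simp add: field_comps_def inv_x0 z_def)
  have z_nz: "cderiv rc x0 z \<noteq> 0" using k(2) \<rho>_rc[OF T_ctangent[OF Zk]] by (simp add: z_def)
  have ker: "\<exists>w\<in>TC x. Re_vec w = - 2 *\<^sub>R (\<Sum>j<nr. Im_vec (conj_deriv (field_comps c (Z j)) x))"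
    if "x \<in> snd c ` (V2 \<inter> fst c)" for x
  proof -
    obtain p where p: "p \<in> V2 \<inter> fst c" "x = snd c p" using \<open>x \<in> _\<close> by blast
    show ?thesis unfolding p(2) by (rule ker_levi_conj_deriv[OF \<tau>(3) Z \<tau>(2) p(1)]) blast
  qed
  have normal: "u' x0 w < 0" if "r' x0 w < 0" for w
    by (rule normal_derivative_pos[OF \<tau>(1) W(1) ZV ker k(1) _ that]) (simp_all add: fz z_nz)
  have "\<exists>w. r' x0 w \<noteq> 0"
  proof (rule ccontr)
    assume "\<not> ?thesis"
    then have "cderiv rc x0 z = 0" by (simp add: cderiv_rc[OF x0_S])
    then show False using z_nz by contradiction
  qed
  then obtain w where w: "r' x0 w < 0"
    using linear_neg[OF r'_linear[OF x0_S]] by (metis neg_less_0_iff_less not_less_iff_gr_or_eq)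
  then have w_nz: "r' x0 w \<noteq> 0" by simp
  define \<mu> where "\<mu> = u' x0 w / r' x0 w"
  have \<mu>_pos: "\<mu> > 0" using normal[OF w] w by (simp add: \<mu>_def divide_neg_neg)
  have \<mu>: "u' x0 v = \<mu> * r' x0 v" for v
    unfolding \<mu>_def
  proof (rule lagrange_multiplier[OF open_S x0_S separates_N[OF order_refl] has_derivs2D(1)[OF r2 x0_S] _ w_nz has_derivs2D(1)[OF u2 x0_S]])
    show "r x0 = 0" using r_N x0_N x0_S by blast
    show "\<forall>\<^sub>F y in nhds x0. y \<in> N \<longrightarrow> u y \<le> u x0"
      using eventually_nhds_in_open[OF open_S x0_S]
      by eventually_elim (use Re_G_N in \<open>simp add: u_def G_x0\<close>)
  qed
  let ?F = "frechet_derivative G (at x0)"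
  have dG: "(G has_derivative ?F) (at x0)" by (rule has_derivs2D(1)[OF Ck_on_2D(1)[OF G_Ck] x0_S])
  have Re_F: "Re (?F v) = \<mu> * r' x0 v" for v using \<mu>[of v] by (simp add: u'_def)
  define H where "H x = complex_of_real (Im (G x))" for x
  have dH: "(H has_derivative (\<lambda>v. complex_of_real (Im (?F v)))) (at x0)"
    unfolding H_def[abs_def]
    by (intro bounded_linear.has_derivative[OF bounded_linear_of_real]
        bounded_linear.has_derivative[OF bounded_linear_Im] dG)
  \<comment> \<open>Using \<open>cderiv\<close> gives the complex linear extension; its values on
    real vectors are real because their components have no imaginary part.\<close>
  define \<xi> where "\<xi> X = cderiv H x0 (comps c X)" for X
  have \<xi>_eq: "\<xi> X = complex_of_real (Im (?F (Re_vec (comps c X)))) + \<i> * complex_of_real (Im (?F (Im_vec (comps c X))))" for X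
    unfolding \<xi>_def by (rule cderiv_eq[OF dH])
  have F0: "?F 0 = 0" by (rule linear_0[OF has_derivative_linear[OF dG]])
  have real_comps: "Im_vec (comps c X) = 0" if "X \<in> tangent A p0" for X
    using that tangent_iff[OF p0(2), of X] by (simp add: vec_eq_iff complex_eq_iff)
  have cov: "real_covector A p0 \<xi>"
    unfolding real_covector_def
  proof (intro conjI ballI allI)
    show "\<xi> (X + Y) = \<xi> X + \<xi> Y" for X Y by (simp only: \<xi>_def comps_add cderiv_add_arg)
    show "\<xi> (cscale a X) = a * \<xi> X" for a X by (simp only: \<xi>_def comps_cscale cderiv_scale_arg)
    show "\<xi> X \<in> \<real>" if "X \<in> tangent A p0" for X by (simp add: \<xi>_eq real_comps[OF that] F0)
  qed
  have p0_cl: "chart_inv c x0 \<in> closure \<Omega>" using p0(1) by (simp add: inv_x0 frontier_def)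
  \<comment> \<open>Since \<open>d (Re G) = \<mu> d\<rho>\<close> at the peak, this functional is
    the complex linear differential of \<open>G\<close>, which kills \<open>T\<close> at
    \<open>p0\<close> by \<open>G_TC_closure\<close>.\<close>
  have "covector_10 T p0 (\<lambda>X. complex_of_real \<mu> * differential \<rho> X + \<i> * \<xi> X)"
    unfolding covector_10_def
  proof
    fix Y assume Y: "Y \<in> T p0"
    have "comps c Y \<in> TC x0" using Y by (simp add: TC_def inv_x0)
    from G_TC_closure[OF x0_S p0_cl this]
    have 0: "?F (Re_vec (comps c Y)) + \<i> * ?F (Im_vec (comps c Y)) = 0" by (simp add: cderiv_G[OF x0_S])
    have "differential \<rho> Y = complex_of_real (r' x0 (Re_vec (comps c Y))) + \<i> * complex_of_real (r' x0 (Im_vec (comps c Y)))"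
      unfolding diff_\<rho> \<rho>_rc[OF T_ctangent[OF Y]] by (rule cderiv_rc[OF x0_S])
    then show "complex_of_real \<mu> * differential \<rho> Y + \<i> * \<xi> Y = 0"
      using 0 by (simp add: \<xi>_eq complex_eq_iff Re_F)
  qed
  then have H0: "restrict \<xi> (ctangent_sub A ?N p0) \<in> H0_M A T \<Omega> p0 \<rho>"
    unfolding H0_M_def using cov \<mu>_pos by blast
  \<comment> \<open>Multiplication by the conjugate of \<eta> rotates \<open>z\<close> so that
    \<open>d\<rho>\<close> becomes positive on it: \<open>Im_vec z1\<close> is then tangent to the
    boundary and \<open>Re_vec z1\<close> transverse.\<close>
  define \<eta> where "\<eta> = cderiv rc x0 z"
  define z1 where "z1 = cnj \<eta> *s z"
  have z1_TC: "z1 \<in> TC x0" unfolding z1_def z_def by (rule TC_ops(3)) (use Zk in \<open>simp add: TC_def inv_x0\<close>)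
  have "cderiv rc x0 z1 = complex_of_real ((cmod \<eta>)\<^sup>2)"
    unfolding z1_def cderiv_scale_arg \<eta>_def[symmetric] by (simp only: mult.commute[of "cnj \<eta>"] complex_norm_square)
  then have z1: "r' x0 (Re_vec z1) = (cmod \<eta>)\<^sup>2" "r' x0 (Im_vec z1) = 0"
    unfolding cderiv_rc[OF x0_S] by (simp_all add: complex_eq_iff)
  define Y where "Y = coord_vec A c p0 (\<chi> i. complex_of_real (Im_vec z1 $ i))"
  have Y_ct: "Y \<in> ctangent A p0" unfolding Y_def using p0(2) by (rule coord_vec_in_ctangent)
  have Y_comps: "comps c Y = (\<chi> i. complex_of_real (Im_vec z1 $ i))" unfolding Y_def by (rule comps_coord_vec[OF p0(2)])
  have Y_Re: "Re_vec (comps c Y) = Im_vec z1" and Y_Im: "Im_vec (comps c Y) = 0"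
    unfolding Y_comps by (simp_all add: vec_eq_iff)
  have "Y \<in> tangent A p0" unfolding tangent_iff[OF p0(2)] using Y_ct Y_comps by (simp add: vec_eq_iff)
  moreover have "Y \<in> ctangent_sub A ?N p0"
    unfolding ctangent_sub_def
  proof (intro CollectI conjI allI impI Y_ct)
    fix h assume h: "smooth_near A p0 h" "\<forall>\<^sub>F q in nhds p0. q \<in> ?N \<longrightarrow> h q = 0"
    have "(h \<circ> chart_inv c) differentiable (at x0)"
      unfolding x0_def by (rule smooth_near_differentiable[OF h(1) chart p0(2)])
    then obtain h' where h': "((h \<circ> chart_inv c) has_derivative h') (at x0)" by (auto simp: differentiable_def)
    have ev: "\<forall>\<^sub>F x in nhds x0. x \<in> N \<longrightarrow> (h \<circ> chart_inv c) x = 0"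
      using eventually_N_transfer[OF h(2)] by simp
    have "h p0 = 0" using eventually_nhds_x_imp_x[OF h(2)] p0(1) by blast
    then have "h' (Im_vec z1) = 0"
      by (intro derivative_tangent_eq_0[OF open_S x0_S separates_N[OF order_refl] has_derivs2D(1)[OF r2 x0_S] _ w_nz z1(2) h' _ ev])
        (use r_N x0_N x0_S in \<open>auto simp: inv_x0\<close>)
    moreover have "h' 0 = 0" by (rule linear_0[OF has_derivative_linear[OF h']])
    moreover have "Y h = cderiv (h \<circ> chart_inv c) x0 (comps c Y)"
      unfolding x0_def by (rule ctangent_apply[OF Y_ct p0(2) h(1)])
    ultimately show "Y h = 0" by (simp add: cderiv_eq[OF h'] Y_Re Y_Im)
  qed
  moreover have "\<xi> Y \<noteq> 0"
  proof -
    \<comment> \<open>By the CR equation the derivative of \<open>Im G\<close> along the tangent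
      vector \<open>Im_vec z1\<close> equals that of \<open>Re G\<close> along the transverse vector
      \<open>Re_vec z1\<close>, which the Hopf lemma makes nonzero.\<close>
    have "?F (Re_vec z1) + \<i> * ?F (Im_vec z1) = 0"
      using G_TC_closure[OF x0_S p0_cl z1_TC] by (simp add: cderiv_G[OF x0_S])
    then have "Im (?F (Im_vec z1)) = \<mu> * (cmod \<eta>)\<^sup>2" using Re_F[of "Re_vec z1"] z1(1) by (simp add: complex_eq_iff)
    also have "\<dots> > 0" using \<mu>_pos z_nz by (simp add: \<eta>_def)
    finally show ?thesis by (simp add: \<xi>_eq Y_Re complex_eq_iff)
  qed
  ultimately have nz: "\<exists>X\<in>tangent_sub A ?N p0. restrict \<xi> (ctangent_sub A ?N p0) X \<noteq> 0"
    by (intro bexI[of _ Y]) (simp_all add: tangent_sub_def)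
  have "scalar_levi_nonneg A T ?N p0 (restrict \<xi> (ctangent_sub A ?N p0))"
    unfolding scalar_levi_nonneg_def
  proof (intro allI impI)
    fix W' Z' assume Z': "p0 \<in> W'" "Z' \<in> CR_sections_sub A T ?N W'"
    have sf: "smooth_field A W' Z'" using Z'(2) by (simp add: CR_sections_sub_def)
    let ?B = "cscale \<i> (bracket A Z' (field_conj Z') p0)" and ?q = "conj_deriv (field_comps c Z') x0"
    have "- ?B = coord_vec A c p0 (\<chi> i. complex_of_real (- 2 * Im (?q $ i)))"
      using levi_bracket_eq[OF sf, of p0] Z'(1) p0(2) by (simp add: x0_def)
    then have levi: "comps c (- ?B) = (\<chi> i. complex_of_real (- 2 * Im (?q $ i)))"
      by (simp only: comps_coord_vec[OF p0(2)])
    have neg: "comps c ?B $ i = - (comps c (- ?B) $ i)" for i by (simp add: comps_def)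
    have "comps c ?B $ i = complex_of_real (2 * Im (?q $ i))" for i unfolding neg levi by simp
    then have "Re_vec (comps c ?B) = 2 *\<^sub>R Im_vec ?q" "Im_vec (comps c ?B) = 0" by (simp_all add: vec_eq_iff)
    \<comment> \<open>The minus sign in \<open>scalar_levi\<close> turns the nonpositive derivative
      of \<open>Im G\<close> along \<open>Im_vec ?q\<close> into nonnegativity of the Levi
      form.\<close>
    then have "\<xi> ?B = complex_of_real (2 * Im (?F (Im_vec ?q)))"
      by (simp add: \<xi>_eq F0 linear_scale[OF has_derivative_linear[OF dG]])
    moreover have "Im (?F (Im_vec ?q)) \<le> 0" by (rule levi_Im_nonpos[OF \<mu> w_nz Z'(2,1)])
    moreover have "?B \<in> ctangent_sub A ?N p0" by (rule bracket_tangent_sub[OF Z'(2,1)])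
    ultimately show "0 \<le> scalar_levi A p0 (restrict \<xi> (ctangent_sub A ?N p0)) Z'"
      by (simp add: scalar_levi_def)
  qed
  with nz show ?thesis by (intro bexI[OF _ H0] conjI)
qed

end

theorem proposition5p15:
  fixes A :: "('a::{t2_space,second_countable_topology}, 'n::finite) chart set"
    and T :: "'a \<Rightarrow> 'a cvec set"
    and \<Omega> :: "'a set" and f :: "'a \<Rightarrow> complex" and p0 :: 'a and \<rho> :: "'a \<Rightarrow> real"
  assumes "almost_CR_manifold A T"
    and "open \<Omega>"
    and "f \<in> CR_functions A T \<Omega>"
    and "C2_on_set A (closure \<Omega>) f"
    and "p0 \<in> frontier \<Omega>"
    and "\<And>p. p \<in> \<Omega> \<Longrightarrow> cmod (f p0) > cmod (f p)"
    and "defining_function A \<Omega> p0 \<rho>"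
    and "Theta_noncharacteristic A T (frontier \<Omega>) p0"
  shows "\<exists>\<xi>\<in>H0_M A T \<Omega> p0 \<rho>. (\<exists>X\<in>tangent_sub A (frontier \<Omega>) p0. \<xi> X \<noteq> 0) \<and>
           scalar_levi_nonneg A T (frontier \<Omega>) p0 \<xi>"
proof -
  have "\<exists>c\<in>A. p0 \<in> fst c"
    using assms(1) unfolding almost_CR_manifold_def smooth_manifold_def by (metis UNIV_I UN_E)
  then obtain c where c: "c \<in> A" "p0 \<in> fst c" by blast
  obtain U where U: "p0 \<in> U" "smooth_fun A U (\<lambda>q. complex_of_real (\<rho> q))" "\<Omega> \<inter> U = {q \<in> U. \<rho> q < 0}"
    and d\<rho>: "\<exists>X\<in>tangent A p0. differential \<rho> X \<noteq> 0"
    using assms(7) unfolding defining_function_def by blast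
  have "p0 \<in> closure \<Omega>" using assms(5) by (simp add: frontier_def)
  then have "\<exists>V g. p0 \<in> V \<and> Ck_fun A 2 V g \<and> (\<forall>q\<in>V \<inter> closure \<Omega>. f q = g q)"
    using assms(4) unfolding C2_on_set_def by (rule bspec[rotated])
  then obtain V g where V: "p0 \<in> V" "Ck_fun A 2 V g" "\<forall>q\<in>V \<inter> closure \<Omega>. f q = g q"
    by (elim exE conjE) (rule that)
  have fg: "\<And>q. q \<in> V \<Longrightarrow> q \<in> closure \<Omega> \<Longrightarrow> f q = g q" using V(3) by simp
  interpret peak_point A T c \<Omega> f g p0 \<rho> U V
    by unfold_locales (fact assms(1-3,5,6) c U V(1,2) fg)+
  show ?thesis by (rule exists_covector[OF assms(8) d\<rho>])
qed

end
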